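(* Consider the Hamiltonian system $$\dot x=J_{2m}D_xH^0(x,I)+\varepsilon J_{2m}D_xH^1(x,I,\theta),\quad \dot I=-\varepsilon D_\theta H^1(x,I,\theta),\quad \dot\theta=D_IH^0(x,I)+\varepsilon D_IH^1(x,I,\theta)\qquad(\ast)$$ on $\mathbb{R}^{2m}\times V\times\mathbb{S}^1_{2\pi}$, and suppose that the following hold. (W1) For each $I\in V$, the equation $\dot x=J_{2m}D_xH^0(x,I)$ has $m$ $C^3$ first integrals $F_j(x,I)$, $j=1,\dots,m$, with $F_1(x,I)=H^0(x,I)$, such that $D_xF_j(x,I)$, $j=1,\dots,m$, are linearly independent except at equilibria and $D_xF_i(x,I)\cdot J_{2m}D_xF_j(x,I)=0$ for $i,j=1,\dots,m$. (W2) For each $I\in V$, the equation $\dot x=J_{2m}D_xH^0(x,I)$ has a hyperbolic equilibrium $x^I$ and an $(m-1)$-parameter family of homoclinic orbits $q^I(t;\alpha)$, $\alpha\in\bar V\subset\mathbb{R}^{m-1}$, to $x^I$, where $x^I$ and $q^I(t;\alpha)$ depend $C^2$-smoothly on $I$ and $\alpha$, and $\bar V$ is a connected open set in $\mathbb{R}^{m-1}$. (W3) $D_IH^0(q^I(t;\alpha),I)>0$ for $(I,\alpha)\in V\times\bar V$. Let $(I_0,\theta_0,\alpha_0)\in V\times\mathbb{S}^1_{2\pi}\times\bar V$. If $(\ast)$ has a $C^3$ first integral $F_{k,\varepsilon}(x,I,\theta)=F_k(x,I)+O(\varepsilon)$ for some $k=2,\dots,m$ (resp. $F_{m+1,\varepsilon}(x,I,\theta)=I+O(\varepsilon)$)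 depending $C^2$-smoothly on $\varepsilon$ in a neighborhood of $$\bar\Gamma^{\mathrm h}_{I_0,\theta_0,\alpha_0}=\{(q^{I_0}(t;\alpha_0),I_0,\theta^{I_0}(t;\alpha_0)+\theta_0)\mid t\in\mathbb{R}\}$$ together with the periodic orbit $\gamma^{\mathrm p}_{I_0}=\{(x^{I_0},I_0,\theta)\mid\theta\in\mathbb{S}^1_{2\pi}\}$ to which it is homoclinic, then there exists a connected open set $\bar\Pi\subset V\times\mathbb{S}^1_{2\pi}\times\bar V$ such that $(I_0,\theta_0,\alpha_0)\in\bar\Pi$ and the Melnikov function $\bar M^I_k(\theta,\alpha)=0$ (resp. $\bar M^I_1(\theta,\alpha)=0$) for all $(I,\theta,\alpha)\in\bar\Pi$.
   Context: $\varepsilon$ is a small parameter, $0\le\varepsilon\ll1$; $m\ge1$ is an integer; $V\subset\mathbb{R}$ is an open interval; $\mathbb{S}^1_{2\pi}=\mathbb{R}/2\pi\mathbb{Z}$; $I$ and $\theta$ are scalar; $H^0(x,I)$ and $H^1(x,I,\theta)$ are $C^3$ in $(x,I,\theta)$; $J_{2m}=\begin{pmatrix}0&\mathrm{id}_m\\-\mathrm{id}_m&0\end{pmatrix}$ with $\mathrm{id}_m$ the $m\times m$ identity matrix. The Hamiltonian is $H_\varepsilon=H^0+\varepsilon H^1$. Define $\theta^I(t;\alpha)=\int_0^tD_IH^0(q^I(s;\alpha),I)\,ds$ (read modulo $2\pi$ as an element of $\mathbb{S}^1_{2\pi}$). For $(I,\alpha)\in V\times\bar V$ let $\{T^{I,\alpha}_j\}_{j\in\mathbb{Z}}$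 be a sequence with $\theta^I(T^{I,\alpha}_j;\alpha)=0$ in $\mathbb{S}^1_{2\pi}$ for $j\in\mathbb{Z}$ and $\lim_{j\to\pm\infty}T^{I,\alpha}_j=\pm\infty$. The Melnikov functions are $$\bar M^I_1(\theta_0,\alpha)=\lim_{j\to\infty}\int_{T^{I,\alpha}_{-j}}^{T^{I,\alpha}_j}D_\theta H^1\bigl(q^I(t;\alpha),I,\theta^I(t;\alpha)+\theta_0\bigr)\,dt$$ and, for $k=2,\dots,m$, $$\bar M^I_k(\theta_0,\alpha)=\lim_{j\to\infty}\int_{T^{I,\alpha}_{-j}}^{T^{I,\alpha}_j}\Bigl(D_xF_k(q^I(t;\alpha),I)\cdot J_{2m}D_xH^1\bigl(q^I(t;\alpha),I,\theta^I(t;\alpha)+\theta_0\bigr)-D_IF_k(q^I(t;\alpha),I)\,D_\theta H^1\bigl(q^I(t;\alpha),I,\theta^I(t;\alpha)+\theta_0\bigr)\Bigr)dt .$$ *)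

theory Defs
  imports "HOL-Analysis.Analysis"
begin

text \<open>
  The phase space \<open>\<real>\<^sup>2\<^sup>m \<times> V \<times> S\<^sup>1\<close> with \<open>m = CARD('m)\<close> has \<open>\<real>\<^sup>2\<^sup>m\<close> rendered as
  \<open>real ^ ('m + 'm)\<close>, the summands \<open>Inl\<close>, \<open>Inr\<close> being the two blocks of \<open>J\<^sub>2\<^sub>m\<close>.
  A point of the circle \<open>\<real>/2\<pi>\<int>\<close> is given by a real angle \<open>\<theta>\<close>. Functions on the circle
  are \<open>2\<pi>\<close>-periodic functions of \<open>\<theta>\<close>; subsets of a product with the circle are written with
  \<open>sphere (0::complex) 1\<close> as the circle factor, the angle \<open>\<theta>\<close> corresponding to \<open>cis \<theta>\<close>.
\<close>

definition J2m :: "real ^ ('m::finite + 'm) ^ ('m + 'm)" where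
  "J2m = (\<chi> i j. case i of
      Inl a \<Rightarrow> (case j of Inl b \<Rightarrow> 0 | Inr b \<Rightarrow> if a = b then 1 else 0)
    | Inr a \<Rightarrow> (case j of Inl b \<Rightarrow> if a = b then - 1 else 0 | Inr b \<Rightarrow> 0))"

definition grad :: "('a::real_inner \<Rightarrow> real) \<Rightarrow> 'a \<Rightarrow> 'a" where
  "grad f x = (THE D. GDERIV f x :> D)"

text \<open>
  \<open>C\<^sup>k\<close> on \<open>S\<close>: for every direction \<open>v\<close>, \<open>f' v x\<close> is the value at \<open>v\<close> of the derivative
  of \<open>f\<close> at \<open>x\<close>. Derivatives are taken within \<open>S\<close>, so that on \<open>{0..<e} \<times> U\<close> with \<open>U\<close> open
  they are one-sided in the first variable at \<open>0\<close>.
\<close>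

primrec Ck_on :: "nat \<Rightarrow> ('a::real_normed_vector \<Rightarrow> 'b::real_normed_vector) \<Rightarrow> 'a set \<Rightarrow> bool" where
  "Ck_on 0 f S \<longleftrightarrow> continuous_on S f"
| "Ck_on (Suc k) f S \<longleftrightarrow>
     (\<exists>f'. (\<forall>x\<in>S. (f has_derivative (\<lambda>v. f' v x)) (at x within S)) \<and> (\<forall>v. Ck_on k (f' v) S))"

text \<open>
  No index type \<open>'n\<close> yields \<open>\<real>\<^sup>0\<close> as \<open>real ^ 'n\<close>, so \<open>\<real>\<^sup>n\<close> with \<open>n \<ge> 0\<close> is rendered as an
  arbitrary real inner product space type of dimension \<open>n\<close>; \<open>real ^ 'n\<close> is one for
  \<open>n = CARD('n)\<close>, and the instance of \<open>unit\<close> below is one for \<open>n = 0\<close>.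
\<close>

definition has_dimension :: "'a::real_inner itself \<Rightarrow> nat \<Rightarrow> bool" where
  "has_dimension _ n \<longleftrightarrow>
     (\<exists>B::'a set. finite B \<and> independent B \<and> span B = UNIV \<and> card B = n)"

instantiation unit :: real_inner
begin
definition zero_unit :: unit where "zero_unit = ()"
definition plus_unit :: "unit \<Rightarrow> unit \<Rightarrow> unit" where "plus_unit _ _ = ()"
definition scaleR_unit :: "real \<Rightarrow> unit \<Rightarrow> unit" where "scaleR_unit _ _ = ()"
definition norm_unit :: "unit \<Rightarrow> real" where "norm_unit _ = 0"
definition dist_unit :: "unit \<Rightarrow> unit \<Rightarrow> real" where "dist_unit _ _ = 0"
definition sgn_unit :: "unit \<Rightarrow> unit" where "sgn_unit _ = ()"
definition inner_unit :: "unit \<Rightarrow> unit \<Rightarrow> real" where "inner_unit _ _ = 0"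
definition uniformity_unit :: "(unit \<times> unit) filter" where
  "uniformity_unit = (INF e\<in>{0 <..}. principal {(x, y). dist x y < e})"
definition open_unit :: "unit set \<Rightarrow> bool" where
  "open_unit U \<longleftrightarrow> (\<forall>x\<in>U. eventually (\<lambda>(x', y). x' = x \<longrightarrow> y \<in> U) uniformity)"
instance
  by standard
    (simp_all add: uniformity_unit_def open_unit_def norm_unit_def dist_unit_def inner_unit_def)
end

lemma has_dimension_unit: "has_dimension TYPE(unit) 0"
  unfolding has_dimension_def by (intro exI[of _ "{}"]) (auto simp: independent_empty)

lemma has_dimension_vec: "has_dimension TYPE(real ^ 'n) CARD('n)"
  unfolding has_dimension_def
  by (intro exI[of _ Basis]) (auto simp: independent_Basis)

text \<open>A first integral is a differentiable function whose derivative along the vector field vanishes.\<close>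

definition first_integral_on ::
    "('a::real_normed_vector \<Rightarrow> 'a) \<Rightarrow> ('a \<Rightarrow> real) \<Rightarrow> 'a set \<Rightarrow> bool" where
  "first_integral_on X G S \<longleftrightarrow>
     (\<forall>z\<in>S. G differentiable (at z) \<and> frechet_derivative G (at z) (X z) = 0)"

definition hyperbolic_equilibrium :: "(real ^ 'n \<Rightarrow> real ^ 'n) \<Rightarrow> real ^ 'n \<Rightarrow> bool" where
  "hyperbolic_equilibrium X p \<longleftrightarrow>
     X p = 0 \<and> X differentiable (at p) \<and>
     (\<forall>(\<mu>::complex) (v::complex ^ 'n).
        v \<noteq> 0 \<and> map_matrix complex_of_real (jacobian X (at p)) *v v = \<mu> *s v \<longrightarrow> Re \<mu> \<noteq> 0)"

definition homoclinic_orbit ::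
    "('a::real_normed_vector \<Rightarrow> 'a) \<Rightarrow> 'a \<Rightarrow> (real \<Rightarrow> 'a) \<Rightarrow> bool" where
  "homoclinic_orbit X p c \<longleftrightarrow>
     (\<forall>t. (c has_vector_derivative X (c t)) (at t)) \<and> (\<forall>t. c t \<noteq> p) \<and>
     (c \<longlongrightarrow> p) at_top \<and> (c \<longlongrightarrow> p) at_bot"

definition xfield ::
    "(real ^ ('m::finite + 'm) \<Rightarrow> real \<Rightarrow> real) \<Rightarrow> real \<Rightarrow> real ^ ('m + 'm) \<Rightarrow> real ^ ('m + 'm)" where
  "xfield H0 I x = J2m *v grad (\<lambda>y. H0 y I) x"

definition full_field ::
    "(real ^ ('m::finite + 'm) \<Rightarrow> real \<Rightarrow> real) \<Rightarrow> (real ^ ('m + 'm) \<Rightarrow> real \<Rightarrow> real \<Rightarrow> real) \<Rightarrow> real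
     \<Rightarrow> (real ^ ('m + 'm)) \<times> real \<times> real \<Rightarrow> (real ^ ('m + 'm)) \<times> real \<times> real" where
  "full_field H0 H1 \<epsilon> = (\<lambda>(x, I, \<theta>).
     (J2m *v grad (\<lambda>y. H0 y I) x + \<epsilon> *\<^sub>R (J2m *v grad (\<lambda>y. H1 y I \<theta>) x),
      - \<epsilon> * deriv (\<lambda>s. H1 x I s) \<theta>,
      deriv (\<lambda>K. H0 x K) I + \<epsilon> * deriv (\<lambda>K. H1 x K \<theta>) I))"

definition theta_of ::
    "('x \<Rightarrow> real \<Rightarrow> real) \<Rightarrow> (real \<Rightarrow> real \<Rightarrow> 'a \<Rightarrow> 'x) \<Rightarrow> real \<Rightarrow> real \<Rightarrow> 'a \<Rightarrow> real" where
  "theta_of H0 q I t \<alpha> = (LBINT s=0..t. deriv (\<lambda>K. H0 (q I s \<alpha>) K) I)"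

definition melnikov1_seq ::
    "('x \<Rightarrow> real \<Rightarrow> real) \<Rightarrow> ('x \<Rightarrow> real \<Rightarrow> real \<Rightarrow> real) \<Rightarrow> (real \<Rightarrow> real \<Rightarrow> 'a \<Rightarrow> 'x)
     \<Rightarrow> (real \<Rightarrow> 'a \<Rightarrow> int \<Rightarrow> real) \<Rightarrow> real \<Rightarrow> real \<Rightarrow> 'a \<Rightarrow> nat \<Rightarrow> real" where
  "melnikov1_seq H0 H1 q T I \<theta> \<alpha> j =
     (LBINT t=T I \<alpha> (- int j)..T I \<alpha> (int j).
        deriv (\<lambda>s. H1 (q I t \<alpha>) I s) (theta_of H0 q I t \<alpha> + \<theta>))"

definition melnikov1 ::
    "('x \<Rightarrow> real \<Rightarrow> real) \<Rightarrow> ('x \<Rightarrow> real \<Rightarrow> real \<Rightarrow> real) \<Rightarrow> (real \<Rightarrow> real \<Rightarrow> 'a \<Rightarrow> 'x)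
     \<Rightarrow> (real \<Rightarrow> 'a \<Rightarrow> int \<Rightarrow> real) \<Rightarrow> real \<Rightarrow> real \<Rightarrow> 'a \<Rightarrow> real" where
  "melnikov1 H0 H1 q T I \<theta> \<alpha> = lim (melnikov1_seq H0 H1 q T I \<theta> \<alpha>)"

definition melnikov_seq ::
    "(real ^ ('m::finite + 'm) \<Rightarrow> real \<Rightarrow> real) \<Rightarrow> (real ^ ('m + 'm) \<Rightarrow> real \<Rightarrow> real \<Rightarrow> real)
     \<Rightarrow> (real ^ ('m + 'm) \<Rightarrow> real \<Rightarrow> real) \<Rightarrow> (real \<Rightarrow> real \<Rightarrow> 'a \<Rightarrow> real ^ ('m + 'm))
     \<Rightarrow> (real \<Rightarrow> 'a \<Rightarrow> int \<Rightarrow> real) \<Rightarrow> real \<Rightarrow> real \<Rightarrow> 'a \<Rightarrow> nat \<Rightarrow> real" where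
  "melnikov_seq H0 H1 Fk q T I \<theta> \<alpha> j =
     (LBINT t=T I \<alpha> (- int j)..T I \<alpha> (int j).
        grad (\<lambda>y. Fk y I) (q I t \<alpha>)
          \<bullet> (J2m *v grad (\<lambda>y. H1 y I (theta_of H0 q I t \<alpha> + \<theta>)) (q I t \<alpha>))
        - deriv (\<lambda>K. Fk (q I t \<alpha>) K) I
          * deriv (\<lambda>s. H1 (q I t \<alpha>) I s) (theta_of H0 q I t \<alpha> + \<theta>))"

definition melnikov ::
    "(real ^ ('m::finite + 'm) \<Rightarrow> real \<Rightarrow> real) \<Rightarrow> (real ^ ('m + 'm) \<Rightarrow> real \<Rightarrow> real \<Rightarrow> real)
     \<Rightarrow> (real ^ ('m + 'm) \<Rightarrow> real \<Rightarrow> real) \<Rightarrow> (real \<Rightarrow> real \<Rightarrow> 'a \<Rightarrow> real ^ ('m + 'm))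
     \<Rightarrow> (real \<Rightarrow> 'a \<Rightarrow> int \<Rightarrow> real) \<Rightarrow> real \<Rightarrow> real \<Rightarrow> 'a \<Rightarrow> real" where
  "melnikov H0 H1 Fk q T I \<theta> \<alpha> = lim (melnikov_seq H0 H1 Fk q T I \<theta> \<alpha>)"

definition angle_lift :: "('x \<times> real \<times> complex) set \<Rightarrow> ('x \<times> real \<times> real) set" where
  "angle_lift U = {(x, I, \<theta>). (x, I, cis \<theta>) \<in> U}"

text \<open>
  \<open>has_first_integral_near V H0 H1 F \<Gamma>\<close>: the perturbed system has, for all small \<open>\<epsilon> \<ge> 0\<close>,
  a \<open>C\<^sup>3\<close> first integral \<open>F\<^sub>\<epsilon> = F + O(\<epsilon>)\<close> on a neighbourhood of \<open>\<Gamma>\<close> in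
  \<open>\<real>\<^sup>2\<^sup>m \<times> V \<times> S\<^sup>1\<close>. The \<open>C\<^sup>2\<close> dependence on \<open>\<epsilon>\<close> is joint with the phase variables, and
  \<open>F\<^sub>\<epsilon>\<close> is \<open>C\<^sup>3\<close> in the phase variables for each fixed \<open>\<epsilon>\<close>.
\<close>

definition has_first_integral_near ::
    "real set \<Rightarrow> (real ^ ('m::finite + 'm) \<Rightarrow> real \<Rightarrow> real)
     \<Rightarrow> (real ^ ('m + 'm) \<Rightarrow> real \<Rightarrow> real \<Rightarrow> real) \<Rightarrow> (real ^ ('m + 'm) \<Rightarrow> real \<Rightarrow> real)
     \<Rightarrow> ((real ^ ('m + 'm)) \<times> real \<times> complex) set \<Rightarrow> bool" where
  "has_first_integral_near V H0 H1 F \<Gamma> \<longleftrightarrow>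
     (\<exists>\<epsilon>\<^sub>1>0. \<exists>U G.
        openin (top_of_set (UNIV \<times> V \<times> sphere 0 1)) U \<and> \<Gamma> \<subseteq> U \<and>
        (\<forall>\<epsilon>\<in>{0..<\<epsilon>\<^sub>1}.
           (\<forall>(x, I, \<theta>)\<in>angle_lift U. G \<epsilon> (x, I, \<theta> + 2 * pi) = G \<epsilon> (x, I, \<theta>)) \<and>
           Ck_on 3 (G \<epsilon>) (angle_lift U) \<and>
           first_integral_on (full_field H0 H1 \<epsilon>) (G \<epsilon>) (angle_lift U)) \<and>
        Ck_on 2 (\<lambda>(\<epsilon>, z). G \<epsilon> z) ({0..<\<epsilon>\<^sub>1} \<times> angle_lift U) \<and>
        (\<forall>(x, I, \<theta>)\<in>angle_lift U.
           (\<lambda>\<epsilon>. G \<epsilon> (x, I, \<theta>) - F x I) \<in> O[at_right 0](\<lambda>\<epsilon>. \<epsilon>)))"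

end

theory Submission
  imports Defs "HOL-Computational_Algebra.Fundamental_Theorem_Algebra"
begin

text \<open>
  The reason is a first variation argument. Let \<open>F\<^sub>\<epsilon>\<close> be conserved by the perturbed field
  \<open>X\<^sub>0 + \<epsilon> X\<^sub>1\<close>, and let \<open>c\<close> be an orbit \<open>t \<mapsto> (q\<^sup>I(t;\<alpha>), I, \<theta>\<^sup>I(t;\<alpha>) + \<theta>)\<close> of the unperturbed field
  \<open>X\<^sub>0\<close>. Then \<open>F\<^sub>\<epsilon> \<circ> c\<close> has derivative \<open>- \<epsilon> DF\<^sub>\<epsilon>(c) X\<^sub>1(c)\<close>; integrating over \<open>[a, b]\<close>, dividing by \<open>\<epsilon>\<close>
  and letting \<open>\<epsilon>\<close> tend to 0, the integral of \<open>DF\<^sub>0(c) X\<^sub>1(c)\<close>, which is the Melnikov integrand up to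
  sign, equals \<open>g(c a) - g(c b)\<close> with \<open>g = \<partial>F\<^sub>\<epsilon>/\<partial>\<epsilon>\<close> at \<open>\<epsilon> = 0\<close> (\<open>variation_along_orbit\<close>). At the times
  \<open>T\<^sub>j\<close> the angle of \<open>c\<close> is \<open>\<theta>\<close> modulo \<open>2\<pi>\<close>, so for \<open>j \<rightarrow> \<plusminus>\<infinity>\<close> both end points converge to \<open>(x\<^sup>I, I, \<theta>)\<close> on the
  circle, and the integrals tend to 0 (\<open>melnikov_integral_tendsto_0\<close>).

  This applies to \<open>(I, \<theta>, \<alpha>)\<close> only if the whole orbit and its limit lie in the neighbourhood on which
  \<open>F\<^sub>\<epsilon>\<close> is given (\<open>orbits_stay\<close>). On a compact time interval continuity suffices. For large \<open>\<bar>t\<bar>\<close> one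
  needs that \<open>q\<^sup>I(t;\<alpha>)\<close> is close to the equilibrium uniformly in \<open>(I, \<alpha>)\<close>, and this does not follow
  from continuity: a neighbouring orbit might come close to the equilibrium, leave again along the
  unstable manifold, and converge only after a second excursion. Most of the text excludes this
  (\<open>uniform_tail\<close>), as follows.

  The linearisation at the equilibrium has an exponential dichotomy: the equation \<open>u' = A u + f\<close> on the
  half-line has for every bounded \<open>f\<close> exactly one bounded solution with \<open>u(0)\<close> prescribed modulo the
  unstable space \<open>E\<close> (\<open>halfline_dichotomy\<close>). By contraction there is for every parameter near
  \<open>(I\<^sub>0, \<alpha>\<^sub>0)\<close> a solution that stays close to the equilibrium and starts in \<open>q\<^sup>I(T;\<alpha>) + E\<close>
  (\<open>bounded_solution_exists\<close>); it converges to the equilibrium (\<open>decay\<close>). Its initial value \<open>y\<close> and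
  \<open>q\<^sup>I(T;\<alpha>)\<close> therefore have the same values of all the first integrals \<open>F\<^sub>j\<close>, namely those at \<open>x\<^sup>I\<close>. On
  the other hand the common kernel of the \<open>DF\<^sub>j\<close> at \<open>q(T;\<alpha>\<^sub>0)\<close> for \<open>I = I\<^sub>0\<close> is spanned by the commuting
  Hamiltonian fields \<open>J \<nabla>F\<^sub>j\<close>; along the orbit these are bounded solutions of the variational equation,
  so the kernel meets \<open>E\<close> only in 0 (\<open>kernel_transversal\<close>). Hence two points of a common level set near
  \<open>q(T;\<alpha>\<^sub>0)\<close> that differ by a vector of \<open>E\<close> coincide, \<open>y = q\<^sup>I(T;\<alpha>)\<close>, and the orbit never leaves.
\<close>

section \<open>Scalar linear equations on the half-line\<close>

abbreviation solves :: "(real \<Rightarrow> 'a::real_normed_vector) \<Rightarrow> (real \<Rightarrow> 'a) \<Rightarrow> bool" where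
  "solves u f \<equiv> \<forall>t\<ge>0. (u has_vector_derivative f t) (at t within {0..})"

lemma at_within_atLeast_Icc:
  fixes t :: real
  assumes "0 \<le> t" "t < b"
  shows "at t within {0..b} = at t within {0..}"
  by (rule at_within_nhd[of _ "{..<b}"]) (use assms in auto)

text \<open>
  Variation of constants: \<open>exp (l t) K t\<close> solves \<open>g' = l g + \<phi>\<close>. The bound is written so that it is
  usable for either sign of \<open>Re l\<close>.
\<close>

lemma exp_weighted_integral:
  fixes l :: complex and \<phi> :: "real \<Rightarrow> complex"
  assumes rho: "Re l \<noteq> 0" and cont: "continuous_on {0..} \<phi>" and M: "\<And>t. 0 \<le> t \<Longrightarrow> norm (\<phi> t) \<le> M"
  obtains K where "K 0 = 0"
    and "\<And>t. 0 \<le> t \<Longrightarrow> (K has_vector_derivative exp (- l * of_real t) * \<phi> t) (at t within {0..})"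
    and "\<And>a b. 0 \<le> a \<Longrightarrow> a \<le> b \<Longrightarrow> norm (K b - K a) \<le> M * (exp (- Re l * a) - exp (- Re l * b)) / Re l"
proof -
  define w where "w s = exp (- l * of_real s) * \<phi> s" for s :: real
  define K where "K t = integral {0..t} w" for t
  have cw: "continuous_on {0..} w"
    unfolding w_def by (intro continuous_intros cont)
  have cw': "continuous_on {a..b} w" if "0 \<le> a" for a b
    by (rule continuous_on_subset[OF cw]) (use that in auto)
  have int: "w integrable_on {a..b}" if "0 \<le> a" for a b
    by (rule integrable_continuous_interval[OF cw'[OF that]])
  show thesis
  proof (rule that[of K])
    show "K 0 = 0" by (simp add: K_def)
  next
    fix t :: real assume t: "0 \<le> t"
    have "(K has_vector_derivative w t) (at t within {0..t+1})"
      unfolding K_def by (rule integral_has_vector_derivative[OF cw']) (use t in auto)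
    then show "(K has_vector_derivative exp (- l * of_real t) * \<phi> t) (at t within {0..})"
      using at_within_atLeast_Icc[of t "t+1"] t by (simp add: w_def)
  next
    fix a b :: real assume ab: "0 \<le> a" "a \<le> b"
    have "K a + integral {a..b} w = K b"
      unfolding K_def by (rule Henstock_Kurzweil_Integration.integral_combine) (use ab int in auto)
    then have eq: "K b - K a = integral {a..b} w" by (simp add: algebra_simps)
    define e where "e s = M * exp (- Re l * s)" for s
    have ei: "(e has_integral (- M * exp (- Re l * b) / Re l - (- M * exp (- Re l * a) / Re l))) {a..b}"
    proof (rule fundamental_theorem_of_calculus[OF ab(2)])
      fix x assume "x \<in> {a..b}"
      have "((\<lambda>s. - M * exp (- Re l * s) / Re l) has_real_derivative e x) (at x within {a..b})"
        unfolding e_def using rho by (auto intro!: derivative_eq_intros simp: field_simps)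
      then show "((\<lambda>s. - M * exp (- Re l * s) / Re l) has_vector_derivative e x) (at x within {a..b})"
        by (simp add: has_real_derivative_iff_has_vector_derivative)
    qed
    have "norm (integral {a..b} w) \<le> integral {a..b} e"
    proof (rule integral_norm_bound_integral[OF int[OF ab(1)] has_integral_integrable[OF ei]])
      fix x assume x: "x \<in> {a..b}"
      have "norm (w x) = exp (- Re l * x) * norm (\<phi> x)"
        by (simp add: w_def norm_mult)
      also have "\<dots> \<le> exp (- Re l * x) * M"
        using M[of x] x ab by (intro mult_left_mono) auto
      finally show "norm (w x) \<le> e x" by (simp add: e_def mult.commute)
    qed
    also have "\<dots> = M * (exp (- Re l * a) - exp (- Re l * b)) / Re l"
      using integral_unique[OF ei] by (simp add: algebra_simps diff_divide_distrib)
    finally show "norm (K b - K a) \<le> M * (exp (- Re l * a) - exp (- Re l * b)) / Re l"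
      using eq by simp
  qed
qed

lemma has_vector_derivative_exp_mult:
  fixes K :: "real \<Rightarrow> complex"
  assumes "(K has_vector_derivative exp (- l * of_real t) * p) (at t within S)"
  shows "((\<lambda>t. exp (l * of_real t) * K t) has_vector_derivative l * (exp (l * of_real t) * K t) + p) (at t within S)"
proof -
  have e: "((\<lambda>t. exp (l * of_real t)) has_vector_derivative (exp (l * of_real t) * l)) (at t within S)"
    by (rule has_vector_derivative_real_field)
       (auto intro!: derivative_eq_intros)
  have "exp (l * of_real t) * (exp (- l * of_real t) * p) = p"
    by (simp add: mult.assoc[symmetric] exp_add[symmetric])
  then show ?thesis
    using has_vector_derivative_mult[OF e assms] by (simp only: ) (simp only: ac_simps add.commute)
qed

lemma scalar_forced_stable:
  fixes l :: complex and \<phi> :: "real \<Rightarrow> complex"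
  assumes rho: "Re l < 0" and cont: "continuous_on {0..} \<phi>" and M: "\<And>t. 0 \<le> t \<Longrightarrow> norm (\<phi> t) \<le> M"
  obtains g where "g 0 = 0" "\<And>t. 0 \<le> t \<Longrightarrow> (g has_vector_derivative l * g t + \<phi> t) (at t within {0..})"
    "\<And>t. 0 \<le> t \<Longrightarrow> norm (g t) \<le> M / \<bar>Re l\<bar>"
proof -
  obtain K where K: "K 0 = 0"
    "\<And>t. 0 \<le> t \<Longrightarrow> (K has_vector_derivative exp (- l * of_real t) * \<phi> t) (at t within {0..})"
    "\<And>a b. 0 \<le> a \<Longrightarrow> a \<le> b \<Longrightarrow> norm (K b - K a) \<le> M * (exp (- Re l * a) - exp (- Re l * b)) / Re l"
    using exp_weighted_integral[of l \<phi> M] rho cont M by (metis less_irrefl)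
  have M0: "0 \<le> M" using M[of 0] norm_ge_zero order_trans by blast
  show thesis
  proof (rule that[of "\<lambda>t. exp (l * of_real t) * K t"])
    show "exp (l * complex_of_real 0) * K 0 = 0" by (simp add: K)
    fix t :: real assume t: "0 \<le> t"
    show "((\<lambda>t. exp (l * of_real t) * K t) has_vector_derivative l * (exp (l * of_real t) * K t) + \<phi> t) (at t within {0..})"
      by (rule has_vector_derivative_exp_mult[OF K(2)[OF t]])
    have "norm (exp (l * of_real t) * K t) \<le> exp (Re l * t) * (M * (1 - exp (- Re l * t)) / Re l)"
      unfolding norm_mult norm_exp_eq_Re using K(3)[of 0 t] t by (intro mult_mono) (auto simp: K)
    also have "\<dots> = M * (1 - exp (Re l * t)) / \<bar>Re l\<bar>"
      using rho by (simp add: field_simps exp_minus)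
    also have "\<dots> \<le> M / \<bar>Re l\<bar>"
      using M0 by (intro divide_right_mono) (auto simp: algebra_simps)
    finally show "norm (exp (l * of_real t) * K t) \<le> M / \<bar>Re l\<bar>" .
  qed
qed

text \<open>
  For \<open>Re l > 0\<close> the bounded solution is unique; it is obtained by integrating from infinity, that is, by
  subtracting the limit \<open>L\<close> of the weighted integral.
\<close>

lemma scalar_forced_unstable:
  fixes l :: complex and \<phi> :: "real \<Rightarrow> complex"
  assumes rho: "Re l > 0" and cont: "continuous_on {0..} \<phi>" and M: "\<And>t. 0 \<le> t \<Longrightarrow> norm (\<phi> t) \<le> M"
  obtains g where "\<And>t. 0 \<le> t \<Longrightarrow> (g has_vector_derivative l * g t + \<phi> t) (at t within {0..})"
    "\<And>t. 0 \<le> t \<Longrightarrow> norm (g t) \<le> M / \<bar>Re l\<bar>"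
proof -
  obtain K where K: "K 0 = 0"
    "\<And>t. 0 \<le> t \<Longrightarrow> (K has_vector_derivative exp (- l * of_real t) * \<phi> t) (at t within {0..})"
    "\<And>a b. 0 \<le> a \<Longrightarrow> a \<le> b \<Longrightarrow> norm (K b - K a) \<le> M * (exp (- Re l * a) - exp (- Re l * b)) / Re l"
    using exp_weighted_integral[of l \<phi> M] rho cont M by (metis less_irrefl)
  have M0: "0 \<le> M" using M[of 0] norm_ge_zero order_trans by blast
  have tail: "norm (K b - K a) \<le> M * exp (- Re l * a) / Re l" if "0 \<le> a" "a \<le> b" for a b
  proof (rule order_trans[OF K(3)[OF that]])
    show "M * (exp (- Re l * a) - exp (- Re l * b)) / Re l \<le> M * exp (- Re l * a) / Re l"
      using rho M0 by (intro divide_right_mono mult_left_mono) auto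
  qed
  have lim0: "(\<lambda>n. M * exp (- Re l * real n) / Re l) \<longlonglongrightarrow> 0"
  proof -
    have "filterlim (\<lambda>n. Re l * real n) at_top sequentially"
      using rho by (intro filterlim_tendsto_pos_mult_at_top[OF tendsto_const] filterlim_real_sequentially)
    then have "filterlim (\<lambda>n. - Re l * real n) at_bot sequentially"
      by (simp add: filterlim_uminus_at_top)
    then have "(\<lambda>n. exp (- Re l * real n)) \<longlonglongrightarrow> 0"
      by (rule filterlim_compose[OF exp_at_bot])
    from tendsto_mult[OF tendsto_const[of "M / Re l"] this] show ?thesis by simp
  qed
  have "Cauchy (\<lambda>n. K (real n))"
  proof (rule CauchyI')
    fix e :: real assume e: "0 < e"
    obtain N where N: "M * exp (- Re l * real N) / Re l < e / 2"
      using order_tendstoD(2)[OF lim0, of "e/2"] e by (auto simp: eventually_sequentially)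
    show "\<exists>M. \<forall>m\<ge>M. \<forall>n>m. dist (K (real m)) (K (real n)) < e"
    proof (intro exI allI impI)
      fix m n assume mn: "N \<le> m" "m < n"
      have "norm (K (real m) - K (real n)) \<le> norm (K (real m) - K (real N)) + norm (K (real n) - K (real N))"
        by (metis norm_triangle_ineq4 diff_diff_eq2 diff_add_cancel)
      also have "\<dots> \<le> 2 * (M * exp (- Re l * real N) / Re l)"
        using tail[of "real N" "real m"] tail[of "real N" "real n"] mn by auto
      also have "\<dots> < e" using N by linarith
      finally show "dist (K (real m)) (K (real n)) < e" by (simp add: dist_norm)
    qed
  qed
  then obtain L where L: "(\<lambda>n. K (real n)) \<longlonglongrightarrow> L"
    using Cauchy_convergent_iff convergentD by blast
  have tailL: "norm (L - K a) \<le> M * exp (- Re l * a) / Re l" if "0 \<le> a" for a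
  proof (rule tendsto_upperbound)
    show "(\<lambda>n. norm (K (real n) - K a)) \<longlonglongrightarrow> norm (L - K a)"
      by (intro tendsto_intros L)
    show "\<forall>\<^sub>F n in sequentially. norm (K (real n) - K a) \<le> M * exp (- Re l * a) / Re l"
      using eventually_ge_at_top[of "nat \<lceil>a\<rceil>"]
      by eventually_elim (use that tail in \<open>auto simp: nat_ceiling_le_eq\<close>)
  qed simp
  show thesis
  proof (rule that[of "\<lambda>t. exp (l * of_real t) * (K t - L)"])
    fix t :: real assume t: "0 \<le> t"
    have "((\<lambda>t. K t - L) has_vector_derivative exp (- l * of_real t) * \<phi> t) (at t within {0..})"
      using K(2)[OF t] by (auto intro!: derivative_eq_intros)
    then show "((\<lambda>t. exp (l * of_real t) * (K t - L)) has_vector_derivative l * (exp (l * of_real t) * (K t - L)) + \<phi> t) (at t within {0..})"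
      by (rule has_vector_derivative_exp_mult)
    have "norm (exp (l * of_real t) * (K t - L)) \<le> exp (Re l * t) * (M * exp (- Re l * t) / Re l)"
      unfolding norm_mult norm_exp_eq_Re using tailL[OF t] by (intro mult_mono) (auto simp: norm_minus_commute)
    also have "\<dots> = M / \<bar>Re l\<bar>" using rho by (simp add: exp_minus)
    finally show "norm (exp (l * of_real t) * (K t - L)) \<le> M / \<bar>Re l\<bar>" .
  qed
qed

section \<open>Spectral subspaces and forced linear systems\<close>

lemma norm_vector_smult: "norm (c *s v) = norm c * norm (v :: complex ^ 'n)"
proof -
  have "(\<Sum>i\<in>UNIV. (cmod c * cmod (v $ i))\<^sup>2) = (cmod c)\<^sup>2 * (\<Sum>i\<in>UNIV. (cmod (v $ i))\<^sup>2)"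
    by (simp add: power_mult_distrib sum_distrib_left)
  then show ?thesis
    by (simp add: norm_vec_def L2_set_def norm_mult real_sqrt_mult)
qed

lemma bounded_linear_vector_smult: "bounded_linear (\<lambda>c. c *s (w :: complex ^ 'n))"
proof (rule bounded_linear_intro[where K="norm w"])
  fix r :: real and c d :: complex
  show "(c + d) *s w = c *s w + d *s w" by (rule vector_sadd_rdistrib)
  show "(r *\<^sub>R c) *s w = r *\<^sub>R (c *s w)" by (simp add: vec_eq_iff)
  show "norm (c *s w) \<le> norm c * norm w" by (simp add: norm_vector_smult)
qed

lemma bounded_linear_cmatrix: "bounded_linear (\<lambda>v. (B :: complex ^ 'n ^ 'n) *v v)"
proof -
  have "linear (\<lambda>v. B *v v)"
  proof (rule linearI)
    fix r :: real and x y :: "complex ^ 'n"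
    show "B *v (x + y) = B *v x + B *v y" by (rule matrix_vector_right_distrib)
    show "B *v (r *\<^sub>R x) = r *\<^sub>R (B *v x)"
      by (simp add: vec_eq_iff matrix_vector_mult_def scaleR_sum_right)
  qed
  then show ?thesis by (simp add: linear_conv_bounded_linear)
qed

primrec factor_product :: "complex ^ 'n ^ 'n \<Rightarrow> complex list \<Rightarrow> complex ^ 'n \<Rightarrow> complex ^ 'n" where
  "factor_product B [] v = v"
| "factor_product B (l # ls) v = factor_product B ls (B *v v - l *s v)"

lemma factor_product_add: "factor_product B ls (v + w) = factor_product B ls v + factor_product B ls w"
proof (induction ls arbitrary: v w)
  case (Cons l ls)
  have "B *v (v + w) - l *s (v + w) = (B *v v - l *s v) + (B *v w - l *s w)"
    by (simp add: matrix_vector_right_distrib vector_add_ldistrib)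
  then show ?case by (simp only: factor_product.simps Cons)
qed simp

lemma factor_product_smult: "factor_product B ls (c *s v) = c *s factor_product B ls v"
proof (induction ls arbitrary: v)
  case (Cons l ls)
  have "B *v (c *s v) - l *s (c *s v) = c *s (B *v v - l *s v)"
    by (simp add: vector_scalar_commute vector_ssub_ldistrib vector_smult_assoc mult.commute)
  then show ?case by (simp only: factor_product.simps Cons)
qed simp

lemma factor_product_0 [simp]: "factor_product B ls 0 = 0"
  using factor_product_smult[of B ls 0 0] by simp

lemma factor_product_uminus: "factor_product B ls (- v) = - factor_product B ls v"
  using factor_product_smult[of B ls "-1" v] by simp

lemma factor_product_diff: "factor_product B ls (v - w) = factor_product B ls v - factor_product B ls w"
  using factor_product_add[of B ls v "-w"] by (simp add: factor_product_uminus)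

lemma factor_product_matrix: "factor_product B ls (B *v v) = B *v factor_product B ls v"
proof (induction ls arbitrary: v)
  case (Cons l ls)
  have "B *v (B *v v) - l *s (B *v v) = B *v (B *v v - l *s v)"
    by (simp add: matrix_vector_mult_diff_distrib vector_scalar_commute)
  then show ?case by (simp only: factor_product.simps Cons)
qed simp

lemma factor_product_shift: "factor_product B ls (B *v v - l *s v) = B *v factor_product B ls v - l *s factor_product B ls v"
  by (simp add: factor_product_diff factor_product_matrix factor_product_smult)

lemma factor_product_append: "factor_product B (ls @ ms) v = factor_product B ms (factor_product B ls v)"
  by (induction ls arbitrary: v) auto

lemma factor_product_commute: "factor_product B ls (factor_product B ms v) = factor_product B ms (factor_product B ls v)"
proof (induction ls arbitrary: v)
  case (Cons l ls)
  then show ?case by (simp add: factor_product_shift[symmetric])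
qed simp

text \<open>
  The sum of the generalised eigenspaces for the eigenvalues that satisfy \<open>P\<close>.
\<close>

definition spectral_space :: "complex ^ 'n ^ 'n \<Rightarrow> (complex \<Rightarrow> bool) \<Rightarrow> (complex ^ 'n) set" where
  "spectral_space B P = {v. \<exists>ls. (\<forall>l\<in>set ls. P l) \<and> factor_product B ls v = 0}"

lemma spectral_spaceI: "(\<And>l. l \<in> set ls \<Longrightarrow> P l) \<Longrightarrow> factor_product B ls v = 0 \<Longrightarrow> v \<in> spectral_space B P"
  by (auto simp: spectral_space_def)

lemma spectral_space_0: "0 \<in> spectral_space B P"
  by (rule spectral_spaceI[of "[]"]) auto

lemma spectral_space_add: "v \<in> spectral_space B P \<Longrightarrow> w \<in> spectral_space B P \<Longrightarrow> v + w \<in> spectral_space B P"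
proof -
  assume "v \<in> spectral_space B P" "w \<in> spectral_space B P"
  then obtain ls ms where lm: "\<forall>l\<in>set ls. P l" "factor_product B ls v = 0" "\<forall>l\<in>set ms. P l" "factor_product B ms w = 0"
    by (auto simp: spectral_space_def)
  have "factor_product B (ls @ ms) (v + w) = 0"
    using lm by (simp add: factor_product_append factor_product_add factor_product_commute[of B ms ls w])
  then show ?thesis using lm by (intro spectral_spaceI[of "ls @ ms"]) auto
qed

lemma spectral_space_smult: "v \<in> spectral_space B P \<Longrightarrow> c *s v \<in> spectral_space B P"
  by (auto simp: spectral_space_def factor_product_smult)

lemma spectral_space_sum: "(\<And>i. i \<in> S \<Longrightarrow> f i \<in> spectral_space B P) \<Longrightarrow> sum f S \<in> spectral_space B P"
  by (induction S rule: infinite_finite_induct) (auto intro: spectral_space_0 spectral_space_add)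

lemma spectral_space_shiftD:
  assumes "P l" "B *v v - l *s v \<in> spectral_space B P"
  shows "v \<in> spectral_space B P"
proof -
  obtain ls where "\<forall>l\<in>set ls. P l" "factor_product B ls (B *v v - l *s v) = 0"
    using assms(2) by (auto simp: spectral_space_def)
  then show ?thesis using assms(1) by (intro spectral_spaceI[of "l # ls"]) auto
qed

text \<open>
  Outside the eigenvalues admitted by \<open>P\<close> the operator \<open>B - l\<close> is onto the spectral space. The preimage is
  found by the resolvent identity \<open>(B - l) w = (B - m) w + (m - l) w\<close> and induction on the factors.
\<close>

lemma spectral_space_solve_shift:
  assumes "\<forall>m\<in>set ls. P m" "factor_product B ls w = 0" "\<not> P l"
  shows "\<exists>v\<in>spectral_space B P. B *v v - l *s v = w"
  using assms
proof (induction ls arbitrary: w)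
  case Nil
  then show ?case by (intro bexI[of _ 0]) (auto simp: spectral_space_0)
next
  case (Cons m ls)
  obtain v' where v': "v' \<in> spectral_space B P" "B *v v' - l *s v' = B *v w - m *s w"
    using Cons by auto
  have ml: "m - l \<noteq> 0" using Cons by auto
  have w: "w \<in> spectral_space B P" using Cons.prems by (intro spectral_spaceI[of "m # ls"]) auto
  \<comment> \<open>divides by \<open>m - l\<close>, nonzero because \<open>P m\<close> holds and \<open>P l\<close> does not\<close>
  define v where "v = inverse (m - l) *s (w + (-1) *s v')"
  have "v \<in> spectral_space B P" unfolding v_def using w v' by (intro spectral_space_smult spectral_space_add)
  moreover have "B *v v - l *s v = inverse (m - l) *s ((B *v w - l *s w) - (B *v v' - l *s v'))"
    unfolding v_def
    by (simp add: vector_scalar_commute matrix_vector_mult_diff_distrib vector_ssub_ldistrib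
         vector_smult_assoc mult.commute algebra_simps)
  moreover have "(B *v w - l *s w) - (B *v v' - l *s v') = (m - l) *s w"
    unfolding v'(2) by (simp add: vec_eq_iff algebra_simps)
  ultimately have "v \<in> spectral_space B P" "B *v v - l *s v = (inverse (m - l) * (m - l)) *s w"
    by (simp_all only: vector_smult_assoc)
  then show ?case using ml by (intro bexI[of _ v]) simp_all
qed

lemma diff_diff_swap_pairs: "a - b - (c - d) = a - c - (b - (d :: 'a :: ab_group_add))"
  by (simp add: algebra_simps)

lemma spectral_space_split_step:
  assumes P: "P l" "\<not> Q l" and a: "a \<in> spectral_space B P" and b: "b \<in> spectral_space B Q"
    and eq: "B *v v - l *s v = a + b"
  shows "\<exists>a\<in>spectral_space B P. \<exists>b\<in>spectral_space B Q. v = a + b"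
proof -
  obtain ms where "\<forall>m\<in>set ms. Q m" "factor_product B ms b = 0"
    using b by (auto simp: spectral_space_def)
  then obtain b' where b': "b' \<in> spectral_space B Q" "B *v b' - l *s b' = b"
    using spectral_space_solve_shift[of ms Q B b l] P by blast
  have "B *v (v - b') - l *s (v - b') = (B *v v - l *s v) - (B *v b' - l *s b')"
    unfolding matrix_vector_mult_diff_distrib vector_ssub_ldistrib by (rule diff_diff_swap_pairs)
  also have "\<dots> = a" unfolding eq b'(2) by (rule add_diff_cancel_right')
  finally have sh: "B *v (v - b') - l *s (v - b') = a" .
  have "v - b' \<in> spectral_space B P"
    by (rule spectral_space_shiftD[of P l, OF P(1)]) (unfold sh, rule a)
  moreover have "v = (v - b') + b'" by simp
  ultimately show ?thesis using b' by blast
qed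

text \<open>
  The primary decomposition, by induction on the factors: the \<open>Q\<close>-part of \<open>(B - l) v\<close> has a preimage in
  the \<open>Q\<close>-space if \<open>l\<close> belongs to \<open>P\<close>, and removing it from \<open>v\<close> leaves a vector of the \<open>P\<close>-space.
\<close>

lemma spectral_space_split:
  assumes "\<forall>l\<in>set ls. P l \<or> Q l" "factor_product B ls v = 0" "\<And>l. \<not> (P l \<and> Q l)"
  shows "\<exists>a\<in>spectral_space B P. \<exists>b\<in>spectral_space B Q. v = a + b"
  using assms(1,2)
proof (induction ls arbitrary: v)
  case Nil
  then show ?case by (intro bexI[of _ 0] spectral_space_0) auto
next
  case (Cons l ls)
  obtain a b where ab: "a \<in> spectral_space B P" "b \<in> spectral_space B Q" "B *v v - l *s v = a + b"
    using Cons.IH[of "B *v v - l *s v"] Cons.prems by auto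
  show ?case
  proof (cases "P l")
    case True
    then show ?thesis using spectral_space_split_step[of P l Q a B b v] ab assms(3) by blast
  next
    case False
    then have "Q l" using Cons.prems by auto
    then have "\<exists>b\<in>spectral_space B Q. \<exists>a\<in>spectral_space B P. v = b + a"
      using spectral_space_split_step[of Q l P b B a v] ab False by (simp add: add.commute)
    then show ?thesis by (metis add.commute)
  qed
qed

text \<open>
  The vector \<open>p(B) v\<close>, by the Horner scheme.
\<close>

definition poly_apply :: "complex ^ 'n ^ 'n \<Rightarrow> complex poly \<Rightarrow> complex ^ 'n \<Rightarrow> complex ^ 'n" where
  "poly_apply B p v = fold_coeffs (\<lambda>a w. a *s v + B *v w) p 0"

lemma poly_apply_0 [simp]: "poly_apply B 0 v = 0"
  by (simp add: poly_apply_def)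

lemma poly_apply_pCons [simp]: "poly_apply B (pCons a p) v = a *s v + B *v poly_apply B p v"
  by (cases "p = 0 \<and> a = 0") (auto simp: poly_apply_def)

lemma poly_apply_add: "poly_apply B (p + q) v = poly_apply B p v + poly_apply B q v"
proof (induction p arbitrary: q)
  case (pCons a p)
  obtain b q' where "q = pCons b q'" by (cases q)
  then show ?case using pCons by (simp add: matrix_vector_right_distrib vector_sadd_rdistrib)
qed simp

lemma poly_apply_smult: "poly_apply B (smult c p) v = c *s poly_apply B p v"
  by (induction p) (simp_all add: vector_add_ldistrib vector_smult_assoc vector_scalar_commute)

lemma poly_apply_monom: "poly_apply B (monom c i) v = c *s (((*v) B) ^^ i) v"
  by (induction i) (simp_all add: monom_0 monom_Suc vector_scalar_commute)

lemma poly_apply_linear_factor: "poly_apply B ([:- l, 1:] * p) v = B *v poly_apply B p v - l *s poly_apply B p v"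
proof -
  have "[:- l, 1:] * p = smult (- l) p + pCons 0 p" by simp
  then show ?thesis by (simp only: poly_apply_add poly_apply_smult poly_apply_pCons) simp
qed

lemma poly_apply_linear_factors: "poly_apply B (\<Prod>l\<leftarrow>ls. [:- l, 1:]) v = factor_product B ls v"
proof (induction ls)
  case (Cons l ls)
  then show ?case by (simp only: list.map prod_list.Cons poly_apply_linear_factor factor_product.simps factor_product_shift)
qed (simp add: one_pCons)

lemma nontrivial_relation:
  fixes x :: "nat \<Rightarrow> 'a::euclidean_space"
  shows "\<exists>c n. (\<exists>i\<le>n. c i \<noteq> 0) \<and> (\<Sum>i\<le>n. c i *\<^sub>R x i) = 0"
proof (cases "inj_on x {..DIM('a)}")
  case True
  have "\<not> independent (x ` {..DIM('a)})"
  proof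
    assume "independent (x ` {..DIM('a)})"
    then have "card (x ` {..DIM('a)}) \<le> DIM('a)" by (rule independent_bound[THEN conjunct2])
    then show False using card_image[OF True] by simp
  qed
  then obtain u where u: "\<exists>v\<in>x ` {..DIM('a)}. u v \<noteq> 0" "(\<Sum>v\<in>x ` {..DIM('a)}. u v *\<^sub>R v) = 0"
    using dependent_finite[of "x ` {..DIM('a)}"] by auto
  then show ?thesis
    using sum.reindex[OF True, of "\<lambda>v. u v *\<^sub>R v"]
    by (intro exI[of _ "\<lambda>i. u (x i)"] exI[of _ "DIM('a)"]) auto
next
  case False
  then obtain i j where ij: "i \<le> DIM('a)" "j \<le> DIM('a)" "i \<noteq> j" "x i = x j" by (auto simp: inj_on_def)
  define c where "c k = (if k = i then 1 else if k = j then -1 else 0 :: real)" for k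
  have "(\<Sum>k\<le>DIM('a). c k *\<^sub>R x k) = (\<Sum>k\<in>{i,j}. c k *\<^sub>R x k)"
    by (rule sum.mono_neutral_right) (use ij in \<open>auto simp: c_def\<close>)
  also have "\<dots> = 0" using ij by (auto simp: c_def)
  finally show ?thesis using ij by (intro exI[of _ c] exI[of _ "DIM('a)"]) (auto simp: c_def)
qed

text \<open>
  The iterates \<open>B\<^sup>i v\<close> are linearly dependent, which gives a polynomial in \<open>B\<close> that annihilates \<open>v\<close>; it splits
  into linear factors over the complex numbers.
\<close>

lemma annihilating_list_exists: "\<exists>ls. factor_product B ls v = 0"
proof -
  obtain c n where c: "\<exists>i\<le>n. c i \<noteq> 0" "(\<Sum>i\<le>n. c i *\<^sub>R (((*v) B) ^^ i) v) = 0"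
    using nontrivial_relation[of "\<lambda>i. (((*v) B) ^^ i) v"] by auto
  define p :: "complex poly" where "p = (\<Sum>i\<le>n. monom (of_real (c i)) i)"
  have "poly_apply B p v = (\<Sum>i\<le>n. complex_of_real (c i) *s (((*v) B) ^^ i) v)"
    unfolding p_def by (induction n) (simp_all add: poly_apply_monom poly_apply_add)
  also have "\<dots> = (\<Sum>i\<le>n. c i *\<^sub>R (((*v) B) ^^ i) v)"
    by (intro sum.cong refl) (simp only: vec_eq_iff vector_smult_component vector_scaleR_component, simp add: scaleR_conv_of_real)
  finally have pv: "poly_apply B p v = 0" using c by simp
  have "p \<noteq> 0"
  proof
    assume "p = 0"
    obtain i where i: "i \<le> n" "c i \<noteq> 0" using c by auto
    have "coeff p i = of_real (c i)" using i by (simp add: p_def coeff_sum)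
    then show False using \<open>p = 0\<close> i by simp
  qed
  then obtain ls where ls: "p = smult (lead_coeff p) (\<Prod>x\<leftarrow>ls. [:- x, 1:])"
    using alg_closed_imp_factorization[of p] by (metis ex_mset mset_map prod_mset_prod_list)
  have "lead_coeff p *s factor_product B ls v = 0"
    using pv by (subst (asm) ls) (simp only: poly_apply_smult poly_apply_linear_factors)
  then have "factor_product B ls v = 0" using \<open>p \<noteq> 0\<close> by (simp add: vector_mul_eq_0)
  then show ?thesis by blast
qed

text \<open>
  A factor \<open>B - l\<close> that is injective can be cancelled.
\<close>

lemma annihilating_eigenvalues:
  assumes "factor_product B ls v = 0"
  shows "\<exists>ms. (\<forall>l\<in>set ms. \<exists>w. w \<noteq> 0 \<and> B *v w = l *s w) \<and> factor_product B ms v = 0"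
  using assms
proof (induction ls arbitrary: v)
  case (Cons l ls)
  obtain ms where ms: "\<forall>l\<in>set ms. \<exists>w. w \<noteq> 0 \<and> B *v w = l *s w" "factor_product B ms (B *v v - l *s v) = 0"
    using Cons.IH[of "B *v v - l *s v"] Cons.prems by (auto simp only: factor_product.simps)
  show ?case
  proof (cases "factor_product B ms v = 0")
    case False
    have "B *v factor_product B ms v = l *s factor_product B ms v" using ms(2) by (simp add: factor_product_shift)
    then show ?thesis using ms False by (intro exI[of _ "l # ms"]) auto
  qed (use ms in auto)
next
  case Nil
  then show ?case by (intro exI[of _ "[]"]) auto
qed


lemma continuous_on_of_vector_derivative:
  assumes "\<And>t. 0 \<le> t \<Longrightarrow> (g has_vector_derivative d t) (at t within {0..})"
  shows "continuous_on {0..} (g :: real \<Rightarrow> 'a::real_normed_vector)"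
  by (rule continuous_on_vector_derivative[of _ _ d]) (use assms in auto)

lemma has_vector_derivative_smult:
  fixes w :: "complex ^ 'n"
  assumes "(g has_vector_derivative g') (at t within S)"
  shows "((\<lambda>t. g t *s w) has_vector_derivative g' *s w) (at t within S)"
  using bounded_linear.has_vector_derivative[OF bounded_linear_vector_smult assms] .

text \<open>
  Solvability of the equation with a forcing term in the fixed direction \<open>w\<close>. The initial value is not
  prescribed but lies in the unstable space.
\<close>

definition solvable_forced :: "complex ^ 'n ^ 'n \<Rightarrow> complex ^ 'n \<Rightarrow> real \<Rightarrow> bool" where
  "solvable_forced B w C \<longleftrightarrow> C \<ge> 0 \<and>
    (\<forall>\<phi> M. continuous_on {0..} \<phi> \<longrightarrow> (\<forall>t\<ge>0. norm (\<phi> t) \<le> M) \<longrightarrow>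
      (\<exists>u. u 0 \<in> spectral_space B (\<lambda>l. Re l > 0) \<and> solves u (\<lambda>t. B *v u t + \<phi> t *s w) \<and>
           (\<forall>t\<ge>0. norm (u t) \<le> C * M)))"

lemma solvable_forcedD:
  assumes "solvable_forced B w C" "continuous_on {0..} \<phi>" "\<And>t. 0 \<le> t \<Longrightarrow> norm (\<phi> t) \<le> M"
  shows "\<exists>u. u 0 \<in> spectral_space B (\<lambda>l. Re l > 0) \<and> solves u (\<lambda>t. B *v u t + \<phi> t *s w) \<and>
    (\<forall>t\<ge>0. norm (u t) \<le> C * M)"
  by (rule assms(1)[unfolded solvable_forced_def, THEN conjunct2, rule_format, OF assms(2,3)])

text \<open>
  The inductive step along a chain of generalised eigenvectors: \<open>g\<close> takes care of the eigenvalue, and the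
  error \<open>B w - l w\<close> lies further down the chain and becomes the forcing term of \<open>v\<close>.
\<close>

lemma solves_add_component:
  fixes w :: "complex ^ 'n"
  assumes g: "(g has_vector_derivative l * g t + p) (at t within {0..})"
    and v: "(v has_vector_derivative B *v v t + g t *s (B *v w - l *s w)) (at t within {0..})"
  shows "((\<lambda>t. g t *s w + v t) has_vector_derivative B *v (g t *s w + v t) + p *s w) (at t within {0..})"
proof -
  have "(l * g t + p) *s w + (B *v v t + g t *s (B *v w - l *s w)) = B *v (g t *s w + v t) + p *s w"
    unfolding matrix_vector_right_distrib vector_scalar_commute by (simp add: vec_eq_iff algebra_simps)
  then show ?thesis
    using has_vector_derivative_add[OF has_vector_derivative_smult[OF g, of w] v] by (simp only:)
qed

lemma norm_add_component:
  fixes w :: "complex ^ 'n"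
  assumes "norm a \<le> m" "norm x \<le> C * m"
  shows "norm (a *s w + x) \<le> (norm w + C) * m"
proof -
  have "norm (a *s w + x) \<le> norm a * norm w + norm x" by (metis norm_triangle_ineq norm_vector_smult)
  also have "\<dots> \<le> m * norm w + C * m" using assms by (intro add_mono mult_right_mono) auto
  finally show ?thesis by (simp add: algebra_simps)
qed

lemma forced_solution:
  assumes "(\<forall>l\<in>set ls. Re l < 0) \<or> (\<forall>l\<in>set ls. Re l > 0)" "factor_product B ls w = 0"
  shows "\<exists>C. solvable_forced B w C"
  using assms
proof (induction ls arbitrary: w)
  case Nil
  then show ?case
    unfolding solvable_forced_def
    by (intro exI[of _ 0]) (auto intro!: exI[of _ "\<lambda>_. 0"] derivative_eq_intros spectral_space_0)
next
  case (Cons l ls)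
  let ?U = "spectral_space B (\<lambda>l. Re l > 0)"
  obtain C where C: "solvable_forced B (B *v w - l *s w) C" using Cons by auto
  have sign: "Re l < 0 \<or> (Re l > 0 \<and> w \<in> ?U)"
  proof (cases "Re l < 0")
    case False
    then have pos: "\<forall>m\<in>set (l # ls). Re m > 0" using Cons.prems(1) by auto
    have "w \<in> ?U" by (rule spectral_spaceI[OF _ Cons.prems(2)]) (use pos in blast)
    then show ?thesis using pos by simp
  qed simp
  have "\<exists>u. u 0 \<in> ?U \<and> solves u (\<lambda>t. B *v u t + \<phi> t *s w) \<and>
         (\<forall>t\<ge>0. norm (u t) \<le> (norm w + C) / \<bar>Re l\<bar> * M)"
    if \<phi>: "continuous_on {0..} \<phi>" "\<forall>t\<ge>0. norm (\<phi> t) \<le> M" for \<phi> M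
  proof -
    obtain g where g: "\<And>t. 0 \<le> t \<Longrightarrow> (g has_vector_derivative l * g t + \<phi> t) (at t within {0..})"
      "\<And>t. 0 \<le> t \<Longrightarrow> norm (g t) \<le> M / \<bar>Re l\<bar>" and g0: "g 0 *s w \<in> ?U"
    proof (cases "Re l < 0")
      case True
      obtain g where "g 0 = 0" "\<And>t. 0 \<le> t \<Longrightarrow> (g has_vector_derivative l * g t + \<phi> t) (at t within {0..})"
        "\<And>t. 0 \<le> t \<Longrightarrow> norm (g t) \<le> M / \<bar>Re l\<bar>"
        using scalar_forced_stable[OF True \<phi>(1), of M] \<phi>(2) by metis
      then show ?thesis by (intro that[of g]) (simp_all add: spectral_space_0)
    next
      case False
      then have l: "Re l > 0" "w \<in> ?U" using sign by auto
      obtain g where "\<And>t. 0 \<le> t \<Longrightarrow> (g has_vector_derivative l * g t + \<phi> t) (at t within {0..})"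
        "\<And>t. 0 \<le> t \<Longrightarrow> norm (g t) \<le> M / \<bar>Re l\<bar>"
        using scalar_forced_unstable[OF l(1) \<phi>(1), of M] \<phi>(2) by metis
      then show ?thesis by (intro that[of g]) (simp_all add: spectral_space_smult[OF l(2)])
    qed
    from solvable_forcedD[OF C continuous_on_of_vector_derivative[OF g(1)] g(2)]
    obtain v where "v 0 \<in> ?U \<and> solves v (\<lambda>t. B *v v t + g t *s (B *v w - l *s w)) \<and>
      (\<forall>t\<ge>0. norm (v t) \<le> C * (M / \<bar>Re l\<bar>))" ..
    then have v: "v 0 \<in> ?U" "solves v (\<lambda>t. B *v v t + g t *s (B *v w - l *s w))"
      "\<And>t. 0 \<le> t \<Longrightarrow> norm (v t) \<le> C * (M / \<bar>Re l\<bar>)" by auto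
    show ?thesis
    proof (intro exI[of _ "\<lambda>t. g t *s w + v t"] conjI allI impI)
      show "g 0 *s w + v 0 \<in> ?U" by (rule spectral_space_add[OF g0 v(1)])
      fix t :: real assume t: "t \<ge> 0"
      show "((\<lambda>t. g t *s w + v t) has_vector_derivative B *v (g t *s w + v t) + \<phi> t *s w) (at t within {0..})"
        by (rule solves_add_component[OF g(1)[OF t]]) (use v(2) t in blast)
      show "norm (g t *s w + v t) \<le> (norm w + C) / \<bar>Re l\<bar> * M"
        using norm_add_component[OF g(2)[OF t] v(3)[OF t], of w] by simp
    qed
  qed
  moreover have "(norm w + C) / \<bar>Re l\<bar> \<ge> 0" using C by (auto simp: solvable_forced_def)
  ultimately show ?case unfolding solvable_forced_def by blast
qed

lemma homogeneous_solution:
  assumes "w \<in> spectral_space B (\<lambda>l. Re l < 0)"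
  shows "\<exists>C u. C \<ge> 0 \<and> u 0 - w \<in> spectral_space B (\<lambda>l. Re l > 0) \<and> solves u (\<lambda>t. B *v u t) \<and> (\<forall>t\<ge>0. norm (u t) \<le> C)"
proof -
  obtain ls where ls: "\<forall>l\<in>set ls. Re l < 0" "factor_product B ls w = 0" using assms by (auto simp: spectral_space_def)
  show ?thesis
  proof (cases ls)
    case Nil
    then show ?thesis
      using ls by (intro exI[of _ 0] exI[of _ "\<lambda>_. 0"]) (auto intro!: derivative_eq_intros spectral_space_0)
  next
    case (Cons l ms)
    have rho: "Re l < 0" using ls Cons by auto
    obtain C where C: "solvable_forced B (B *v w - l *s w) C"
      using forced_solution[of ms B "B *v w - l *s w"] ls Cons by auto
    define g where "g t = exp (l * of_real t)" for t :: real
    have g: "(g has_vector_derivative l * g t + 0) (at t within S)" for t S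
      unfolding g_def
      by (rule has_vector_derivative_real_field) (auto intro!: derivative_eq_intros)
    have g1: "norm (g t) \<le> 1" if "0 \<le> t" for t
      using rho that by (simp add: g_def mult_nonpos_nonneg)
    from solvable_forcedD[OF C continuous_on_of_vector_derivative[OF g] g1]
    obtain v where "v 0 \<in> spectral_space B (\<lambda>l. Re l > 0) \<and> solves v (\<lambda>t. B *v v t + g t *s (B *v w - l *s w)) \<and>
      (\<forall>t\<ge>0. norm (v t) \<le> C * 1)" ..
    then have v: "v 0 \<in> spectral_space B (\<lambda>l. Re l > 0)" "solves v (\<lambda>t. B *v v t + g t *s (B *v w - l *s w))"
      "\<And>t. 0 \<le> t \<Longrightarrow> norm (v t) \<le> C * 1" by auto
    show ?thesis
    proof (intro exI[of _ "norm w + C"] exI[of _ "\<lambda>t. g t *s w + v t"] conjI allI impI)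
      show "0 \<le> norm w + C" using C by (auto simp: solvable_forced_def)
      show "g 0 *s w + v 0 - w \<in> spectral_space B (\<lambda>l. Re l > 0)" using v(1) by (simp add: g_def)
      fix t :: real assume t: "t \<ge> 0"
      have "((\<lambda>t. g t *s w + v t) has_vector_derivative B *v (g t *s w + v t) + 0 *s w) (at t within {0..})"
        by (rule solves_add_component[OF g]) (use v(2) t in blast)
      then show "((\<lambda>t. g t *s w + v t) has_vector_derivative B *v (g t *s w + v t)) (at t within {0..})" by simp
      show "norm (g t *s w + v t) \<le> norm w + C"
        using norm_add_component[OF g1[OF t] v(3)[OF t], of w] by simp
    qed
  qed
qed

text \<open>
  The weight \<open>exp (- 2 K t)\<close> makes the squared norm monotone when \<open>K\<close> bounds the growth rate.
\<close>

lemma weighted_norm_derivative: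
  fixes u :: "real \<Rightarrow> 'a::real_inner"
  assumes "(u has_vector_derivative d) (at t within S)"
  shows "((\<lambda>t. exp (- 2 * K * t) * (u t \<bullet> u t)) has_real_derivative
           exp (- 2 * K * t) * (2 * (u t \<bullet> d) - 2 * K * (u t \<bullet> u t))) (at t within S)"
proof -
  have "((\<lambda>t. u t \<bullet> u t) has_vector_derivative (u t \<bullet> d + d \<bullet> u t)) (at t within S)"
    by (rule bounded_bilinear.has_vector_derivative[OF bounded_bilinear_inner assms assms])
  then have "((\<lambda>t. u t \<bullet> u t) has_real_derivative (u t \<bullet> d + d \<bullet> u t)) (at t within S)"
    by (simp add: has_real_derivative_iff_has_vector_derivative)
  then show ?thesis
    by (auto intro!: derivative_eq_intros simp: algebra_simps inner_commute)
qed

lemma linear_growth_eq_0: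
  fixes u :: "real \<Rightarrow> 'a::real_inner"
  assumes u: "\<And>t. t \<in> {0..b} \<Longrightarrow> (u has_vector_derivative d t) (at t within {0..b})"
    and d: "\<And>t. t \<in> {0..b} \<Longrightarrow> norm (d t) \<le> K * norm (u t)"
    and "u 0 = 0" "0 \<le> b"
  shows "u b = 0"
proof -
  define \<psi> where "\<psi> t = exp (- 2 * K * t) * (u t \<bullet> u t)" for t
  have der: "(\<psi> has_real_derivative exp (- 2 * K * t) * (2 * (u t \<bullet> d t) - 2 * K * (u t \<bullet> u t))) (at t within {0..b})"
    if "t \<in> {0..b}" for t
    unfolding \<psi>_def by (rule weighted_norm_derivative[OF u[OF that]])
  have "\<psi> b \<le> \<psi> 0"
  proof (rule DERIV_nonpos_imp_decreasing_open[OF \<open>0 \<le> b\<close>])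
    fix x assume x: "0 < x" "x < b"
    have "u x \<bullet> d x \<le> norm (u x) * norm (d x)" by (rule norm_cauchy_schwarz)
    also have "\<dots> \<le> norm (u x) * (K * norm (u x))" using d[of x] x by (intro mult_left_mono) auto
    finally have "2 * (u x \<bullet> d x) - 2 * K * (u x \<bullet> u x) \<le> 0"
      by (simp add: power2_norm_eq_inner[symmetric] power2_eq_square algebra_simps)
    then have "exp (- 2 * K * x) * (2 * (u x \<bullet> d x) - 2 * K * (u x \<bullet> u x)) \<le> 0"
      by (intro mult_nonneg_nonpos) auto
    moreover have "at x within {0..b} = at x"
      using x by (intro at_within_interior) auto
    ultimately show "\<exists>y. DERIV \<psi> x :> y \<and> y \<le> 0" using der[of x] x by auto
  next
    show "continuous_on {0..b} \<psi>"
      using der by (intro DERIV_continuous_on)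
  qed
  then have "u b \<bullet> u b \<le> 0" using \<open>u 0 = 0\<close> by (simp add: \<psi>_def mult_le_0_iff)
  then show ?thesis by (metis inner_ge_zero inner_eq_zero_iff order_antisym)
qed

lemma linear_growth_eq_0_halfline:
  fixes u :: "real \<Rightarrow> 'a::real_inner"
  assumes u: "\<And>t. t \<ge> 0 \<Longrightarrow> (u has_vector_derivative d t) (at t within {0..})"
    and d: "\<And>t. t \<ge> 0 \<Longrightarrow> norm (d t) \<le> K * norm (u t)"
    and "u 0 = 0" "0 \<le> t"
  shows "u t = 0"
  by (rule linear_growth_eq_0[of t u d K])
     (use assms has_vector_derivative_within_subset[OF u, of _ "{0..t}"] in auto)

lemma inner_vector_smult: "v \<bullet> (c *s v) = Re c * (v \<bullet> (v :: complex ^ 'n))"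
  by (simp add: inner_vec_def inner_complex_def sum_distrib_left algebra_simps)

text \<open>
  Induction on the factors reduces the claim to \<open>u' = l u\<close> with \<open>Re l > 0\<close>, whose nonzero solutions grow
  exponentially.
\<close>

lemma unstable_bounded_eq_0:
  assumes "\<forall>l\<in>set ls. Re l > 0" "factor_product B ls (u 0) = 0"
    and "\<And>t. t \<ge> 0 \<Longrightarrow> (u has_vector_derivative B *v u t) (at t within {0..})"
    and "\<And>t. t \<ge> 0 \<Longrightarrow> norm (u t) \<le> M" and "t \<ge> 0"
  shows "u t = 0"
  using assms
proof (induction ls arbitrary: u M t)
  case Nil
  obtain K where "\<And>x. norm (B *v x) \<le> norm x * K"
    using bounded_linear.bounded[OF bounded_linear_cmatrix[of B]] by auto
  then show ?case
    using linear_growth_eq_0_halfline[of u "\<lambda>t. B *v u t" K t] Nil by (auto simp: mult.commute)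
next
  case (Cons l ls)
  obtain K where K: "\<And>x. norm (B *v x) \<le> norm x * K"
    using bounded_linear.bounded[OF bounded_linear_cmatrix[of B]] by auto
  have bl: "bounded_linear (\<lambda>x. B *v x - l *s x)"
  proof -
    have "mat l *v x = l *s x" for x :: "complex ^ 'a"
      by (simp add: vec_eq_iff matrix_vector_mult_def mat_def if_distrib if_distribR sum.delta cong: if_cong)
    then have me: "(\<lambda>x. mat l *v x) = ((*s) l :: complex ^ 'a \<Rightarrow> _)" by (rule ext)
    have "bounded_linear (\<lambda>x :: complex ^ 'a. mat l *v x)" by (rule bounded_linear_cmatrix)
    then have "bounded_linear ((*s) l :: complex ^ 'a \<Rightarrow> _)" by (simp only: me)
    then show ?thesis by (intro bounded_linear_sub bounded_linear_cmatrix)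
  qed
  obtain K' where K': "\<And>x. norm (B *v x - l *s x) \<le> norm x * K'"
    using bounded_linear.bounded[OF bl] by auto
  have u': "B *v u t - l *s u t = 0" if "t \<ge> 0" for t
  proof (rule Cons.IH[of "\<lambda>t. B *v u t - l *s u t" "M * \<bar>K'\<bar>"])
    show "\<forall>l\<in>set ls. 0 < Re l" "factor_product B ls (B *v u 0 - l *s u 0) = 0" using Cons.prems by auto
    show "0 \<le> t" by fact
    fix s :: real assume s: "0 \<le> s"
    have "((\<lambda>t. B *v u t - l *s u t) has_vector_derivative B *v (B *v u s) - l *s (B *v u s)) (at s within {0..})"
      by (rule bounded_linear.has_vector_derivative[OF bl Cons.prems(3)[OF s]])
    moreover have "B *v (B *v u s) - l *s (B *v u s) = B *v (B *v u s - l *s u s)"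
      by (simp add: matrix_vector_mult_diff_distrib vector_scalar_commute)
    ultimately show "((\<lambda>t. B *v u t - l *s u t) has_vector_derivative B *v (B *v u s - l *s u s)) (at s within {0..})"
      by simp
    have "norm (B *v u s - l *s u s) \<le> norm (u s) * \<bar>K'\<bar>"
      using K'[of "u s"] by (smt (verit) mult_left_mono norm_ge_zero)
    also have "\<dots> \<le> M * \<bar>K'\<bar>" using Cons.prems(4)[OF s] by (intro mult_right_mono) auto
    finally show "norm (B *v u s - l *s u s) \<le> M * \<bar>K'\<bar>" .
  qed
  have rho: "Re l > 0" using Cons.prems by auto
  define \<psi> where "\<psi> t = exp (- 2 * Re l * t) * (u t \<bullet> u t)" for t
  have der: "(\<psi> has_real_derivative 0) (at t within {0..})" if "t \<in> {0..}" for t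
  proof -
    have "2 * (u t \<bullet> (B *v u t)) - 2 * Re l * (u t \<bullet> u t) = 0"
      using u'[of t] that by (simp add: inner_vector_smult)
    then show ?thesis
      using weighted_norm_derivative[OF Cons.prems(3)[of t], of "Re l"] that unfolding \<psi>_def by simp
  qed
  have const: "\<psi> t = u 0 \<bullet> u 0" if "t \<ge> 0" for t
  proof -
    have "\<psi> t = \<psi> 0"
      by (rule has_field_derivative_zero_constant[of "{0..}", OF _ der, THEN exE]) (use that in auto)
    then show ?thesis by (simp add: \<psi>_def)
  qed
  have "u 0 \<bullet> u 0 \<le> 0"
  proof (rule tendsto_lowerbound)
    have "filterlim (\<lambda>t. 2 * Re l * t) at_top at_top"
      using rho by (intro filterlim_tendsto_pos_mult_at_top[OF tendsto_const] filterlim_ident) auto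
    then have "filterlim (\<lambda>t. - 2 * Re l * t) at_bot at_top"
      by (simp add: filterlim_uminus_at_top)
    then have "((\<lambda>t. exp (- 2 * Re l * t)) \<longlongrightarrow> 0) at_top"
      by (rule filterlim_compose[OF exp_at_bot])
    from tendsto_mult[OF this tendsto_const[of "M\<^sup>2"]]
    show "((\<lambda>t. exp (- 2 * Re l * t) * M\<^sup>2) \<longlongrightarrow> 0) at_top" by simp
    show "\<forall>\<^sub>F t in at_top. u 0 \<bullet> u 0 \<le> exp (- 2 * Re l * t) * M\<^sup>2"
      using eventually_ge_at_top[of 0]
    proof eventually_elim
      case (elim t)
      have "u t \<bullet> u t \<le> M\<^sup>2"
        using Cons.prems(4)[OF elim] by (simp add: power2_norm_eq_inner[symmetric] power_mono)
      then show ?case using const[OF elim] unfolding \<psi>_def by (metis mult_left_mono exp_ge_zero)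
    qed
  qed simp
  then have "u 0 = 0" by (metis inner_ge_zero inner_eq_zero_iff order_antisym)
  then show ?case
    using linear_growth_eq_0_halfline[of u "\<lambda>t. B *v u t" K t] Cons.prems K by (auto simp: mult.commute)
qed

section \<open>Exponential dichotomy of a hyperbolic matrix\<close>

text \<open>
  The consequences of hyperbolicity that are used below, in coordinate-free form: \<open>E\<close> is the
  unstable space, and a bounded solution on the half-line is determined by its forcing term and by its
  initial value modulo \<open>E\<close>.
\<close>

locale exponential_dichotomy =
  fixes A :: "'a::euclidean_space \<Rightarrow> 'a" and E :: "'a set" and C :: real
  assumes A: "bounded_linear A" and E: "subspace E" and C: "C > 0"
    and solvable: "\<And>f M \<delta>. continuous_on {0..} f \<Longrightarrow> (\<And>t. 0 \<le> t \<Longrightarrow> norm (f t) \<le> M) \<Longrightarrow>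
      \<exists>u. u 0 - \<delta> \<in> E \<and> solves u (\<lambda>t. A (u t) + f t) \<and>
          (\<forall>t\<ge>0. norm (u t) \<le> C * (norm \<delta> + M))"
    and unique: "\<And>u M t. (\<And>t. 0 \<le> t \<Longrightarrow> (u has_vector_derivative A (u t)) (at t within {0..})) \<Longrightarrow>
      (\<And>t. 0 \<le> t \<Longrightarrow> norm (u t) \<le> M) \<Longrightarrow> u 0 \<in> E \<Longrightarrow> 0 \<le> t \<Longrightarrow> u t = 0"

definition vec_of_real :: "real ^ 'n \<Rightarrow> complex ^ 'n" where "vec_of_real v = (\<chi> i. complex_of_real (v $ i))"
definition vec_Re :: "complex ^ 'n \<Rightarrow> real ^ 'n" where "vec_Re v = (\<chi> i. Re (v $ i))"
definition vec_cnj :: "complex ^ 'n \<Rightarrow> complex ^ 'n" where "vec_cnj v = (\<chi> i. cnj (v $ i))"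

lemma vec_Re_of_real [simp]: "vec_Re (vec_of_real v) = v"
  by (simp add: vec_Re_def vec_of_real_def vec_eq_iff)

lemma vec_of_real_Re: "vec_of_real (vec_Re v) = (1/2) *s (v + vec_cnj v)"
  by (auto simp: vec_of_real_def vec_Re_def vec_cnj_def vec_eq_iff complex_eq_iff)

lemma bounded_linear_vec_Re: "bounded_linear vec_Re"
proof -
  have "linear vec_Re" by (rule linearI) (simp_all add: vec_Re_def vec_eq_iff)
  then show ?thesis by (simp add: linear_conv_bounded_linear)
qed

lemma bounded_linear_vec_of_real: "bounded_linear vec_of_real"
proof -
  have "linear vec_of_real"
    by (rule linearI)
       (simp only: vec_of_real_def vec_eq_iff vec_lambda_beta vector_add_component vector_scaleR_component,
        simp add: scaleR_conv_of_real)+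
  then show ?thesis by (simp add: linear_conv_bounded_linear)
qed

lemma vec_of_real_scaleR: "vec_of_real (c *\<^sub>R v) = complex_of_real c *s vec_of_real v"
  by (simp add: vec_of_real_def vec_eq_iff)

lemma norm_vec_Re: "norm (vec_Re v) \<le> norm v"
  by (rule norm_le_componentwise_cart) (simp add: vec_Re_def abs_Re_le_cmod)

context
  fixes A :: "real ^ 'n ^ 'n"
begin

abbreviation "cA \<equiv> map_matrix complex_of_real A"

lemma cA_vec_of_real: "cA *v vec_of_real v = vec_of_real (A *v v)"
  by (simp add: vec_of_real_def vec_eq_iff matrix_vector_mult_def map_matrix_def)

lemma vec_Re_cA: "vec_Re (cA *v v) = A *v vec_Re v"
  by (simp add: vec_Re_def vec_eq_iff matrix_vector_mult_def map_matrix_def)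

lemma factor_product_cnj: "factor_product cA (map cnj ls) (vec_cnj v) = vec_cnj (factor_product cA ls v)"
proof (induction ls arbitrary: v)
  case (Cons l ls)
  have "cA *v vec_cnj v - cnj l *s vec_cnj v = vec_cnj (cA *v v - l *s v)"
    by (simp add: vec_cnj_def vec_eq_iff matrix_vector_mult_def map_matrix_def)
  then show ?case by (simp only: list.map factor_product.simps Cons)
qed simp

text \<open>
  The matrix is real, so the complex unstable space is invariant under conjugation and taking real
  parts stays inside it.
\<close>

lemma spectral_space_cnj:
  assumes "v \<in> spectral_space cA P" "\<And>l. P l \<Longrightarrow> P (cnj l)"
  shows "vec_cnj v \<in> spectral_space cA P"
proof -
  obtain ls where "\<forall>l\<in>set ls. P l" "factor_product cA ls v = 0" using assms(1) by (auto simp: spectral_space_def)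
  moreover have "vec_cnj 0 = 0" by (simp add: vec_cnj_def vec_eq_iff)
  ultimately show ?thesis using assms(2) by (intro spectral_spaceI[of "map cnj ls"]) (auto simp: factor_product_cnj)
qed

definition unstable_space :: "(real ^ 'n) set" where
  "unstable_space = {v. vec_of_real v \<in> spectral_space cA (\<lambda>l. Re l > 0)}"

lemma subspace_unstable_space: "subspace unstable_space"
  unfolding subspace_def unstable_space_def
  by (auto simp: linear_0 linear_add bounded_linear.linear[OF bounded_linear_vec_of_real] vec_of_real_scaleR
      intro!: spectral_space_0 spectral_space_add spectral_space_smult)

lemma vec_Re_unstable_space:
  assumes "v \<in> spectral_space cA (\<lambda>l. Re l > 0)"
  shows "vec_Re v \<in> unstable_space"
  unfolding unstable_space_def mem_Collect_eq vec_of_real_Re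
  by (intro spectral_space_smult spectral_space_add spectral_space_cnj assms) auto

lemma unstable_space_bounded_eq_0:
  assumes "\<And>t. t \<ge> 0 \<Longrightarrow> (u has_vector_derivative A *v u t) (at t within {0..})"
    and "\<And>t. t \<ge> 0 \<Longrightarrow> norm (u t) \<le> M" and "u 0 \<in> unstable_space" and "t \<ge> 0"
  shows "u t = 0"
proof -
  obtain ls where ls: "\<forall>l\<in>set ls. Re l > 0" "factor_product cA ls (vec_of_real (u 0)) = 0"
    using assms(3) by (auto simp: unstable_space_def spectral_space_def)
  obtain K where K: "0 \<le> K" "\<And>v. norm (vec_of_real v :: complex ^ 'n) \<le> norm v * K"
    using bounded_linear.nonneg_bounded[OF bounded_linear_vec_of_real] by metis
  have "vec_of_real (u t) = 0"
  proof (rule unstable_bounded_eq_0[of ls cA "\<lambda>t. vec_of_real (u t)" "M * K"])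
    fix t :: real assume t: "t \<ge> 0"
    show "((\<lambda>t. vec_of_real (u t)) has_vector_derivative cA *v vec_of_real (u t)) (at t within {0..})"
      unfolding cA_vec_of_real by (rule bounded_linear.has_vector_derivative[OF bounded_linear_vec_of_real assms(1)[OF t]])
    show "norm (vec_of_real (u t)) \<le> M * K"
      using K(2)[of "u t"] assms(2)[OF t] K(1) by (meson mult_right_mono order_trans)
  qed (use ls assms in auto)
  then show ?thesis by (metis vec_Re_of_real linear_0 bounded_linear.linear bounded_linear_vec_Re)
qed

lemma complex_halfline_solution:
  assumes hyp: "\<And>\<mu> v. v \<noteq> 0 \<Longrightarrow> cA *v v = \<mu> *s v \<Longrightarrow> Re \<mu> \<noteq> 0"
  shows "\<exists>C. solvable_forced cA w C"
    and "\<exists>C u. C \<ge> 0 \<and> u 0 - w \<in> spectral_space cA (\<lambda>l. Re l > 0) \<and> solves u (\<lambda>t. cA *v u t) \<and> (\<forall>t\<ge>0. norm (u t) \<le> C)"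
proof -
  obtain ls0 where "factor_product cA ls0 w = 0" using annihilating_list_exists by auto
  then obtain ls where ls: "\<forall>l\<in>set ls. \<exists>w. w \<noteq> 0 \<and> cA *v w = l *s w" "factor_product cA ls w = 0"
    using annihilating_eigenvalues by blast
  have "\<exists>a\<in>spectral_space cA (\<lambda>l. Re l < 0). \<exists>b\<in>spectral_space cA (\<lambda>l. Re l > 0). w = a + b"
  proof (rule spectral_space_split[OF _ ls(2)])
    show "\<forall>l\<in>set ls. Re l < 0 \<or> Re l > 0" using ls(1) hyp by (meson linorder_neq_iff)
  qed auto
  then obtain a b where ab: "a \<in> spectral_space cA (\<lambda>l. Re l < 0)" "b \<in> spectral_space cA (\<lambda>l. Re l > 0)" "w = a + b"
    by auto
  obtain C1 where C1: "solvable_forced cA a C1"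
    using ab(1) forced_solution unfolding spectral_space_def by blast
  obtain C2 where C2: "solvable_forced cA b C2"
    using ab(2) forced_solution unfolding spectral_space_def by blast
  have "\<exists>u. u 0 \<in> spectral_space cA (\<lambda>l. Re l > 0) \<and> solves u (\<lambda>t. cA *v u t + \<phi> t *s w) \<and>
         (\<forall>t\<ge>0. norm (u t) \<le> (C1 + C2) * M)"
    if \<phi>: "continuous_on {0..} \<phi>" "\<forall>t\<ge>0. norm (\<phi> t) \<le> M" for \<phi> M
  proof -
    have \<phi>b: "\<And>t. 0 \<le> t \<Longrightarrow> norm (\<phi> t) \<le> M" using \<phi>(2) by simp
    from solvable_forcedD[OF C1 \<phi>(1) \<phi>b]
    obtain u where "u 0 \<in> spectral_space cA (\<lambda>l. Re l > 0) \<and> solves u (\<lambda>t. cA *v u t + \<phi> t *s a) \<and>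
      (\<forall>t\<ge>0. norm (u t) \<le> C1 * M)" ..
    then have u: "u 0 \<in> spectral_space cA (\<lambda>l. Re l > 0)" "solves u (\<lambda>t. cA *v u t + \<phi> t *s a)"
      "\<And>t. 0 \<le> t \<Longrightarrow> norm (u t) \<le> C1 * M" by auto
    from solvable_forcedD[OF C2 \<phi>(1) \<phi>b]
    obtain v where "v 0 \<in> spectral_space cA (\<lambda>l. Re l > 0) \<and> solves v (\<lambda>t. cA *v v t + \<phi> t *s b) \<and>
      (\<forall>t\<ge>0. norm (v t) \<le> C2 * M)" ..
    then have v: "v 0 \<in> spectral_space cA (\<lambda>l. Re l > 0)" "solves v (\<lambda>t. cA *v v t + \<phi> t *s b)"
      "\<And>t. 0 \<le> t \<Longrightarrow> norm (v t) \<le> C2 * M" by auto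
    show ?thesis
    proof (intro exI[of _ "\<lambda>t. u t + v t"] conjI allI impI)
      show "u 0 + v 0 \<in> spectral_space cA (\<lambda>l. Re l > 0)" by (rule spectral_space_add[OF u(1) v(1)])
      fix t :: real assume t: "t \<ge> 0"
      have "((\<lambda>t. u t + v t) has_vector_derivative (cA *v u t + \<phi> t *s a) + (cA *v v t + \<phi> t *s b)) (at t within {0..})"
        using u(2) v(2) t by (intro has_vector_derivative_add) auto
      moreover have "(cA *v u t + \<phi> t *s a) + (cA *v v t + \<phi> t *s b) = cA *v (u t + v t) + \<phi> t *s w"
        by (simp add: ab matrix_vector_right_distrib vector_add_ldistrib)
      ultimately show "((\<lambda>t. u t + v t) has_vector_derivative cA *v (u t + v t) + \<phi> t *s w) (at t within {0..})"
        by (simp only:)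
      show "norm (u t + v t) \<le> (C1 + C2) * M"
        using norm_triangle_ineq[of "u t" "v t"] u(3)[OF t] v(3)[OF t] by (simp add: algebra_simps)
    qed
  qed
  moreover have "C1 + C2 \<ge> 0" using C1 C2 by (simp add: solvable_forced_def)
  ultimately show "\<exists>C. solvable_forced cA w C" unfolding solvable_forced_def by blast
  obtain C u where u: "C \<ge> 0" "u 0 - a \<in> spectral_space cA (\<lambda>l. Re l > 0)" "solves u (\<lambda>t. cA *v u t)"
      "\<forall>t\<ge>0. norm (u t) \<le> C" using homogeneous_solution[OF ab(1)] by blast
  have "u 0 - w = (u 0 - a) + (-1) *s b" using ab(3) by (simp add: vec_eq_iff)
  moreover have "(u 0 - a) + (-1) *s b \<in> spectral_space cA (\<lambda>l. Re l > 0)"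
    by (rule spectral_space_add[OF u(2) spectral_space_smult[OF ab(2)]])
  ultimately have "u 0 - w \<in> spectral_space cA (\<lambda>l. Re l > 0)" by (simp only:)
  then show "\<exists>C u. C \<ge> 0 \<and> u 0 - w \<in> spectral_space cA (\<lambda>l. Re l > 0) \<and> solves u (\<lambda>t. cA *v u t) \<and> (\<forall>t\<ge>0. norm (u t) \<le> C)"
    using u(1,3,4) by (intro exI[of _ C] exI[of _ u]) simp
qed

text \<open>
  Every real basis vector is the sum of a stable and an unstable complex vector. A forcing term is
  expanded in the basis and treated componentwise, the initial value is corrected by the homogeneous
  solutions that start in the stable parts, and the real part is taken at the end.
\<close>

theorem halfline_dichotomy:
  assumes hyp: "\<And>\<mu> v. v \<noteq> 0 \<Longrightarrow> cA *v v = \<mu> *s v \<Longrightarrow> Re \<mu> \<noteq> 0"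
  shows "\<exists>C. exponential_dichotomy (\<lambda>v. A *v v) unstable_space C"
proof -
  let ?U = "spectral_space cA (\<lambda>l. Re l > 0)"
  have "\<exists>C. solvable_forced cA (vec_of_real b) C" for b :: "real ^ 'n"
    by (rule complex_halfline_solution(1)) (rule hyp)
  then have "\<forall>b :: real ^ 'n. \<exists>C. solvable_forced cA (vec_of_real b) C" ..
  from choice[OF this] obtain C1 where C1': "\<forall>b :: real ^ 'n. solvable_forced cA (vec_of_real b) (C1 b)" ..
  then have C1: "C1 b \<ge> 0" for b by (simp add: solvable_forced_def)
  define homog where "homog b C u \<longleftrightarrow> C \<ge> 0 \<and> u 0 - vec_of_real b \<in> ?U \<and> solves u (\<lambda>t. cA *v u t) \<and>
         (\<forall>t\<ge>0. norm (u t) \<le> C)" for b :: "real ^ 'n" and C u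
  have "\<exists>C u. homog b C u" for b
    unfolding homog_def by (rule complex_halfline_solution(2)) (rule hyp)
  then have "\<forall>b. \<exists>C u. homog b C u" ..
  from choice[OF this] obtain C2 where "\<forall>b. \<exists>u. homog b (C2 b) u" ..
  from choice[OF this] obtain h where h0: "\<forall>b. homog b (C2 b) (h b)" ..
  have h: "C2 b \<ge> 0" "h b 0 - vec_of_real b \<in> ?U"
    "t \<ge> 0 \<Longrightarrow> (h b has_vector_derivative cA *v h b t) (at t within {0..})"
    "t \<ge> 0 \<Longrightarrow> norm (h b t) \<le> C2 b" for b t
    using h0 unfolding homog_def by auto
  define C where "C = 1 + (\<Sum>b\<in>Basis. C1 b) + (\<Sum>b\<in>Basis. C2 b)"
  have Cpos: "C > 0" unfolding C_def by (intro add_pos_nonneg sum_nonneg C1 h(1) zero_less_one)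
  have C12: "(\<Sum>b\<in>Basis. C1 b) \<le> C" "(\<Sum>b\<in>Basis. C2 b) \<le> C"
    unfolding C_def using sum_nonneg[of Basis C1] sum_nonneg[of Basis C2] C1 h(1) by simp_all
  have sol: "\<exists>u. u 0 - \<delta> \<in> unstable_space \<and> solves u (\<lambda>t. A *v u t + f t) \<and>
         (\<forall>t\<ge>0. norm (u t) \<le> C * (norm \<delta> + M))"
    if f: "continuous_on {0..} f" "\<And>t. 0 \<le> t \<Longrightarrow> norm (f t) \<le> M" for f :: "real \<Rightarrow> real ^ 'n" and M \<delta>
  proof -
    have M0: "M \<ge> 0" using f(2)[of 0] norm_ge_zero order_trans by blast
    have "\<exists>u. u 0 \<in> ?U \<and> solves u (\<lambda>t. cA *v u t + complex_of_real (f t \<bullet> b) *s vec_of_real b) \<and>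
         (\<forall>t\<ge>0. norm (u t) \<le> C1 b * M)" if b: "b \<in> Basis" for b
    proof (rule solvable_forcedD[OF C1'[rule_format]])
      show "continuous_on {0..} (\<lambda>t. complex_of_real (f t \<bullet> b))" by (intro continuous_intros f)
      show "norm (complex_of_real (f t \<bullet> b)) \<le> M" if "0 \<le> t" for t
        using order_trans[OF Basis_le_norm[OF b] f(2)[OF that]] by simp
    qed
    then have "\<forall>b\<in>Basis. \<exists>u. u 0 \<in> ?U \<and> solves u (\<lambda>t. cA *v u t + complex_of_real (f t \<bullet> b) *s vec_of_real b) \<and>
         (\<forall>t\<ge>0. norm (u t) \<le> C1 b * M)" ..
    from bchoice[OF this] obtain U where U0: "\<forall>b\<in>Basis. U b 0 \<in> ?U \<and>
         solves (U b) (\<lambda>t. cA *v U b t + complex_of_real (f t \<bullet> b) *s vec_of_real b) \<and>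
         (\<forall>t\<ge>0. norm (U b t) \<le> C1 b * M)" ..
    have U: "\<And>b. b \<in> Basis \<Longrightarrow> U b 0 \<in> ?U"
         "\<And>b t. b \<in> Basis \<Longrightarrow> t \<ge> 0 \<Longrightarrow> (U b has_vector_derivative cA *v U b t + complex_of_real (f t \<bullet> b) *s vec_of_real b) (at t within {0..})"
         "\<And>b t. b \<in> Basis \<Longrightarrow> t \<ge> 0 \<Longrightarrow> norm (U b t) \<le> C1 b * M"
      using U0 by auto
    define w where "w t = (\<Sum>b\<in>Basis. U b t + (\<delta> \<bullet> b) *\<^sub>R h b t)" for t
    have vr_sum: "(\<Sum>b\<in>Basis. complex_of_real (z \<bullet> b) *s vec_of_real b) = vec_of_real z" for z :: "real ^ 'n"
    proof -
      have "vec_of_real z = vec_of_real (\<Sum>b\<in>Basis. (z \<bullet> b) *\<^sub>R b)" by (simp add: euclidean_representation)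
      also have "\<dots> = (\<Sum>b\<in>Basis. vec_of_real ((z \<bullet> b) *\<^sub>R b))"
        by (rule linear_sum[OF bounded_linear.linear[OF bounded_linear_vec_of_real]])
      finally show ?thesis by (simp add: vec_of_real_scaleR)
    qed
    have w0: "w 0 - vec_of_real \<delta> \<in> ?U"
    proof -
      have "w 0 - vec_of_real \<delta> = (\<Sum>b\<in>Basis. U b 0 + complex_of_real (\<delta> \<bullet> b) *s (h b 0 - vec_of_real b))"
        unfolding w_def vr_sum[symmetric, of \<delta>] sum_subtractf[symmetric]
        by (intro sum.cong refl) (simp only: vec_eq_iff vector_add_component vector_minus_component vector_smult_component vector_scaleR_component, simp add: scaleR_conv_of_real algebra_simps)
      then show ?thesis
        by (simp only:) (intro spectral_space_sum spectral_space_add spectral_space_smult U(1) h(2))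
    qed
    have w': "(w has_vector_derivative cA *v w t + vec_of_real (f t)) (at t within {0..})" if t: "t \<ge> 0" for t
    proof -
      have "(w has_vector_derivative (\<Sum>b\<in>Basis. (cA *v U b t + complex_of_real (f t \<bullet> b) *s vec_of_real b) + (\<delta> \<bullet> b) *\<^sub>R (cA *v h b t))) (at t within {0..})"
        unfolding w_def using t
        by (intro has_vector_derivative_sum has_vector_derivative_add U(2) bounded_linear.has_vector_derivative[OF bounded_linear_scaleR_right] h(3))
      moreover have "(\<Sum>b\<in>Basis. (cA *v U b t + complex_of_real (f t \<bullet> b) *s vec_of_real b) + (\<delta> \<bullet> b) *\<^sub>R (cA *v h b t))
          = (\<Sum>b\<in>Basis. cA *v (U b t + (\<delta> \<bullet> b) *\<^sub>R h b t)) + (\<Sum>b\<in>Basis. complex_of_real (f t \<bullet> b) *s vec_of_real b)"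
        unfolding sum.distrib[symmetric]
        by (intro sum.cong refl)
           (simp add: linear_add linear_scale bounded_linear.linear[OF bounded_linear_cmatrix] algebra_simps)
      moreover have "(\<Sum>b\<in>Basis. cA *v (U b t + (\<delta> \<bullet> b) *\<^sub>R h b t)) = cA *v w t"
        unfolding w_def by (rule linear_sum[OF bounded_linear.linear[OF bounded_linear_cmatrix], symmetric])
      ultimately show ?thesis by (simp only: vr_sum)
    qed
    have wb: "norm (w t) \<le> C * (norm \<delta> + M)" if t: "t \<ge> 0" for t
    proof -
      have "norm (w t) \<le> (\<Sum>b\<in>Basis. C1 b * M + norm \<delta> * C2 b)"
        unfolding w_def
      proof (rule sum_norm_le)
        fix b :: "real ^ 'n" assume b: "b \<in> Basis"
        have "norm (U b t + (\<delta> \<bullet> b) *\<^sub>R h b t) \<le> norm (U b t) + \<bar>\<delta> \<bullet> b\<bar> * norm (h b t)"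
          by (metis norm_triangle_ineq norm_scaleR)
        also have "\<dots> \<le> C1 b * M + norm \<delta> * C2 b"
          using U(3)[OF b t] h(4)[OF t, of b] Basis_le_norm[OF b, of \<delta>] h(1)[of b]
          by (intro add_mono mult_mono) auto
        finally show "norm (U b t + (\<delta> \<bullet> b) *\<^sub>R h b t) \<le> C1 b * M + norm \<delta> * C2 b" .
      qed
      also have "\<dots> = (\<Sum>b\<in>Basis. C1 b) * M + norm \<delta> * (\<Sum>b\<in>Basis. C2 b)"
        by (simp add: sum.distrib sum_distrib_left sum_distrib_right)
      also have "\<dots> \<le> C * M + norm \<delta> * C"
        using M0 C12 by (intro add_mono mult_right_mono mult_left_mono) auto
      finally show ?thesis by (simp add: algebra_simps)
    qed
    show ?thesis
    proof (intro exI[of _ "\<lambda>t. vec_Re (w t)"] conjI allI impI)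
      note lin = bounded_linear.linear[OF bounded_linear_vec_Re]
      have "vec_Re (w 0) - \<delta> = vec_Re (w 0 - vec_of_real \<delta>)"
        by (simp add: linear_diff[OF lin])
      then show "vec_Re (w 0) - \<delta> \<in> unstable_space" using vec_Re_unstable_space[OF w0] by simp
      fix t :: real assume t: "t \<ge> 0"
      have "((\<lambda>t. vec_Re (w t)) has_vector_derivative vec_Re (cA *v w t + vec_of_real (f t))) (at t within {0..})"
        by (rule bounded_linear.has_vector_derivative[OF bounded_linear_vec_Re w'[OF t]])
      then show "((\<lambda>t. vec_Re (w t)) has_vector_derivative A *v vec_Re (w t) + f t) (at t within {0..})"
        by (simp add: linear_add[OF lin] vec_Re_cA)
      show "norm (vec_Re (w t)) \<le> C * (norm \<delta> + M)"
        using norm_vec_Re wb[OF t] order_trans by blast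
    qed
  qed
  have "exponential_dichotomy (\<lambda>v. A *v v) unstable_space C"
  proof (rule exponential_dichotomy.intro)
    show "bounded_linear (\<lambda>v. A *v v)" by (rule matrix_vector_mul_bounded_linear)
    show "u t = 0" if "\<And>t. 0 \<le> t \<Longrightarrow> (u has_vector_derivative A *v u t) (at t within {0..})"
      "\<And>t. 0 \<le> t \<Longrightarrow> norm (u t) \<le> M" "u 0 \<in> unstable_space" "0 \<le> t" for u M t
      by (rule unstable_space_bounded_eq_0[OF that])
  qed (fact subspace_unstable_space Cpos sol)+
  then show ?thesis ..
qed

end

section \<open>Bounded solutions near a hyperbolic equilibrium\<close>

context exponential_dichotomy
begin

lemmas A_linear = bounded_linear.linear[OF A]

lemma estimate:
  assumes u: "\<And>t. 0 \<le> t \<Longrightarrow> (u has_vector_derivative A (u t) + f t) (at t within {0..})"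
    and K: "\<And>t. 0 \<le> t \<Longrightarrow> norm (u t) \<le> K" and "u 0 - \<delta> \<in> E"
    and f: "continuous_on {0..} f" "\<And>t. 0 \<le> t \<Longrightarrow> norm (f t) \<le> M"
    and "0 \<le> t"
  shows "norm (u t) \<le> C * (norm \<delta> + M)"
proof -
  obtain v where v: "v 0 - \<delta> \<in> E" "\<And>t. 0 \<le> t \<Longrightarrow> (v has_vector_derivative A (v t) + f t) (at t within {0..})"
      "\<And>t. 0 \<le> t \<Longrightarrow> norm (v t) \<le> C * (norm \<delta> + M)"
    using solvable[of f M \<delta>] f by auto
  have "u t - v t = 0"
  proof (rule unique[of "\<lambda>t. u t - v t" "K + C * (norm \<delta> + M)"])
    fix t :: real assume t: "0 \<le> t"
    have "((\<lambda>t. u t - v t) has_vector_derivative (A (u t) + f t) - (A (v t) + f t)) (at t within {0..})"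
      by (intro has_vector_derivative_diff u v t)
    then show "((\<lambda>t. u t - v t) has_vector_derivative A (u t - v t)) (at t within {0..})"
      by (simp add: linear_diff[OF A_linear])
    show "norm (u t - v t) \<le> K + C * (norm \<delta> + M)"
      using norm_triangle_ineq4[of "u t" "v t"] K[OF t] v(3)[OF t] by linarith
  next
    have "u 0 - v 0 = (u 0 - \<delta>) - (v 0 - \<delta>)" by simp
    then show "u 0 - v 0 \<in> E" using assms(3) v(1) subspace_diff[OF E] by metis
  qed fact
  then show ?thesis using v(3)[OF \<open>0 \<le> t\<close>] by simp
qed

text \<open>
  A forcing term that is small relative to the solution is absorbed into the left-hand side.
\<close>

lemma perturbed_estimate:
  assumes u: "\<And>t. 0 \<le> t \<Longrightarrow> (u has_vector_derivative A (u t) + f t) (at t within {0..})"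
    and K: "\<And>t. 0 \<le> t \<Longrightarrow> norm (u t) \<le> K" and u0: "u 0 - \<delta> \<in> E"
    and f: "continuous_on {0..} f" "\<And>t. 0 \<le> t \<Longrightarrow> norm (f t) \<le> \<epsilon> * norm (u t) + \<kappa>"
    and \<epsilon>: "0 \<le> \<epsilon>" "2 * C * \<epsilon> \<le> 1" and "0 \<le> t"
  shows "norm (u t) \<le> 2 * C * (norm \<delta> + \<kappa>)"
proof -
  define S where "S = (SUP t\<in>{0..}. norm (u t))"
  have bdd: "bdd_above ((\<lambda>t. norm (u t)) ` {0..})" using K by (intro bdd_aboveI2[of _ _ K]) auto
  have S: "norm (u t) \<le> S" if "0 \<le> t" for t
    unfolding S_def using that by (intro cSUP_upper bdd) auto
  have "norm (u t) \<le> C * (norm \<delta> + (\<epsilon> * S + \<kappa>))" if "0 \<le> t" for t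
  proof (rule estimate[OF u K u0 f(1) _ that])
    fix t :: real assume t: "0 \<le> t"
    show "norm (f t) \<le> \<epsilon> * S + \<kappa>"
      using f(2)[OF t] mult_left_mono[OF S[OF t] \<epsilon>(1)] by linarith
  qed
  then have "S \<le> C * (norm \<delta> + (\<epsilon> * S + \<kappa>))"
    unfolding S_def by (intro cSUP_least) auto
  moreover have "2 * (C * (\<epsilon> * S)) \<le> S"
  proof -
    have "0 \<le> S" using S[of 0] norm_ge_zero order_trans by blast
    then have "2 * C * \<epsilon> * S \<le> 1 * S" using \<epsilon>(2) by (rule mult_right_mono[rotated])
    then show ?thesis by (simp add: mult.assoc)
  qed
  ultimately have "S \<le> 2 * C * (norm \<delta> + \<kappa>)" by (simp add: algebra_simps)
  then show ?thesis using S[OF \<open>0 \<le> t\<close>] by simp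
qed

text \<open>
  Multiplication by the slowly increasing cut-off \<open>1 - exp (- \<epsilon> s)\<close> makes the initial value 0 at the price
  of a forcing term of size \<open>\<epsilon> R\<close>, so after the time \<open>ln 2 / \<epsilon>\<close> the bound on \<open>u\<close> has been halved.
\<close>

lemma decay_step:
  assumes u: "\<And>t. 0 \<le> t \<Longrightarrow> (u has_vector_derivative A (u t) + f t) (at t within {0..})"
    and R: "\<And>t. \<tau> \<le> t \<Longrightarrow> norm (u t) \<le> R"
    and f: "continuous_on {0..} f" "\<And>t. 0 \<le> t \<Longrightarrow> norm (f t) \<le> \<epsilon> * norm (u t)"
    and \<epsilon>: "0 < \<epsilon>" "8 * C * \<epsilon> \<le> 1" and \<tau>: "0 \<le> \<tau>" and t: "\<tau> + ln 2 / \<epsilon> \<le> t"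
  shows "norm (u t) \<le> R / 2"
proof -
  define \<phi> where "\<phi> s = 1 - exp (- \<epsilon> * s)" for s
  have R0: "0 \<le> R" using R[of \<tau>] norm_ge_zero order_trans by blast
  have d\<phi>: "(\<phi> has_vector_derivative \<epsilon> * exp (- \<epsilon> * s)) (at s within S)" for s S
    unfolding \<phi>_def has_real_derivative_iff_has_vector_derivative[symmetric]
    by (auto intro!: derivative_eq_intros)
  have du: "((\<lambda>s. u (\<tau> + s)) has_vector_derivative A (u (\<tau> + s)) + f (\<tau> + s)) (at s within {0..})" if s: "0 \<le> s" for s
  proof -
    have "((\<lambda>s. \<tau> + s) has_vector_derivative 1) (at s within {0..})"
      by (auto intro!: derivative_eq_intros)
    moreover have "(u has_vector_derivative A (u (\<tau> + s)) + f (\<tau> + s)) (at (\<tau> + s) within (\<lambda>s. \<tau> + s) ` {0..})"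
      by (rule has_vector_derivative_within_subset[OF u]) (use s \<tau> in auto)
    ultimately show ?thesis
      using vector_diff_chain_within[of "\<lambda>s. \<tau> + s" 1 s "{0..}" u] by (simp add: o_def)
  qed
  have "norm (\<phi> (t - \<tau>) *\<^sub>R u (\<tau> + (t - \<tau>))) \<le> C * (norm (0::'a) + 2 * \<epsilon> * R)"
  proof (rule estimate[of "\<lambda>s. \<phi> s *\<^sub>R u (\<tau> + s)" "\<lambda>s. \<phi> s *\<^sub>R f (\<tau> + s) + (\<epsilon> * exp (- \<epsilon> * s)) *\<^sub>R u (\<tau> + s)" R])
    fix s :: real assume s: "0 \<le> s"
    have \<phi>01: "0 \<le> \<phi> s" "\<phi> s \<le> 1" using s \<epsilon> by (auto simp: \<phi>_def)
    show "((\<lambda>s. \<phi> s *\<^sub>R u (\<tau> + s)) has_vector_derivative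
         A (\<phi> s *\<^sub>R u (\<tau> + s)) + (\<phi> s *\<^sub>R f (\<tau> + s) + (\<epsilon> * exp (- \<epsilon> * s)) *\<^sub>R u (\<tau> + s))) (at s within {0..})"
      using bounded_bilinear.has_vector_derivative[OF bounded_bilinear_scaleR d\<phi> du[OF s]]
      by (simp add: linear_scale[OF A_linear] algebra_simps)
    show "norm (\<phi> s *\<^sub>R u (\<tau> + s)) \<le> R"
      using \<phi>01 R[of "\<tau> + s"] s by (simp add: mult_le_one mult_left_le_one_le order_trans[OF mult_left_le_one_le])
    have "norm (\<phi> s *\<^sub>R f (\<tau> + s) + (\<epsilon> * exp (- \<epsilon> * s)) *\<^sub>R u (\<tau> + s))
        \<le> \<phi> s * norm (f (\<tau> + s)) + (\<epsilon> * exp (- \<epsilon> * s)) * norm (u (\<tau> + s))"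
      using norm_triangle_ineq[of "\<phi> s *\<^sub>R f (\<tau> + s)" "(\<epsilon> * exp (- \<epsilon> * s)) *\<^sub>R u (\<tau> + s)"] \<phi>01 \<epsilon> by simp
    also have "\<dots> \<le> 1 * (\<epsilon> * R) + (\<epsilon> * 1) * R"
    proof (intro add_mono mult_mono)
      have "norm (f (\<tau> + s)) \<le> \<epsilon> * norm (u (\<tau> + s))" using f(2)[of "\<tau> + s"] s \<tau> by simp
      also have "\<dots> \<le> \<epsilon> * R" using R[of "\<tau> + s"] s \<epsilon> by (intro mult_left_mono) auto
      finally show "norm (f (\<tau> + s)) \<le> \<epsilon> * R" .
    qed (use \<phi>01 \<epsilon> R0 R[of "\<tau> + s"] s in auto)
    finally show "norm (\<phi> s *\<^sub>R f (\<tau> + s) + (\<epsilon> * exp (- \<epsilon> * s)) *\<^sub>R u (\<tau> + s)) \<le> 2 * \<epsilon> * R" by (simp add: mult_ac)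
  next
    have c1: "continuous_on {0..} (\<lambda>s. f (\<tau> + s))"
      by (rule continuous_on_compose2[OF f(1)]) (use \<tau> in \<open>auto intro!: continuous_intros\<close>)
    have c2: "continuous_on {0..} (\<lambda>s. u (\<tau> + s))"
      by (rule continuous_on_vector_derivative[OF du]) auto
    show "continuous_on {0..} (\<lambda>s. \<phi> s *\<^sub>R f (\<tau> + s) + (\<epsilon> * exp (- \<epsilon> * s)) *\<^sub>R u (\<tau> + s))"
      unfolding \<phi>_def by (intro continuous_intros c1 c2)
    show "\<phi> 0 *\<^sub>R u (\<tau> + 0) - 0 \<in> E" using subspace_0[OF E] by (simp add: \<phi>_def)
    show "0 \<le> t - \<tau>" using t \<epsilon> by (smt (verit) divide_nonneg_nonneg ln_ge_zero)
  qed
  moreover have "1 / 2 \<le> \<phi> (t - \<tau>)"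
  proof -
    have "ln 2 \<le> \<epsilon> * (t - \<tau>)" using t \<epsilon> by (simp add: field_simps)
    then have "exp (- \<epsilon> * (t - \<tau>)) \<le> exp (- ln 2)" by simp
    then show ?thesis by (simp add: \<phi>_def exp_minus)
  qed
  then have "1 / 2 * norm (u t) \<le> norm (\<phi> (t - \<tau>) *\<^sub>R u (\<tau> + (t - \<tau>)))"
    using mult_right_mono[of "1 / 2" "\<phi> (t - \<tau>)" "norm (u t)"] by simp
  moreover have "C * (norm (0::'a) + 2 * \<epsilon> * R) \<le> R / 4"
    using mult_right_mono[OF \<epsilon>(2) R0] by (simp add: algebra_simps)
  ultimately show ?thesis by simp
qed

lemma decay:
  assumes u: "\<And>t. 0 \<le> t \<Longrightarrow> (u has_vector_derivative A (u t) + f t) (at t within {0..})"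
    and R: "\<And>t. 0 \<le> t \<Longrightarrow> norm (u t) \<le> R"
    and f: "continuous_on {0..} f" "\<And>t. 0 \<le> t \<Longrightarrow> norm (f t) \<le> \<epsilon> * norm (u t)"
    and \<epsilon>: "0 < \<epsilon>" "8 * C * \<epsilon> \<le> 1"
  shows "(u \<longlongrightarrow> 0) at_top"
proof -
  define L where "L = ln 2 / \<epsilon>"
  have L: "0 \<le> L" using \<epsilon> by (simp add: L_def)
  have *: "norm (u t) \<le> R / 2 ^ n" if "real n * L \<le> t" for n t
    using that
  proof (induction n arbitrary: t)
    case 0
    then show ?case using R by simp
  next
    case (Suc n)
    have nL: "0 \<le> real n * L" using L by simp
    have "norm (u t) \<le> R / 2 ^ n / 2"
      by (rule decay_step[OF u _ f \<epsilon>, where \<tau> = "real n * L"])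
         (use Suc nL in \<open>auto simp: L_def algebra_simps add_divide_distrib\<close>)
    then show ?case by (simp add: mult.commute)
  qed
  show ?thesis
  proof (rule tendstoI)
    fix e :: real assume e: "0 < e"
    have "(\<lambda>n. R * (1 / 2) ^ n) \<longlonglongrightarrow> R * 0"
      by (intro tendsto_intros LIMSEQ_power_zero) auto
    then have "\<forall>\<^sub>F n in sequentially. R * (1 / 2) ^ n < e" using e by (intro order_tendstoD) auto
    then obtain n where n: "R * (1 / 2) ^ n < e" by (auto simp: eventually_sequentially)
    show "\<forall>\<^sub>F t in at_top. dist (u t) 0 < e"
      using eventually_ge_at_top[of "real n * L"]
    proof eventually_elim
      case (elim t)
      show ?case using *[OF elim] n by (simp add: power_divide)
    qed
  qed
qed

text \<open>
  The Lyapunov-Perron method: a fixed point of the map that sends \<open>w\<close> to the bounded solution with forcing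
  term \<open>h(w)\<close>. Functions on the half-line are extended to the real line by their value at 0 in order to
  use the Banach space of bounded continuous functions.
\<close>

lemma bounded_solution_exists:
  assumes h0: "h 0 = 0" and h: "\<And>x y. x \<in> cball 0 r \<Longrightarrow> y \<in> cball 0 r \<Longrightarrow> norm (h x - h y) \<le> \<epsilon> * norm (x - y)"
    and \<epsilon>: "0 \<le> \<epsilon>" "2 * C * \<epsilon> \<le> 1" and r: "0 \<le> r" and \<delta>: "2 * C * norm \<delta> \<le> r"
  shows "\<exists>u. u 0 - \<delta> \<in> E \<and> solves u (\<lambda>t. A (u t) + h (u t)) \<and>
          (\<forall>t\<ge>0. norm (u t) \<le> r)"
proof -
  define S where "S = {w :: real \<Rightarrow>\<^sub>C 'a. \<forall>t. norm (apply_bcontfun w t) \<le> r}"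
  define sol where "sol w u \<longleftrightarrow> u 0 - \<delta> \<in> E \<and>
      solves u (\<lambda>t. A (u t) + h (apply_bcontfun w t)) \<and>
      (\<forall>t\<ge>0. norm (u t) \<le> r)" for w u
  have hc: "continuous_on (cball 0 r) h"
    by (rule lipschitz_on_continuous_on[of \<epsilon>])
       (use h \<epsilon> in \<open>auto intro!: lipschitz_onI simp: dist_norm\<close>)
  have hw: "continuous_on {0..} (\<lambda>t. h (apply_bcontfun w t))" if "w \<in> S" for w
    by (rule continuous_on_compose2[OF hc]) (use that in \<open>auto simp: S_def\<close>)
  have hb: "norm (h (apply_bcontfun w t)) \<le> \<epsilon> * r" if "w \<in> S" for w t
    using h[of "apply_bcontfun w t" 0] that h0 r mult_left_mono[OF _ \<epsilon>(1), of "norm (apply_bcontfun w t)" r]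
    by (fastforce simp: S_def)
  have Cr: "C * (norm \<delta> + \<epsilon> * r) \<le> r"
    using \<delta> mult_right_mono[OF \<epsilon>(2) r] by (simp add: algebra_simps)
  have "\<exists>u. sol w u" if "w \<in> S" for w
    using solvable[OF hw[OF that] hb[OF that], of \<delta>] Cr unfolding sol_def by (meson order_trans)
  then obtain U where U: "\<And>w. w \<in> S \<Longrightarrow> sol w (U w)" by metis
  define \<Psi> where "\<Psi> w = Bcontfun (\<lambda>t. U w (max 0 t))" for w
  have app: "apply_bcontfun (\<Psi> w) t = U w (max 0 t)" if "w \<in> S" for w t
  proof -
    have c: "continuous_on {0..} (U w)"
      using U[OF that] unfolding sol_def by (intro continuous_on_of_vector_derivative) auto
    have "(\<lambda>t. U w (max 0 t)) \<in> bcontfun"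
    proof (rule bcontfun_normI)
      show "continuous_on UNIV (\<lambda>t. U w (max 0 t))"
        by (rule continuous_on_compose2[OF c]) (auto intro!: continuous_intros)
      show "norm (U w (max 0 t)) \<le> r" for t using U[OF that] unfolding sol_def by simp
    qed
    then show ?thesis by (simp add: \<Psi>_def Bcontfun_inverse)
  qed
  have \<Psi>S: "\<Psi> w \<in> S" if "w \<in> S" for w
    using U[OF that] app[OF that] unfolding S_def sol_def by simp
  have "\<exists>!w\<in>S. \<Psi> w = w"
  proof (rule Banach_fix)
    have "S = PiC UNIV (\<lambda>_. cball 0 r)" by (auto simp: S_def mem_PiC_iff Pi_def)
    then show "complete S" by (simp add: complete_eq_closed closed_PiC)
    show "S \<noteq> {}" using r by (auto simp: S_def intro!: exI[of _ 0])
    show "0 \<le> C * \<epsilon>" "C * \<epsilon> < 1" using \<epsilon> C by auto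
    show "\<Psi> ` S \<subseteq> S" using \<Psi>S by auto
    fix w z assume wz: "w \<in> S" "z \<in> S"
    show "dist (\<Psi> w) (\<Psi> z) \<le> C * \<epsilon> * dist w z"
    proof (rule dist_bound)
      fix t :: real
      have "norm (U w (max 0 t) - U z (max 0 t)) \<le> C * (norm (0::'a) + \<epsilon> * dist w z)"
      proof (rule estimate[of "\<lambda>t. U w t - U z t" "\<lambda>t. h (apply_bcontfun w t) - h (apply_bcontfun z t)" "r + r"])
        fix t :: real assume t: "0 \<le> t"
        have "((\<lambda>t. U w t - U z t) has_vector_derivative (A (U w t) + h (apply_bcontfun w t)) - (A (U z t) + h (apply_bcontfun z t))) (at t within {0..})"
          using U[OF wz(1)] U[OF wz(2)] t unfolding sol_def by (intro has_vector_derivative_diff) auto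
        then show "((\<lambda>t. U w t - U z t) has_vector_derivative A (U w t - U z t) + (h (apply_bcontfun w t) - h (apply_bcontfun z t))) (at t within {0..})"
          by (simp add: linear_diff[OF A_linear] algebra_simps)
        have "norm (U w t) \<le> r" "norm (U z t) \<le> r"
          using U[OF wz(1)] U[OF wz(2)] t unfolding sol_def by auto
        then show "norm (U w t - U z t) \<le> r + r"
          using norm_triangle_ineq4[of "U w t" "U z t"] by linarith
        have "norm (h (apply_bcontfun w t) - h (apply_bcontfun z t)) \<le> \<epsilon> * norm (apply_bcontfun w t - apply_bcontfun z t)"
          using wz by (intro h) (auto simp: S_def)
        also have "\<dots> \<le> \<epsilon> * dist w z"
          using dist_bounded[of w t z] \<epsilon> by (intro mult_left_mono) (auto simp: dist_norm)
        finally show "norm (h (apply_bcontfun w t) - h (apply_bcontfun z t)) \<le> \<epsilon> * dist w z" .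
      next
        show "continuous_on {0..} (\<lambda>t. h (apply_bcontfun w t) - h (apply_bcontfun z t))"
          by (intro continuous_on_diff hw wz)
        have "U w 0 - U z 0 - 0 = (U w 0 - \<delta>) - (U z 0 - \<delta>)" by simp
        also have "\<dots> \<in> E" using U[OF wz(1)] U[OF wz(2)] unfolding sol_def by (blast intro: subspace_diff[OF E])
        finally show "U w 0 - U z 0 - 0 \<in> E" .
      qed simp
      then show "dist (apply_bcontfun (\<Psi> w) t) (apply_bcontfun (\<Psi> z) t) \<le> C * \<epsilon> * dist w z"
        using app wz by (simp add: dist_norm mult.assoc)
    qed
  qed
  then obtain w where w: "w \<in> S" "\<Psi> w = w" by blast
  have wU: "apply_bcontfun w t = U w t" if "0 \<le> t" for t
    using app[OF w(1), of t] w(2) that by simp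
  have "sol w (U w)" by (rule U[OF w(1)])
  then show ?thesis unfolding sol_def using wU by (intro exI[of _ "U w"]) auto
qed

end

section \<open>Uniform convergence of a family of orbits\<close>

lemma has_vector_derivative_shift:
  fixes u :: "real \<Rightarrow> 'a::real_normed_vector"
  assumes "(u has_vector_derivative d) (at (T + t))"
  shows "((\<lambda>t. u (T + t)) has_vector_derivative d) (at t within S)"
proof -
  have "((\<lambda>s. T + s) has_vector_derivative 1) (at t within S)"
    by (auto intro!: derivative_eq_intros)
  moreover have "(u has_vector_derivative d) (at (T + t) within (\<lambda>s. T + s) ` S)"
    using assms has_vector_derivative_at_within by blast
  ultimately show ?thesis
    using vector_diff_chain_within[of "\<lambda>s. T + s" 1 t S u] by (simp add: o_def)
qed

lemma first_integral_constant:
  fixes u :: "real \<Rightarrow> 'a::real_normed_vector"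
  assumes u: "\<And>t. 0 \<le> t \<Longrightarrow> (u has_vector_derivative X (u t)) (at t within {0..})"
    and F: "\<And>x. (F has_derivative DF x) (at x)" "\<And>x. DF x (X x) = (0::real)"
    and lim: "(u \<longlongrightarrow> c) at_top"
  shows "F (u 0) = F c"
proof -
  have der: "((\<lambda>t. F (u t)) has_real_derivative 0) (at t within {0..})" if "t \<in> {0..}" for t
  proof -
    have "(F \<circ> u has_vector_derivative DF (u t) (X (u t))) (at t within {0..})"
      by (rule vector_derivative_diff_chain_within[OF u]) (use that has_derivative_at_withinI[OF F(1)] in auto)
    then show ?thesis using F(2) by (simp add: o_def has_real_derivative_iff_has_vector_derivative)
  qed
  obtain k where k: "\<And>t. t \<in> {0..} \<Longrightarrow> F (u t) = k"
    using has_field_derivative_zero_constant[of "{0..}", OF _ der] by auto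
  have "isCont F c" using F(1) has_derivative_continuous by blast
  then have "((\<lambda>t. F (u t)) \<longlongrightarrow> F c) at_top" using isCont_tendsto_compose[OF _ lim] by blast
  moreover have "\<forall>\<^sub>F t in at_top. F (u t) = k"
    using eventually_ge_at_top[of 0] by eventually_elim (simp add: k)
  ultimately have "((\<lambda>t::real. k) \<longlongrightarrow> F c) at_top" by (rule Lim_transform_eventually)
  then have "F c = k" by (simp add: tendsto_const_iff)
  then show ?thesis using k[of 0] by simp
qed

text \<open>
  Compactness of the unit sphere of \<open>E\<close>.
\<close>

lemma subspace_bounded_below:
  fixes D :: "'j \<Rightarrow> 'a::euclidean_space \<Rightarrow> real"
  assumes E: "subspace E" and J: "finite J" and D: "\<And>j. j \<in> J \<Longrightarrow> bounded_linear (D j)"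
    and inj: "\<And>v. v \<in> E \<Longrightarrow> (\<And>j. j \<in> J \<Longrightarrow> D j v = 0) \<Longrightarrow> v = 0"
  shows "\<exists>c>0. \<forall>v\<in>E. v \<noteq> 0 \<longrightarrow> (\<exists>j\<in>J. c * norm v \<le> \<bar>D j v\<bar>)"
proof -
  define \<Phi> where "\<Phi> v = (\<Sum>j\<in>J. \<bar>D j v\<bar>)" for v
  define K where "K = E \<inter> sphere 0 1"
  have "compact K" unfolding K_def using closed_subspace[OF E] by (intro closed_Int_compact) auto
  have cont: "continuous_on K \<Phi>"
    unfolding \<Phi>_def by (intro continuous_intros bounded_linear.continuous_on[OF D]) auto
  have "\<exists>c>0. \<forall>v\<in>K. c \<le> \<Phi> v"
  proof (cases "K = {}")
    case False
    obtain w where w: "w \<in> K" "\<And>v. v \<in> K \<Longrightarrow> \<Phi> w \<le> \<Phi> v"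
      using continuous_attains_inf[OF \<open>compact K\<close> False cont] by auto
    have "\<Phi> w \<noteq> 0"
    proof
      assume "\<Phi> w = 0"
      then have "\<And>j. j \<in> J \<Longrightarrow> D j w = 0" unfolding \<Phi>_def using J by (simp add: sum_nonneg_eq_0_iff)
      then show False using inj[of w] w(1) by (auto simp: K_def)
    qed
    moreover have "\<Phi> w \<ge> 0" by (auto simp: \<Phi>_def intro: sum_nonneg)
    ultimately show ?thesis using w(2) by (intro exI[of _ "\<Phi> w"]) auto
  qed (auto intro: exI[of _ 1])
  then obtain c where c: "c > 0" "\<And>v. v \<in> K \<Longrightarrow> c \<le> \<Phi> v" by auto
  define c' where "c' = c / (real (card J) + 1)"
  have c': "c' > 0" using c by (simp add: c'_def)
  have "\<exists>j\<in>J. c' * norm v \<le> \<bar>D j v\<bar>" if v: "v \<in> E" "v \<noteq> 0" for v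
  proof (rule ccontr)
    assume neg: "\<not> ?thesis"
    define w where "w = v /\<^sub>R norm v"
    have wK: "w \<in> K" using v subspace_scale[OF E] by (auto simp: K_def w_def)
    have "\<bar>D j w\<bar> \<le> c'" if "j \<in> J" for j
    proof -
      have "D j w = D j v / norm v"
        using linear_scale[OF bounded_linear.linear[OF D[OF that]], of "inverse (norm v)" v]
        by (simp add: w_def divide_inverse mult.commute)
      moreover have "\<bar>D j v\<bar> < c' * norm v" using neg that by auto
      ultimately show ?thesis using v by (simp add: abs_divide pos_divide_le_eq)
    qed
    then have "\<Phi> w \<le> real (card J) * c'" unfolding \<Phi>_def by (rule sum_bounded_above)
    also have "\<dots> < c" using c by (simp add: c'_def field_simps)
    finally show False using c(2)[OF wK] by simp
  qed
  then show ?thesis using c' by blast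
qed

context exponential_dichotomy
begin

text \<open>
  At the first time at which \<open>w\<close> reaches the sphere of radius \<open>r\<close> it still agrees with \<open>u\<close>, by uniqueness of
  solutions up to that time, and \<open>u\<close> is smaller.
\<close>

lemma trapped_orbit:
  assumes u: "\<And>t. 0 \<le> t \<Longrightarrow> (u has_vector_derivative A (u t) + h (u t)) (at t within {0..})"
    and ur: "\<And>t. 0 \<le> t \<Longrightarrow> norm (u t) \<le> s" and sr: "s < r"
    and w: "\<And>t. 0 \<le> t \<Longrightarrow> (w has_vector_derivative A (w t) + h (w t)) (at t within {0..})"
    and h: "\<And>x y. x \<in> cball 0 r \<Longrightarrow> y \<in> cball 0 r \<Longrightarrow> norm (h x - h y) \<le> \<epsilon> * norm (x - y)"
    and eq: "u 0 = w 0" and t: "0 \<le> t"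
  shows "norm (w t) < r"
proof (rule ccontr)
  assume neg: "\<not> ?thesis"
  have wc: "continuous_on {0..} w" by (rule continuous_on_vector_derivative[OF w]) auto
  define B where "B = {\<tau>\<in>{0..t}. r \<le> norm (w \<tau>)}"
  have "closed ({0..t} \<inter> (\<lambda>\<tau>. norm (w \<tau>)) -` {r..})"
    by (intro continuous_closed_preimage continuous_on_norm continuous_on_subset[OF wc]) auto
  moreover have "B = {0..t} \<inter> ({0..t} \<inter> (\<lambda>\<tau>. norm (w \<tau>)) -` {r..})" by (auto simp: B_def)
  ultimately have "compact B" using compact_Int_closed[OF compact_Icc] by metis
  moreover have "B \<noteq> {}" using neg t by (auto simp: B_def)
  ultimately obtain b where b: "b \<in> B" "\<And>\<tau>. \<tau> \<in> B \<Longrightarrow> b \<le> \<tau>"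
    using compact_attains_inf[of B] by auto
  have b0: "0 \<le> b" "r \<le> norm (w b)" using b by (auto simp: B_def)
  have before: "norm (w \<tau>) < r" if "0 \<le> \<tau>" "\<tau> < b" for \<tau>
    using b(2)[of \<tau>] b(1) that by (force simp: B_def)
  have wb: "norm (w b) \<le> r"
  proof (cases "b = 0")
    case True
    then show ?thesis using eq ur[of 0] sr by simp
  next
    case False
    have "((\<lambda>\<tau>. norm (w \<tau>)) \<longlongrightarrow> norm (w b)) (at b within {0..<b})"
      using wc b0 by (intro tendsto_norm) (auto simp: continuous_on intro: tendsto_within_subset)
    moreover have "\<forall>\<^sub>F \<tau> in at b within {0..<b}. norm (w \<tau>) \<le> r"
      using before by (auto simp: eventually_at_filter less_imp_le)
    moreover have "at b within {0..<b} \<noteq> bot"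
      using False b0 by (simp add: at_within_eq_bot_iff[of b] trivial_limit_within islimpt_Ico)
    ultimately show ?thesis by (rule tendsto_upperbound)
  qed
  obtain K where K: "0 \<le> K" "\<And>x. norm (A x) \<le> norm x * K" using bounded_linear.nonneg_bounded[OF A] by auto
  have "(\<lambda>\<tau>. w \<tau> - u \<tau>) b = 0"
  proof (rule linear_growth_eq_0[where K = "K + \<epsilon>" and d = "\<lambda>\<tau>. (A (w \<tau>) + h (w \<tau>)) - (A (u \<tau>) + h (u \<tau>))"])
    fix \<tau> assume \<tau>: "\<tau> \<in> {0..b}"
    show "((\<lambda>\<tau>. w \<tau> - u \<tau>) has_vector_derivative (A (w \<tau>) + h (w \<tau>)) - (A (u \<tau>) + h (u \<tau>))) (at \<tau> within {0..b})"
      using \<tau> has_vector_derivative_within_subset[OF u, of \<tau> "{0..b}"] has_vector_derivative_within_subset[OF w, of \<tau> "{0..b}"]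
      by (intro has_vector_derivative_diff) auto
    have wr: "w \<tau> \<in> cball 0 r" using before[of \<tau>] wb \<tau> by (cases "\<tau> = b") auto
    have "(A (w \<tau>) + h (w \<tau>)) - (A (u \<tau>) + h (u \<tau>)) = A (w \<tau> - u \<tau>) + (h (w \<tau>) - h (u \<tau>))"
      by (simp add: linear_diff[OF A_linear])
    also have "norm \<dots> \<le> norm (w \<tau> - u \<tau>) * K + \<epsilon> * norm (w \<tau> - u \<tau>)"
      using K(2)[of "w \<tau> - u \<tau>"] h[of "w \<tau>" "u \<tau>"] wr ur[of \<tau>] sr \<tau>
      by (intro order_trans[OF norm_triangle_ineq add_mono]) auto
    finally show "norm ((A (w \<tau>) + h (w \<tau>)) - (A (u \<tau>) + h (u \<tau>))) \<le> (K + \<epsilon>) * norm (w \<tau> - u \<tau>)"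
      by (simp add: algebra_simps)
  qed (use b0 eq in auto)
  then show False using ur[OF b0(1)] sr b0(2) by simp
qed

text \<open>
  The parameter \<open>p\<close> stands for \<open>(I, \<alpha>)\<close>. The assumption \<open>transversal\<close> is what rules out excursions: it says
  that at some late point of the base orbit the level set of the functions \<open>F j\<close> and the affine unstable
  space intersect transversally, so that a point of the level set close to \<open>q p\<^sub>0 T\<close> is determined by its
  class modulo \<open>E\<close>.
\<close>

theorem uniform_tail:
  fixes X :: "'p::topological_space \<Rightarrow> 'a \<Rightarrow> 'a" and c :: "'p \<Rightarrow> 'a" and q :: "'p \<Rightarrow> real \<Rightarrow> 'a"
    and F :: "'j \<Rightarrow> 'p \<Rightarrow> 'a \<Rightarrow> real" and DF :: "'j \<Rightarrow> 'p \<Rightarrow> 'a \<Rightarrow> 'a \<Rightarrow> real"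
  assumes equilibrium: "\<forall>\<^sub>F p in nhds p0. X p (c p) = 0"
    and orbit: "\<forall>\<^sub>F p in nhds p0. (\<forall>t. (q p has_vector_derivative X p (q p t)) (at t)) \<and> (q p \<longlongrightarrow> c p) at_top"
    and c_cont: "(c \<longlongrightarrow> c p0) (nhds p0)" and q_cont: "\<And>t. ((\<lambda>p. q p t) \<longlongrightarrow> q p0 t) (nhds p0)"
    and near_linear: "\<And>e. e > 0 \<Longrightarrow> \<exists>r>0. \<forall>\<^sub>F p in nhds p0. \<forall>x\<in>cball 0 r. \<forall>y\<in>cball 0 r.
        norm (X p (c p + x) - X p (c p + y) - A (x - y)) \<le> e * norm (x - y)"
    and X_cont: "\<exists>r>0. \<forall>e>0. \<forall>\<^sub>F p in nhds p0. \<forall>x\<in>cball 0 r. norm (X p (c p + x) - X p0 (c p0 + x)) \<le> e"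
    and J: "finite J"
    and F: "\<forall>\<^sub>F p in nhds p0. \<forall>j\<in>J. \<forall>x. (F j p has_derivative DF j p x) (at x) \<and> DF j p x (X p x) = 0"
    and DF_cont: "\<And>j x0 e. j \<in> J \<Longrightarrow> e > 0 \<Longrightarrow> \<exists>r>0. \<forall>\<^sub>F p in nhds p0. \<forall>x\<in>ball x0 r. \<forall>v.
        \<bar>DF j p x v - DF j p0 x0 v\<bar> \<le> e * norm v"
    and transversal: "\<exists>\<^sub>F T in at_top. \<forall>v\<in>E. (\<forall>j\<in>J. DF j p0 (q p0 T) v = 0) \<longrightarrow> v = 0"
    and \<rho>: "\<rho> > 0"
  shows "\<exists>T. \<forall>\<^sub>F p in nhds p0. \<forall>t\<ge>T. norm (q p t - c p0) < \<rho>"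
proof -
  \<comment> \<open>the largest value allowed by the decay lemma, which asks for \<open>8 C \<epsilon> \<le> 1\<close>\<close>
  define \<epsilon> where "\<epsilon> = 1 / (8 * C)"
  have \<epsilon>: "\<epsilon> > 0" "8 * C * \<epsilon> \<le> 1" "2 * C * \<epsilon> \<le> 1" using C by (auto simp: \<epsilon>_def)
  obtain r1 where r1: "r1 > 0" "\<forall>\<^sub>F p in nhds p0. \<forall>x\<in>cball 0 r1. \<forall>y\<in>cball 0 r1.
        norm (X p (c p + x) - X p (c p + y) - A (x - y)) \<le> \<epsilon> * norm (x - y)"
    using near_linear[OF \<epsilon>(1)] by auto
  obtain r2 where r2: "r2 > 0" "\<And>e. e > 0 \<Longrightarrow> \<forall>\<^sub>F p in nhds p0. \<forall>x\<in>cball 0 r2. norm (X p (c p + x) - X p0 (c p0 + x)) \<le> e"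
    using X_cont by auto
  define r where "r = min (min r1 r2) (\<rho> / 2)"
  have r: "r > 0" "r \<le> r1" "r \<le> r2" "r \<le> \<rho> / 2" using r1 r2 \<rho> by (auto simp: r_def)
  define h where "h p x = X p (c p + x) - A x" for p x
  have lip: "\<forall>\<^sub>F p in nhds p0. \<forall>x\<in>cball 0 r. \<forall>y\<in>cball 0 r. norm (h p x - h p y) \<le> \<epsilon> * norm (x - y)"
    using r1(2)
  proof eventually_elim
    case (elim p)
    show ?case
    proof (intro ballI)
      fix x y :: 'a assume xy: "x \<in> cball 0 r" "y \<in> cball 0 r"
      have "h p x - h p y = X p (c p + x) - X p (c p + y) - A (x - y)"
        by (simp add: h_def linear_diff[OF A_linear])
      then show "norm (h p x - h p y) \<le> \<epsilon> * norm (x - y)"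
        using elim xy r by auto
    qed
  qed
  \<comment> \<open>the second bound leaves room for doubling the distance when \<open>p\<close> varies and for the radius \<open>r / 2\<close> below\<close>
  define s where "s = min (r / 4) (r / (16 * C))"
  have s: "s > 0" "s \<le> r / 4" "16 * C * s \<le> r"
  proof -
    show "s > 0" "s \<le> r / 4" using r C by (auto simp: s_def)
    have "s \<le> r / (16 * C)" by (simp add: s_def)
    then show "16 * C * s \<le> r" using C by (simp add: field_simps)
  qed
  have orbit0: "\<And>t. (q p0 has_vector_derivative X p0 (q p0 t)) (at t)" "(q p0 \<longlongrightarrow> c p0) at_top"
    using eventually_nhds_x_imp_x[OF orbit] by auto
  have "\<forall>\<^sub>F t in at_top. dist (q p0 t) (c p0) < s" using tendstoD[OF orbit0(2) s(1)] .
  then obtain T0 where T0: "\<And>t. t \<ge> T0 \<Longrightarrow> dist (q p0 t) (c p0) < s" by (auto simp: eventually_at_top_linorder)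
  obtain T where T: "T \<ge> T0" "\<And>v. v \<in> E \<Longrightarrow> (\<forall>j\<in>J. DF j p0 (q p0 T) v = 0) \<Longrightarrow> v = 0"
    using frequently_ex[OF frequently_eventually_frequently[OF transversal eventually_ge_at_top[of T0]]] by blast
  define y0 where "y0 = q p0 T"
  define d0 where "d0 t = q p0 (T + t) - c p0" for t
  define \<delta> where "\<delta> p = q p T - c p" for p
  have d0: "norm (d0 t) \<le> s" if "0 \<le> t" for t
    using T0[of "T + t"] T that by (simp add: d0_def dist_norm)
  have \<delta>0: "\<delta> p0 = d0 0" by (simp add: \<delta>_def d0_def)
  have F0: "\<And>j x. j \<in> J \<Longrightarrow> (F j p0 has_derivative DF j p0 x) (at x)"
    using eventually_nhds_x_imp_x[OF F] by auto
  obtain a where a: "a > 0" "\<And>v. v \<in> E \<Longrightarrow> v \<noteq> 0 \<Longrightarrow> \<exists>j\<in>J. a * norm v \<le> \<bar>DF j p0 y0 v\<bar>"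
    using subspace_bounded_below[OF E J, of "\<lambda>j. DF j p0 y0"] T(2) has_derivative_bounded_linear[OF F0]
    unfolding y0_def by blast
  have "\<forall>j\<in>J. \<exists>r>0. \<forall>\<^sub>F p in nhds p0. \<forall>x\<in>ball y0 r. \<forall>v. \<bar>DF j p x v - DF j p0 y0 v\<bar> \<le> a / 2 * norm v"
    by (intro ballI DF_cont) (use a in auto)
  from bchoice[OF this] obtain R where R: "\<And>j. j \<in> J \<Longrightarrow> R j > 0"
    "\<And>j. j \<in> J \<Longrightarrow> \<forall>\<^sub>F p in nhds p0. \<forall>x\<in>ball y0 (R j). \<forall>v. \<bar>DF j p x v - DF j p0 y0 v\<bar> \<le> a / 2 * norm v"
    by blast
  obtain R0 where R0: "R0 > 0" "\<And>j. j \<in> J \<Longrightarrow> R0 \<le> R j"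
  proof (cases "J = {}")
    case False
    then show ?thesis using that[of "Min (R ` J)"] J R(1) by auto
  qed (use that[of 1] in auto)
  have DFe: "\<forall>\<^sub>F p in nhds p0. \<forall>j\<in>J. \<forall>x\<in>ball y0 R0. \<forall>v. \<bar>DF j p x v - DF j p0 y0 v\<bar> \<le> a / 2 * norm v"
  proof (rule eventually_ball_finite[OF J], rule ballI)
    fix j assume j: "j \<in> J"
    show "\<forall>\<^sub>F p in nhds p0. \<forall>x\<in>ball y0 R0. \<forall>v. \<bar>DF j p x v - DF j p0 y0 v\<bar> \<le> a / 2 * norm v"
      using R(2)[OF j] by eventually_elim (use R0(2)[OF j] in auto)
  qed
  define \<eta> where "\<eta> = min (s) (min (R0 / 4) (R0 / (16 * C)))"
  have \<eta>: "\<eta> > 0" "\<eta> \<le> s" "\<eta> \<le> R0 / 4" "4 * C * \<eta> \<le> R0 / 4"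
  proof -
    show "\<eta> > 0" "\<eta> \<le> s" "\<eta> \<le> R0 / 4" using s R0 C by (auto simp: \<eta>_def)
    have "\<eta> \<le> R0 / (16 * C)" by (simp add: \<eta>_def)
    then show "4 * C * \<eta> \<le> R0 / 4" using C by (simp add: field_simps)
  qed
  have e1: "\<forall>\<^sub>F p in nhds p0. norm (c p - c p0) < \<eta>"
    using tendstoD[OF c_cont \<eta>(1)] by (simp add: dist_norm)
  have e2: "\<forall>\<^sub>F p in nhds p0. norm (\<delta> p - \<delta> p0) < \<eta>"
  proof -
    have "(\<delta> \<longlongrightarrow> \<delta> p0) (nhds p0)" unfolding \<delta>_def by (intro tendsto_intros q_cont c_cont)
    from tendstoD[OF this \<eta>(1)] show ?thesis by (simp add: dist_norm)
  qed
  have e3: "\<forall>\<^sub>F p in nhds p0. \<forall>x\<in>cball 0 r2. norm (X p (c p + x) - X p0 (c p0 + x)) \<le> \<eta>"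
    by (rule r2(2)[OF \<eta>(1)])
  have e4: "\<forall>\<^sub>F p in nhds p0. norm (q p T - y0) < R0"
    using tendstoD[OF q_cont[of T] R0(1)] by (simp add: dist_norm y0_def)
  have X00: "X p0 (c p0) = 0" using eventually_nhds_x_imp_x[OF equilibrium] .
  have lip0: "\<And>x y. x \<in> cball 0 r \<Longrightarrow> y \<in> cball 0 r \<Longrightarrow> norm (h p0 x - h p0 y) \<le> \<epsilon> * norm (x - y)"
    using eventually_nhds_x_imp_x[OF lip] by auto
  have hcont: "continuous_on {0..} (\<lambda>t. h p (w t))"
    if "\<And>x y. x \<in> cball 0 r \<Longrightarrow> y \<in> cball 0 r \<Longrightarrow> norm (h p x - h p y) \<le> \<epsilon> * norm (x - y)"
      and "continuous_on {0..} w" "\<And>t. 0 \<le> t \<Longrightarrow> norm (w t) \<le> r" for p w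
  proof -
    have "continuous_on (cball 0 r) (h p)"
      by (rule lipschitz_on_continuous_on[of \<epsilon>])
         (use that(1) \<epsilon> in \<open>auto intro!: lipschitz_onI simp: dist_norm\<close>)
    moreover have "w ` {0..} \<subseteq> cball 0 r" using that(3) by auto
    ultimately show ?thesis by (rule continuous_on_compose2[OF _ that(2)])
  qed
  have d0': "(d0 has_vector_derivative A (d0 t) + h p0 (d0 t)) (at t within {0..})" for t
    using has_vector_derivative_diff[OF has_vector_derivative_shift[OF orbit0(1)[of "T + t"]] has_vector_derivative_const]
    unfolding d0_def h_def by simp
  have "\<forall>\<^sub>F p in nhds p0. \<forall>t\<ge>T. norm (q p t - c p0) < \<rho>"
    using equilibrium orbit lip F DFe e1 e2 e3 e4
  proof eventually_elim
    case (elim p)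
    have lip_p: "\<And>x y. x \<in> cball 0 r \<Longrightarrow> y \<in> cball 0 r \<Longrightarrow> norm (h p x - h p y) \<le> \<epsilon> * norm (x - y)"
      using elim(3) by auto
    have hp0: "h p 0 = 0" using elim(1) by (simp add: h_def linear_0[OF A_linear])
    have "norm (\<delta> p) \<le> norm (\<delta> p0) + norm (\<delta> p - \<delta> p0)" by (metis norm_triangle_sub)
    also have "\<dots> \<le> 2 * s" using d0[of 0] \<delta>0 elim(7) \<eta>(2) by simp
    finally have "norm (\<delta> p) \<le> 2 * s" .
    then have "2 * C * norm (\<delta> p) \<le> 2 * C * (2 * s)" using C by (intro mult_left_mono) auto
    also have "\<dots> = 16 * C * s / 4" by simp
    also have "\<dots> \<le> r / 2" using s(3) r(1) by linarith
    finally have \<delta>p: "2 * C * norm (\<delta> p) \<le> r / 2" .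
    obtain d where d: "d 0 - \<delta> p \<in> E" "\<And>t. 0 \<le> t \<Longrightarrow> (d has_vector_derivative A (d t) + h p (d t)) (at t within {0..})"
      "\<And>t. 0 \<le> t \<Longrightarrow> norm (d t) \<le> r / 2"
    proof -
      have "\<exists>u. u 0 - \<delta> p \<in> E \<and> solves u (\<lambda>t. A (u t) + h p (u t)) \<and>
          (\<forall>t\<ge>0. norm (u t) \<le> r / 2)"
      proof (rule bounded_solution_exists[of "h p", OF hp0 _ less_imp_le[OF \<epsilon>(1)] \<epsilon>(3) _ \<delta>p])
        show "norm (h p x - h p y) \<le> \<epsilon> * norm (x - y)" if "x \<in> cball 0 (r/2)" "y \<in> cball 0 (r/2)" for x y
          by (rule lip_p) (use that r in auto)
      qed (use r in auto)
      then show ?thesis using that by blast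
    qed
    have dr: "norm (d t) \<le> r" if "0 \<le> t" for t using d(3)[OF that] r by simp
    have dcont: "continuous_on {0..} d" by (rule continuous_on_of_vector_derivative[OF d(2)])
    note hd = hcont[OF lip_p dcont dr]
    have hdb: "norm (h p (d t)) \<le> \<epsilon> * norm (d t)" if "0 \<le> t" for t
      using lip_p[of "d t" 0] dr[OF that] r hp0 by simp
    have lim: "(d \<longlongrightarrow> 0) at_top"
      by (rule decay[OF d(2) d(3) hd hdb \<epsilon>(1,2)])
    \<comment> \<open>the second candidate for the point \<open>q p T\<close>; the two are shown to coincide\<close>
    define y where "y = c p + d 0"
    have sol: "((\<lambda>t. c p + d t) has_vector_derivative X p (c p + d t)) (at t within {0..})" if "0 \<le> t" for t
      using has_vector_derivative_add[OF has_vector_derivative_const d(2)[OF that], of "c p"] by (simp add: h_def)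
    have Fy: "F j p y = F j p (q p T)" if j: "j \<in> J" for j
    proof -
      have Fj: "\<And>x. (F j p has_derivative DF j p x) (at x)" "\<And>x. DF j p x (X p x) = 0" using elim(4) j by auto
      have "((\<lambda>t. c p + d t) \<longlongrightarrow> c p + 0) at_top" by (intro tendsto_intros lim)
      then have "((\<lambda>t. c p + d t) \<longlongrightarrow> c p) at_top" by simp
      from first_integral_constant[of "\<lambda>t. c p + d t", OF sol Fj this]
      have 1: "F j p y = F j p (c p)" by (simp add: y_def)
      have "((\<lambda>t. q p (T + t)) \<longlongrightarrow> c p) at_top"
        by (rule filterlim_compose[OF conjunct2[OF elim(2)] filterlim_tendsto_add_at_top[OF tendsto_const filterlim_ident]])
      from first_integral_constant[of "\<lambda>t. q p (T + t)", OF has_vector_derivative_shift[OF spec[OF conjunct1[OF elim(2)]]] Fj this]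
      have "F j p (q p T) = F j p (c p)" by simp
      then show ?thesis using 1 by simp
    qed
    \<comment> \<open>compares the constructed solution with the base orbit: \<open>y\<close> is close to \<open>y0\<close>, where the level sets are known\<close>
    have dd0: "norm (d 0 - d0 0) \<le> 2 * C * (norm (\<delta> p - \<delta> p0) + \<eta>)"
    proof (rule perturbed_estimate[of "\<lambda>t. d t - d0 t" "\<lambda>t. h p (d t) - h p0 (d0 t)" "r + r" "\<delta> p - \<delta> p0" \<epsilon> \<eta>])
      fix t :: real assume t: "0 \<le> t"
      show "((\<lambda>t. d t - d0 t) has_vector_derivative A (d t - d0 t) + (h p (d t) - h p0 (d0 t))) (at t within {0..})"
        using has_vector_derivative_diff[OF d(2)[OF t] d0'[of t]] by (simp add: linear_diff[OF A_linear] algebra_simps)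
      have d0r: "norm (d0 t) \<le> r" using d0[OF t] s r by linarith
      show "norm (d t - d0 t) \<le> r + r" using norm_triangle_ineq4[of "d t" "d0 t"] d0r dr[OF t] by linarith
      have "h p (d t) - h p0 (d0 t) = (h p (d t) - h p (d0 t)) + (X p (c p + d0 t) - X p0 (c p0 + d0 t))"
        by (simp add: h_def)
      also have "norm \<dots> \<le> \<epsilon> * norm (d t - d0 t) + \<eta>"
        using lip_p[of "d t" "d0 t"] elim(8) d0r dr[OF t] r
        by (intro order_trans[OF norm_triangle_ineq add_mono]) auto
      finally show "norm (h p (d t) - h p0 (d0 t)) \<le> \<epsilon> * norm (d t - d0 t) + \<eta>" .
    next
      have "continuous_on {0..} (\<lambda>t. h p0 (d0 t))"
      proof (rule hcont[OF lip0 continuous_on_of_vector_derivative[OF d0']])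
        fix t :: real assume "0 \<le> t"
        then show "norm (d0 t) \<le> r" using d0[of t] s(2) r(1) by linarith
      qed
      then show "continuous_on {0..} (\<lambda>t. h p (d t) - h p0 (d0 t))" by (intro continuous_on_diff hd)
      show "d 0 - d0 0 - (\<delta> p - \<delta> p0) \<in> E" using d(1) \<delta>0 by simp
    qed (use \<epsilon> in auto)
    also have "\<dots> \<le> 2 * C * (\<eta> + \<eta>)" using elim(7) C by (intro mult_left_mono add_mono) auto
    also have "\<dots> \<le> R0 / 4" using \<eta>(4) by simp
    finally have dd0': "norm (d 0 - d0 0) \<le> R0 / 4" .
    have "y - y0 = (c p - c p0) + (d 0 - d0 0)" by (simp add: y_def y0_def d0_def)
    then have "norm (y - y0) \<le> norm (c p - c p0) + norm (d 0 - d0 0)" using norm_triangle_ineq by metis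
    then have yB: "y \<in> ball y0 R0" using elim(6) dd0' \<eta>(3) R0(1) by (simp add: dist_norm norm_minus_commute)
    have qB: "q p T \<in> ball y0 R0" using elim(9) by (simp add: dist_norm norm_minus_commute)
    have "y - q p T = 0"
    proof (rule ccontr)
      assume ne: "y - q p T \<noteq> 0"
      have "y - q p T = d 0 - \<delta> p" by (simp add: y_def \<delta>_def)
      then have "y - q p T \<in> E" using d(1) by simp
      from a(2)[OF this ne] obtain j where j: "j \<in> J" "a * norm (y - q p T) \<le> \<bar>DF j p0 y0 (y - q p T)\<bar>" by auto
      have lin0: "bounded_linear (DF j p0 y0)" using has_derivative_bounded_linear[OF F0[OF j(1)]] .
      \<comment> \<open>on the ball \<open>F j p\<close> differs from the linear map \<open>DF j p0 y0\<close> by a function of slope at most \<open>a / 2\<close>, which cannot compensate for the slope \<open>a\<close> of that map along the difference\<close>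
      have "norm ((F j p y - DF j p0 y0 y) - (F j p (q p T) - DF j p0 y0 (q p T))) \<le> a / 2 * norm (y - q p T)"
      proof (rule differentiable_bound[OF convex_ball _ _ yB qB])
        fix x assume x: "x \<in> ball y0 R0"
        show "((\<lambda>x. F j p x - DF j p0 y0 x) has_derivative (\<lambda>v. DF j p x v - DF j p0 y0 v)) (at x within ball y0 R0)"
          by (rule has_derivative_diff[OF has_derivative_at_withinI bounded_linear_imp_has_derivative[OF lin0]])
             (use elim(4) j(1) in auto)
        show "onorm (\<lambda>v. DF j p x v - DF j p0 y0 v) \<le> a / 2"
          using elim(5) j(1) x a(1) by (intro onorm_bound) auto
      qed
      then have "\<bar>DF j p0 y0 (y - q p T)\<bar> \<le> a / 2 * norm (y - q p T)"
        using Fy[OF j(1)] by (simp add: linear_diff[OF bounded_linear.linear[OF lin0]] abs_minus_commute)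
      then have "a * norm (y - q p T) \<le> a / 2 * norm (y - q p T)" using j(2) by linarith
      then show False using a(1) ne by simp
    qed
    then have init: "d 0 = q p (T + 0) - c p" by (simp add: y_def algebra_simps)
    have tr: "norm (q p (T + t) - c p) < r" if "0 \<le> t" for t
    proof (rule trapped_orbit[where u = d and h = "h p" and w = "\<lambda>t. q p (T + t) - c p", OF d(2) d(3) _ _ lip_p init that])
      show "r / 2 < r" using r by simp
      fix \<tau> :: real assume "0 \<le> \<tau>"
      have "(q p has_vector_derivative X p (q p (T + \<tau>))) (at (T + \<tau>))" using elim(2) by auto
      from has_vector_derivative_diff[OF has_vector_derivative_shift[OF this] has_vector_derivative_const]
      show "((\<lambda>a. q p (T + a) - c p) has_vector_derivative
          A (q p (T + \<tau>) - c p) + h p (q p (T + \<tau>) - c p)) (at \<tau> within {0..})"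
        by (simp add: h_def)
    qed
    show ?case
    proof (intro allI impI)
      fix t assume "T \<le> t"
      then have "norm (q p t - c p) < r" using tr[of "t - T"] by simp
      moreover have "norm (q p t - c p0) \<le> norm (q p t - c p) + norm (c p - c p0)"
        using norm_triangle_ineq[of "q p t - c p" "c p - c p0"] by simp
      ultimately show "norm (q p t - c p0) < \<rho>" using elim(6) \<eta>(2) s(2) r(1,4) by linarith
    qed
  qed
  then show ?thesis by blast
qed

end

section \<open>Symmetric Hessians and transversality\<close>

text \<open>
  The mean value theorem is applied to \<open>\<tau> \<mapsto> f (x + s u + \<tau> v) - f (x + \<tau> v)\<close>, and
  the resulting difference of gradients is expanded to first order at \<open>x\<close>.
\<close>

lemma second_difference:
  fixes f :: "'a::real_inner \<Rightarrow> real"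
  assumes f: "\<And>y. (f has_derivative (\<lambda>v. g y \<bullet> v)) (at y)"
    and g: "(g has_derivative D) (at x)" and e: "e > 0"
  shows "\<forall>\<^sub>F s in at_right 0. \<bar>f (x + s *\<^sub>R u + s *\<^sub>R v) - f (x + s *\<^sub>R u) - f (x + s *\<^sub>R v) + f x - s\<^sup>2 * (D u \<bullet> v)\<bar> \<le> e * s\<^sup>2"
proof -
  interpret D: bounded_linear D using g by (rule has_derivative_bounded_linear)
  \<comment> \<open>absorbs the distances of the two intermediate points from \<open>x\<close>, which are at most \<open>s (\<bar>u\<bar> + \<bar>v\<bar>)\<close> and \<open>s \<bar>v\<bar>\<close>\<close>
  define K where "K = (norm u + 2 * norm v) * norm v + 1"
  have K: "K > 0" by (simp add: K_def add_nonneg_pos)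
  obtain d where d: "d > 0" "\<And>y. norm (y - x) < d \<Longrightarrow> norm (g y - g x - D (y - x)) \<le> e / K * norm (y - x)"
    using g[unfolded has_derivative_at_alt] e K by (metis divide_pos_pos)
  define L where "L = norm u + norm v + 1"
  have L: "L > 0" by (simp add: L_def add_nonneg_pos)
  have "\<forall>\<^sub>F s in at_right 0. 0 < s \<and> s < d / L"
    using d L by (auto simp: eventually_at_right_field intro!: exI[of _ "d / L"])
  then show ?thesis
  proof eventually_elim
    case (elim s)
    then have s: "0 < s" "s * L < d" using L by (auto simp: pos_less_divide_eq)
    define \<psi> where "\<psi> \<tau> = f (x + s *\<^sub>R u + \<tau> *\<^sub>R v) - f (x + \<tau> *\<^sub>R v)" for \<tau>
    have der: "(\<psi> has_real_derivative (g (x + s *\<^sub>R u + \<tau> *\<^sub>R v) \<bullet> v - g (x + \<tau> *\<^sub>R v) \<bullet> v)) (at \<tau>)" for \<tau>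
    proof -
      have 1: "((\<lambda>\<tau>. f (z + \<tau> *\<^sub>R v)) has_derivative (\<lambda>h. g (z + \<tau> *\<^sub>R v) \<bullet> (h *\<^sub>R v))) (at \<tau>)" for z
      proof -
        have "((\<lambda>\<tau>. z + \<tau> *\<^sub>R v) has_derivative (\<lambda>h. h *\<^sub>R v)) (at \<tau>)"
          by (auto intro!: derivative_eq_intros)
        from has_derivative_compose[OF this f] show ?thesis .
      qed
      show ?thesis
        unfolding \<psi>_def has_field_derivative_def
        by (rule has_derivative_eq_rhs[OF has_derivative_diff[OF 1[of "x + s *\<^sub>R u"] 1[of x]]])
           (auto simp: fun_eq_iff algebra_simps)
    qed
    obtain \<xi> where \<xi>: "0 < \<xi>" "\<xi> < s" "\<psi> s - \<psi> 0 = (s - 0) * (g (x + s *\<^sub>R u + \<xi> *\<^sub>R v) \<bullet> v - g (x + \<xi> *\<^sub>R v) \<bullet> v)"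
      using MVT2[OF s(1) der] by blast
    define y where "y = x + s *\<^sub>R u + \<xi> *\<^sub>R v"
    define y' where "y' = x + \<xi> *\<^sub>R v"
    have ny: "norm (y - x) \<le> s * (norm u + norm v)"
    proof -
      have "norm (y - x) \<le> s * norm u + \<xi> * norm v"
        using norm_triangle_ineq[of "s *\<^sub>R u" "\<xi> *\<^sub>R v"] s \<xi> by (simp add: y_def)
      also have "\<dots> \<le> s * norm u + s * norm v" using \<xi> by (intro add_mono mult_right_mono) auto
      finally show ?thesis by (simp add: algebra_simps)
    qed
    have ny': "norm (y' - x) \<le> s * norm v" using \<xi> by (simp add: y'_def mult_right_mono)
    have "s * (norm u + norm v) \<le> s * L" "s * norm v \<le> s * L" using s by (simp_all add: L_def)
    then have small: "norm (y - x) < d" "norm (y' - x) < d" using ny ny' s(2) by auto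
    have Dy: "D (y - x) - D (y' - x) = s *\<^sub>R D u"
      unfolding D.diff[symmetric] by (simp add: y_def y'_def D.scaleR)
    have "\<psi> s - \<psi> 0 - s\<^sup>2 * (D u \<bullet> v) = s * (((g y - g x - D (y - x)) - (g y' - g x - D (y' - x))) \<bullet> v)"
      using \<xi>(3) Dy unfolding y_def[symmetric] y'_def[symmetric]
      by (simp add: inner_diff_left power2_eq_square algebra_simps flip: inner_scaleR_left)
    also have "\<bar>\<dots>\<bar> \<le> s * ((e / K * norm (y - x) + e / K * norm (y' - x)) * norm v)"
    proof -
      have "\<bar>((g y - g x - D (y - x)) - (g y' - g x - D (y' - x))) \<bullet> v\<bar>
          \<le> norm ((g y - g x - D (y - x)) - (g y' - g x - D (y' - x))) * norm v"
        by (rule Cauchy_Schwarz_ineq2)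
      also have "\<dots> \<le> (e / K * norm (y - x) + e / K * norm (y' - x)) * norm v"
        using d(2)[OF small(1)] d(2)[OF small(2)]
        by (intro mult_right_mono order_trans[OF norm_triangle_ineq4 add_mono]) auto
      finally show ?thesis using s by (simp add: abs_mult)
    qed
    also have "\<dots> \<le> s * ((e / K * (s * (norm u + norm v)) + e / K * (s * norm v)) * norm v)"
      using s e K ny ny' by (intro mult_left_mono mult_right_mono add_mono) auto
    also have "\<dots> = e * s\<^sup>2 * (((norm u + 2 * norm v) * norm v) / K)"
      by (simp add: power2_eq_square algebra_simps add_divide_distrib)
    also have "\<dots> \<le> e * s\<^sup>2 * 1" using e K by (intro mult_left_mono) (auto simp: K_def)
    finally show ?case by (simp add: \<psi>_def algebra_simps)
  qed
qed

text \<open>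
  The second difference is symmetric in \<open>u\<close> and \<open>v\<close>.
\<close>

lemma symmetric_hessian:
  fixes f :: "'a::real_inner \<Rightarrow> real"
  assumes f: "\<And>y. (f has_derivative (\<lambda>v. g y \<bullet> v)) (at y)" and g: "(g has_derivative D) (at x)"
  shows "D u \<bullet> v = D v \<bullet> u"
proof -
  have "\<bar>D u \<bullet> v - D v \<bullet> u\<bar> \<le> e" if e: "e > 0" for e
  proof -
    have "\<forall>\<^sub>F s in at_right (0::real). 0 < s" by (simp add: eventually_at_right_less)
    with second_difference[OF f g, of "e/2" u v] second_difference[OF f g, of "e/2" v u]
    have "\<forall>\<^sub>F s in at_right 0. 0 < s \<and> \<bar>f (x + s *\<^sub>R u + s *\<^sub>R v) - f (x + s *\<^sub>R u) - f (x + s *\<^sub>R v) + f x - s\<^sup>2 * (D u \<bullet> v)\<bar> \<le> e / 2 * s\<^sup>2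
       \<and> \<bar>f (x + s *\<^sub>R v + s *\<^sub>R u) - f (x + s *\<^sub>R v) - f (x + s *\<^sub>R u) + f x - s\<^sup>2 * (D v \<bullet> u)\<bar> \<le> e / 2 * s\<^sup>2"
      using e by (auto intro: eventually_conj)
    then obtain s where s: "0 < s" "\<bar>f (x + s *\<^sub>R u + s *\<^sub>R v) - f (x + s *\<^sub>R u) - f (x + s *\<^sub>R v) + f x - s\<^sup>2 * (D u \<bullet> v)\<bar> \<le> e / 2 * s\<^sup>2"
       "\<bar>f (x + s *\<^sub>R v + s *\<^sub>R u) - f (x + s *\<^sub>R v) - f (x + s *\<^sub>R u) + f x - s\<^sup>2 * (D v \<bullet> u)\<bar> \<le> e / 2 * s\<^sup>2"
      using eventually_happens'[OF trivial_limit_at_right_real] by blast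
    have comm: "x + s *\<^sub>R v + s *\<^sub>R u = x + s *\<^sub>R u + s *\<^sub>R v" by (simp add: algebra_simps)
    have "\<bar>s\<^sup>2 * (D u \<bullet> v) - s\<^sup>2 * (D v \<bullet> u)\<bar> \<le> e / 2 * s\<^sup>2 + e / 2 * s\<^sup>2"
    proof -
      have tri: "\<bar>a - b\<bar> \<le> M + N" if "\<bar>P - a\<bar> \<le> M" "\<bar>P' - b\<bar> \<le> N" "P = P'" for a b P P' M N :: real
        using that by linarith
      show ?thesis by (rule tri[OF s(2) s(3)]) (unfold comm, linarith)
    qed
    then have "\<bar>s\<^sup>2 * (D u \<bullet> v) - s\<^sup>2 * (D v \<bullet> u)\<bar> \<le> e * s\<^sup>2" by simp
    then have "\<bar>s\<^sup>2 * (D u \<bullet> v - D v \<bullet> u)\<bar> \<le> s\<^sup>2 * e"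
      by (simp add: right_diff_distrib mult.commute)
    then have "s\<^sup>2 * \<bar>D u \<bullet> v - D v \<bullet> u\<bar> \<le> s\<^sup>2 * e"
      by (simp only: abs_mult abs_power2)
    moreover have "s\<^sup>2 > 0" using s(1) by simp
    ultimately show ?thesis using mult_le_cancel_left_pos by blast
  qed
  then have "\<bar>D u \<bullet> v - D v \<bullet> u\<bar> \<le> 0" by (rule field_le_epsilon) simp
  then show ?thesis by simp
qed

context exponential_dichotomy
begin

text \<open>
  A vector of the kernel extends to \<open>w t = \<Sum> a\<^sub>j Y\<^sub>j (q (T + t))\<close>. Since the \<open>Y\<^sub>j\<close> commute with \<open>X\<close>, this is a solution of
  the variational equation along the orbit, and it is bounded because the orbit converges. If it
  starts in \<open>E\<close>, the dichotomy forces it to vanish. The points with \<open>X (q T) = 0\<close> cannot fill a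
  half-line, as the orbit would then be constant and equal to its limit.
\<close>

lemma kernel_transversal:
  fixes X :: "'a \<Rightarrow> 'a" and Y DF :: "'j \<Rightarrow> 'a \<Rightarrow> _"
  assumes q: "\<And>t. (q has_vector_derivative X (q t)) (at t)" and lim: "(q \<longlongrightarrow> c) at_top" and qc: "\<And>t. q t \<noteq> c"
    and X: "\<And>x. (X has_derivative DX x) (at x)" and DX: "\<And>v. continuous_on UNIV (\<lambda>x. DX x v)"
    and DXA: "\<And>e. e > 0 \<Longrightarrow> \<exists>r>0. \<forall>x\<in>ball c r. \<forall>v. norm (DX x v - A v) \<le> e * norm v"
    and J: "finite J"
    and Y: "\<And>j x. j \<in> J \<Longrightarrow> (Y j has_derivative DY j x) (at x)"
    and commute: "\<And>j x. j \<in> J \<Longrightarrow> DY j x (X x) = DX x (Y j x)"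
    and span: "\<And>x v. X x \<noteq> 0 \<Longrightarrow> (\<And>j. j \<in> J \<Longrightarrow> DF j x v = 0) \<Longrightarrow> \<exists>a. v = (\<Sum>j\<in>J. a j *\<^sub>R Y j x)"
  shows "\<exists>\<^sub>F T in at_top. \<forall>v\<in>E. (\<forall>j\<in>J. DF j (q T) v = (0::real)) \<longrightarrow> v = 0"
proof -
  define \<epsilon> where "\<epsilon> = 1 / (2 * C)"
  have \<epsilon>: "\<epsilon> > 0" "0 \<le> \<epsilon>" "2 * C * \<epsilon> \<le> 1" using C by (auto simp: \<epsilon>_def)
  obtain r where r: "r > 0" "\<And>x v. x \<in> ball c r \<Longrightarrow> norm (DX x v - A v) \<le> \<epsilon> * norm v"
    using DXA[OF \<epsilon>(1)] by auto
  have "\<forall>\<^sub>F t in at_top. \<forall>j\<in>J. norm (Y j (q t) - Y j c) < 1"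
  proof (rule eventually_ball_finite[OF J], rule ballI)
    fix j assume "j \<in> J"
    then have "isCont (Y j) c" using Y has_derivative_continuous by blast
    then have "((\<lambda>t. Y j (q t)) \<longlongrightarrow> Y j c) at_top" using isCont_tendsto_compose lim by blast
    from tendstoD[OF this zero_less_one] show "\<forall>\<^sub>F t in at_top. norm (Y j (q t) - Y j c) < 1" by (simp add: dist_norm)
  qed
  with tendstoD[OF lim r(1)] have "\<forall>\<^sub>F t in at_top. dist (q t) c < r \<and> (\<forall>j\<in>J. norm (Y j (q t) - Y j c) < 1)"
    by (rule eventually_conj)
  then obtain T0 where T0: "\<And>t. t \<ge> T0 \<Longrightarrow> dist (q t) c < r"
    "\<And>t j. t \<ge> T0 \<Longrightarrow> j \<in> J \<Longrightarrow> norm (Y j (q t) - Y j c) < 1"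
    by (auto simp: eventually_at_top_linorder)
  have trans: "v = 0" if T: "T \<ge> T0" "X (q T) \<noteq> 0" and v: "v \<in> E" "\<And>j. j \<in> J \<Longrightarrow> DF j (q T) v = 0" for T v
  proof -
    obtain a where a: "v = (\<Sum>j\<in>J. a j *\<^sub>R Y j (q T))" using span[OF T(2) v(2)] by blast
    define p where "p t = q (T + t)" for t
    define w where "w t = (\<Sum>j\<in>J. a j *\<^sub>R Y j (p t))" for t
    have p': "(p has_vector_derivative X (p t)) (at t within {0..})" for t
      unfolding p_def by (rule has_vector_derivative_shift[OF q])
    have pc: "continuous_on {0..} p" by (rule continuous_on_of_vector_derivative[OF p'])
    have lin: "linear (DX x)" for x using X has_derivative_linear by blast
    have w': "(w has_vector_derivative A (w t) + (DX (p t) (w t) - A (w t))) (at t within {0..})" if t: "0 \<le> t" for t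
    proof -
      have "((\<lambda>t. Y j (p t)) has_vector_derivative DX (p t) (Y j (p t))) (at t within {0..})" if j: "j \<in> J" for j
        using vector_derivative_diff_chain_within[OF p' has_derivative_at_withinI[OF Y[OF j]], of t]
        by (simp only: o_def commute[OF j])
      then have "(w has_vector_derivative (\<Sum>j\<in>J. a j *\<^sub>R DX (p t) (Y j (p t)))) (at t within {0..})"
        unfolding w_def
        by (intro has_vector_derivative_sum bounded_linear.has_vector_derivative[OF bounded_linear_scaleR_right]) auto
      moreover have "(\<Sum>j\<in>J. a j *\<^sub>R DX (p t) (Y j (p t))) = DX (p t) (w t)"
        unfolding w_def by (simp add: linear_sum[OF lin] linear_scale[OF lin])
      ultimately show ?thesis by simp
    qed
    have wc: "continuous_on {0..} w" by (rule continuous_on_of_vector_derivative[OF w'])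
    have "norm (w 0) \<le> 2 * C * (norm (0::'a) + 0)"
    proof (rule perturbed_estimate[OF w' _ _ _ _ \<epsilon>(2,3), of "\<Sum>j\<in>J. \<bar>a j\<bar> * (norm (Y j c) + 1)"])
      fix t :: real assume t: "0 \<le> t"
      show "norm (w t) \<le> (\<Sum>j\<in>J. \<bar>a j\<bar> * (norm (Y j c) + 1))"
        unfolding w_def
      proof (rule sum_norm_le)
        fix j assume j: "j \<in> J"
        have "norm (Y j (p t)) \<le> norm (Y j c) + 1"
          using T0(2)[of "T + t" j] T t j norm_triangle_ineq2[of "Y j (p t)" "Y j c"] by (simp add: p_def)
        then show "norm (a j *\<^sub>R Y j (p t)) \<le> \<bar>a j\<bar> * (norm (Y j c) + 1)" by (simp add: mult_left_mono)
      qed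
      show "norm (DX (p t) (w t) - A (w t)) \<le> \<epsilon> * norm (w t) + 0"
        using r(2)[of "p t" "w t"] T0(1)[of "T + t"] T t by (simp add: p_def dist_commute)
    next
      show "w 0 - 0 \<in> E" using v(1) a by (simp add: w_def p_def)
      have "DX (p t) (w t) = (\<Sum>b\<in>Basis. (w t \<bullet> b) *\<^sub>R DX (p t) b)" for t
      proof -
        have "DX (p t) (w t) = DX (p t) (\<Sum>b\<in>Basis. (w t \<bullet> b) *\<^sub>R b)" by (simp add: euclidean_representation)
        then show ?thesis by (simp add: linear_sum[OF lin] linear_scale[OF lin])
      qed
      then show "continuous_on {0..} (\<lambda>t. DX (p t) (w t) - A (w t))"
        by (auto intro!: continuous_intros wc pc continuous_on_compose2[OF DX] bounded_linear.continuous_on[OF A])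
    qed auto
    then show "v = 0" using a by (simp add: w_def p_def)
  qed
  have "\<exists>\<^sub>F t in at_top. X (q t) \<noteq> 0"
  proof (rule ccontr)
    assume "\<not> ?thesis"
    then have "\<forall>\<^sub>F t in at_top. X (q t) = 0" by (simp add: frequently_def)
    then obtain N where N: "\<And>t. t \<ge> N \<Longrightarrow> X (q t) = 0" by (auto simp: eventually_at_top_linorder)
    obtain k where k: "\<And>t. t \<in> {N..} \<Longrightarrow> q t = k"
    proof (rule has_vector_derivative_zero_constant[of "{N..}" q])
      show "(q has_vector_derivative 0) (at t within {N..})" if "t \<in> {N..}" for t
        using has_vector_derivative_at_within[OF q[of t]] N[of t] that by simp
    qed auto
    have "\<forall>\<^sub>F t in at_top. q t = k" using eventually_ge_at_top[of N] by eventually_elim (simp add: k)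
    from Lim_transform_eventually[OF lim this] have "((\<lambda>t::real. k) \<longlongrightarrow> c) at_top" .
    then have "k = c" by (simp add: tendsto_const_iff)
    then show False using k[of N] qc by simp
  qed
  from frequently_eventually_frequently[OF this eventually_ge_at_top[of T0]]
  show ?thesis
  proof (rule frequently_elim1)
    fix T assume "X (q T) \<noteq> 0 \<and> T0 \<le> T"
    then show "\<forall>v\<in>E. (\<forall>j\<in>J. DF j (q T) v = 0) \<longrightarrow> v = 0" by (auto intro: trans)
  qed
qed

end

section \<open>Symplectic linear algebra and smooth functions\<close>

lemma sum_UNIV_sum: "(\<Sum>i\<in>UNIV. f i) = (\<Sum>a\<in>UNIV. f (Inl a)) + (\<Sum>a\<in>UNIV. f (Inr a))"
  for f :: "'a::finite + 'b::finite \<Rightarrow> 'c::comm_monoid_add"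
  unfolding UNIV_Plus_UNIV[symmetric] by (subst sum.Plus) simp_all

lemma J2m_mult_Inl: "(J2m *v v) $ Inl a = v $ Inr a"
  by (simp add: J2m_def matrix_vector_mult_def sum_UNIV_sum if_distrib if_distribR cong: if_cong)

lemma J2m_mult_Inr: "(J2m *v v) $ Inr a = - v $ Inl a"
  by (simp add: J2m_def matrix_vector_mult_def sum_UNIV_sum if_distrib if_distribR sum_negf[symmetric] cong: if_cong)

lemma J2m_skew: "x \<bullet> (J2m *v y) = - ((J2m *v x) \<bullet> y)"
  by (simp add: inner_vec_def sum_UNIV_sum J2m_mult_Inl J2m_mult_Inr sum_negf)

lemma J2m_J2m: "J2m *v (J2m *v x) = - x"
proof -
  have "(J2m *v (J2m *v x)) $ i = (- x) $ i" for i
    by (cases i) (simp_all add: J2m_mult_Inl J2m_mult_Inr)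
  then show ?thesis by (simp add: vec_eq_iff)
qed

lemma J2m_inj: "J2m *v x = J2m *v y \<Longrightarrow> x = y"
  by (metis J2m_J2m neg_equal_iff_equal)

text \<open>
  A Lagrangian subspace: the \<open>m\<close> independent vectors \<open>J g\<^sub>j\<close> lie in the orthogonal complement of the \<open>m\<close>
  independent vectors \<open>g\<^sub>j\<close>, which has dimension \<open>m\<close>.
\<close>

lemma isotropic_span:
  fixes g :: "'j \<Rightarrow> real ^ ('m::finite + 'm)"
  assumes J: "finite J" "card J = CARD('m)" and inj: "inj_on g J" and ind: "independent (g ` J)"
    and iso: "\<And>i j. i \<in> J \<Longrightarrow> j \<in> J \<Longrightarrow> g i \<bullet> (J2m *v g j) = 0"
    and v: "\<And>j. j \<in> J \<Longrightarrow> g j \<bullet> v = 0"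
  shows "\<exists>a. v = (\<Sum>j\<in>J. a j *\<^sub>R (J2m *v g j))"
proof -
  define Y where "Y j = J2m *v g j" for j
  have linJ: "linear (\<lambda>x :: real ^ ('m + 'm). J2m *v x)" by (rule matrix_vector_mul_linear)
  have injJ: "inj (\<lambda>x :: real ^ ('m + 'm). J2m *v x)" by (rule injI) (rule J2m_inj)
  have YJ: "Y ` J = (\<lambda>x. J2m *v x) ` (g ` J)" by (auto simp: Y_def)
  have indY: "independent (Y ` J)"
    unfolding YJ by (rule linear_independent_injective_image[OF linJ ind inj_on_subset[OF injJ subset_UNIV]])
  have injY: "inj_on Y J" 
  proof (rule inj_onI)
    fix i j assume ij: "i \<in> J" "j \<in> J" "Y i = Y j"
    have "g i = g j" by (rule J2m_inj[OF ij(3)[unfolded Y_def]])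
    from inj_onD[OF inj this ij(1,2)] show "i = j" .
  qed
  have "v \<in> span (Y ` J)"
  proof (rule ccontr)
    assume nv: "v \<notin> span (Y ` J)"
    have "independent (insert v (Y ` J))" using nv indY by (simp add: independent_insert)
    moreover have "v \<notin> Y ` J" using nv span_base[of v "Y ` J"] by argo
    ultimately have d1: "dim (insert v (Y ` J)) = CARD('m) + 1"
      using dim_eq_card_independent card_insert_disjoint[of "Y ` J" v] J card_image[OF injY] by force
    have d2: "dim (g ` J) = CARD('m)"
      using ind J card_image[OF inj] by (simp add: dim_eq_card_independent)
    have "dim (insert v (Y ` J) \<union> g ` J) = dim (insert v (Y ` J)) + dim (g ` J)"
    proof (rule dim_orthogonal_sum)
      fix x y assume x: "x \<in> insert v (Y ` J)" and y: "y \<in> g ` J"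
      then obtain j where j: "j \<in> J" "y = g j" by blast
      have "y \<bullet> x = 0"
        using x v[OF j(1)] iso[OF j(1)] unfolding j(2) Y_def by (elim insertE imageE) (simp_all only:)
      then show "x \<bullet> y = 0" by (simp only: inner_commute)
    qed
    then have "dim (insert v (Y ` J) \<union> g ` J) = CARD('m) + 1 + CARD('m)" using d1 d2 by linarith
    moreover have "dim (insert v (Y ` J) \<union> g ` J) \<le> DIM(real ^ ('m + 'm))" by (rule dim_subset_UNIV)
    ultimately show False by simp
  qed
  then obtain u where u: "v = (\<Sum>w\<in>Y ` J. u w *\<^sub>R w)"
    using span_finite[of "Y ` J"] J by auto
  then have "v = (\<Sum>j\<in>J. u (Y j) *\<^sub>R Y j)" by (simp add: sum.reindex[OF injY])
  then show ?thesis unfolding Y_def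
    by (rule exI[of "\<lambda>a. v = (\<Sum>j\<in>J. a j *\<^sub>R (J2m *v g j))" "\<lambda>j. u (J2m *v g j)"])
qed

lemma grad_unique:
  assumes "(f has_derivative (\<lambda>v. g \<bullet> v)) (at x)"
  shows "grad f x = g"
  unfolding grad_def
proof (rule the_equality)
  show "GDERIV f x :> g" using assms by (simp add: gderiv_def inner_commute)
  fix D assume "GDERIV f x :> D"
  then have "(f has_derivative (\<lambda>v. D \<bullet> v)) (at x)" by (simp add: gderiv_def inner_commute)
  from has_derivative_unique[OF this assms] have "D \<bullet> v = g \<bullet> v" for v by metis
  then have "\<forall>v. D \<bullet> v = g \<bullet> v" ..
  then show "D = g" by (simp only: vector_eq_rdot)
qed

lemma linear_functional_inner:
  fixes f :: "'a::euclidean_space \<Rightarrow> real"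
  assumes "linear f"
  shows "f v = (\<Sum>b\<in>Basis. f b *\<^sub>R b) \<bullet> v"
proof -
  have "f v = f (\<Sum>b\<in>Basis. (v \<bullet> b) *\<^sub>R b)" by (simp add: euclidean_representation)
  also have "\<dots> = (\<Sum>b\<in>Basis. (v \<bullet> b) * f b)"
    by (simp add: linear_sum[OF assms] linear_scale[OF assms])
  finally show ?thesis by (simp add: inner_sum_left inner_commute[of v] mult.commute)
qed

lemma Ck_on_SucD: "Ck_on (Suc k) f S \<Longrightarrow> Ck_on k f S"
proof (induction k arbitrary: f)
  case 0
  then obtain f' where "\<And>x. x \<in> S \<Longrightarrow> (f has_derivative (\<lambda>v. f' v x)) (at x within S)" by auto
  from has_derivative_continuous_on[OF this] show ?case by simp
next
  case (Suc k)
  then obtain f' where f': "\<And>x. x \<in> S \<Longrightarrow> (f has_derivative (\<lambda>v. f' v x)) (at x within S)"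
    "\<And>v. Ck_on (Suc k) (f' v) S" using Ck_on.simps(2)[of "Suc k" f S] by blast
  show ?case unfolding Ck_on.simps(2)[of k] using f'(1) Suc.IH[OF f'(2)] by blast
qed

lemma Ck_on_continuous_on: "Ck_on k f S \<Longrightarrow> continuous_on S f"
proof (induction k arbitrary: f)
  case (Suc k)
  then show ?case using Ck_on_SucD by blast
qed simp

lemma Ck_on_SucE:
  assumes "Ck_on (Suc k) f S"
  obtains f' where "\<And>x. x \<in> S \<Longrightarrow> (f has_derivative (\<lambda>v. f' v x)) (at x within S)"
    and "\<And>v. Ck_on k (f' v) S" and "\<And>v. continuous_on S (f' v)"
proof -
  obtain f' where f': "\<forall>x\<in>S. (f has_derivative (\<lambda>v. f' v x)) (at x within S)" "\<forall>v. Ck_on k (f' v) S"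
    using assms unfolding Ck_on.simps(2) by blast
  show thesis by (rule that[of f']) (use f' Ck_on_continuous_on[OF f'(2)[rule_format]] in auto)
qed

lemma Ck_on_cong:
  assumes "\<And>x. x \<in> S \<Longrightarrow> f x = g x" "Ck_on k f S"
  shows "Ck_on k g S"
proof (cases k)
  case 0
  then show ?thesis using assms continuous_on_cong[of S S f g] by simp
next
  case (Suc n)
  obtain f' where f': "\<And>x. x \<in> S \<Longrightarrow> (f has_derivative (\<lambda>v. f' v x)) (at x within S)" "\<And>v. Ck_on n (f' v) S"
    using assms(2) Suc Ck_on_SucE by metis
  have "(g has_derivative (\<lambda>v. f' v x)) (at x within S)" if "x \<in> S" for x
    by (rule has_derivative_transform[OF that _ f'(1)[OF that]]) (use assms(1) in auto)
  then show ?thesis using f'(2) Suc by auto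
qed

lemma Ck_on_bounded_linear:
  assumes "bounded_linear L" "Ck_on k f S"
  shows "Ck_on k (\<lambda>x. L (f x)) S"
  using assms(2)
proof (induction k arbitrary: f)
  case 0
  then show ?case using bounded_linear.continuous_on[OF assms(1)] by simp
next
  case (Suc k)
  obtain f' where f': "\<And>x. x \<in> S \<Longrightarrow> (f has_derivative (\<lambda>v. f' v x)) (at x within S)" "\<And>v. Ck_on k (f' v) S"
    using Ck_on_SucE[OF Suc.prems] by metis
  show ?case
    unfolding Ck_on.simps(2)
    using bounded_linear.has_derivative[OF assms(1) f'(1)] Suc.IH[OF f'(2)]
    by (intro exI[of _ "\<lambda>v x. L (f' v x)"]) auto
qed

lemma Ck_on_const: "Ck_on k (\<lambda>x. c) S"
proof (induction k arbitrary: c)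
  case (Suc k)
  show ?case unfolding Ck_on.simps(2)
    by (intro exI[of _ "\<lambda>v x. 0"]) (use Suc in auto)
qed simp

lemma Ck_on_add:
  assumes "Ck_on k f S" "Ck_on k g S"
  shows "Ck_on k (\<lambda>x. f x + g x) S"
  using assms
proof (induction k arbitrary: f g)
  case 0
  then show ?case by (auto intro: continuous_intros)
next
  case (Suc k)
  obtain f' where f': "\<And>x. x \<in> S \<Longrightarrow> (f has_derivative (\<lambda>v. f' v x)) (at x within S)" "\<And>v. Ck_on k (f' v) S"
    using Ck_on_SucE[OF Suc.prems(1)] by metis
  obtain g' where g': "\<And>x. x \<in> S \<Longrightarrow> (g has_derivative (\<lambda>v. g' v x)) (at x within S)" "\<And>v. Ck_on k (g' v) S"
    using Ck_on_SucE[OF Suc.prems(2)] by metis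
  show ?case
    unfolding Ck_on.simps(2)
    using has_derivative_add[OF f'(1) g'(1)] Suc.IH[OF f'(2) g'(2)]
    by (intro exI[of _ "\<lambda>v x. f' v x + g' v x"]) auto
qed

lemma Ck_on_sum:
  "(\<And>i. i \<in> A \<Longrightarrow> Ck_on k (f i) S) \<Longrightarrow> Ck_on k (\<lambda>x. \<Sum>i\<in>A. f i x) S"
  by (induction A rule: infinite_finite_induct) (auto intro: Ck_on_const Ck_on_add)

lemma has_derivative_slice_fst:
  assumes "((\<lambda>(x, y). f x y) has_derivative D) (at (x, y) within UNIV \<times> V)" "y \<in> V"
  shows "((\<lambda>x. f x y) has_derivative (\<lambda>v. D (v, 0))) (at x)"
proof -
  have "((\<lambda>x. (x, y)) has_derivative (\<lambda>v. (v, 0))) (at x)"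
    by (auto intro!: derivative_eq_intros)
  moreover have "((\<lambda>(x, y). f x y) has_derivative D) (at (x, y) within range (\<lambda>x. (x, y)))"
    using assms by (auto intro: has_derivative_subset)
  ultimately show ?thesis
    using has_derivative_in_compose[of "\<lambda>x. (x, y)" "\<lambda>v. (v, 0)" x UNIV "\<lambda>(x, y). f x y" D] by simp
qed

lemma Ck_on_grad:
  fixes f :: "'e::euclidean_space \<Rightarrow> 'b::real_normed_vector \<Rightarrow> real"
  assumes "Ck_on (Suc k) (\<lambda>(x, y). f x y) (UNIV \<times> V)"
  shows "\<And>x y. y \<in> V \<Longrightarrow> ((\<lambda>x. f x y) has_derivative (\<lambda>v. grad (\<lambda>x. f x y) x \<bullet> v)) (at x)"
    and "Ck_on k (\<lambda>(x, y). grad (\<lambda>x. f x y) x) (UNIV \<times> V)"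
proof -
  obtain f' where f': "\<And>z. z \<in> UNIV \<times> V \<Longrightarrow> ((\<lambda>(x, y). f x y) has_derivative (\<lambda>v. f' v z)) (at z within UNIV \<times> V)"
    "\<And>v. Ck_on k (f' v) (UNIV \<times> V)" using Ck_on_SucE[OF assms] by metis
  define g where "g z = (\<Sum>b\<in>Basis. f' (b, 0) z *\<^sub>R b)" for z
  have der: "((\<lambda>x. f x y) has_derivative (\<lambda>v. g (x, y) \<bullet> v)) (at x)" if "y \<in> V" for x y
  proof -
    have d: "((\<lambda>x. f x y) has_derivative (\<lambda>v. f' (v, 0) (x, y))) (at x)"
      by (rule has_derivative_slice_fst[OF f'(1) that]) (use that in auto)
    from linear_functional_inner[OF has_derivative_linear[OF this]]
    have "(\<lambda>v. f' (v, 0) (x, y)) = (\<lambda>v. g (x, y) \<bullet> v)" unfolding g_def by (rule ext)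
    then show ?thesis using d by simp
  qed
  have eq: "grad (\<lambda>x. f x y) x = g (x, y)" if "y \<in> V" for x y
    by (rule grad_unique[OF der[OF that]])
  show "((\<lambda>x. f x y) has_derivative (\<lambda>v. grad (\<lambda>x. f x y) x \<bullet> v)) (at x)" if "y \<in> V" for x y
    unfolding eq[OF that] by (rule der[OF that])
  have "Ck_on k g (UNIV \<times> V)"
    unfolding g_def by (rule Ck_on_sum, rule Ck_on_bounded_linear[OF bounded_linear_scaleR_left], rule f'(2))
  then show "Ck_on k (\<lambda>(x, y). grad (\<lambda>x. f x y) x) (UNIV \<times> V)"
    by (rule Ck_on_cong[rotated]) (auto simp: eq)
qed

text \<open>
  Continuity of each directional derivative gives continuity in operator norm, since it is enough to
  test on a basis.
\<close>

lemma derivative_uniformly_close: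
  fixes f' :: "'e::euclidean_space \<Rightarrow> 'z::metric_space \<Rightarrow> 'b::real_normed_vector"
  assumes S: "open S" "z0 \<in> S" and lin: "\<And>z. z \<in> S \<Longrightarrow> linear (\<lambda>v. f' v z)"
    and cont: "\<And>v. continuous_on S (f' v)" and e: "e > 0"
  obtains r where "r > 0" "ball z0 r \<subseteq> S" "\<And>z v. z \<in> ball z0 r \<Longrightarrow> norm (f' v z - f' v z0) \<le> e * norm v"
proof -
  define d where "d = e / (real (DIM('e)) + 1)"
  have d: "d > 0" using e by (simp add: d_def)
  have "\<forall>\<^sub>F z in nhds z0. \<forall>b\<in>Basis. norm (f' b z - f' b z0) < d"
  proof (rule eventually_ball_finite[OF finite_Basis], rule ballI)
    fix b :: 'e
    have "isCont (f' b) z0" using cont S by (simp add: continuous_on_eq_continuous_at)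
    then have "(f' b \<longlongrightarrow> f' b z0) (nhds z0)" unfolding isCont_def tendsto_at_iff_tendsto_nhds .
    from tendstoD[OF this d] show "\<forall>\<^sub>F z in nhds z0. norm (f' b z - f' b z0) < d" by (simp add: dist_norm)
  qed
  with eventually_nhds_in_open[OF S] have "\<forall>\<^sub>F z in nhds z0. z \<in> S \<and> (\<forall>b\<in>Basis. norm (f' b z - f' b z0) < d)"
    by (rule eventually_conj)
  then obtain r where r: "r > 0" "\<And>z. dist z z0 < r \<Longrightarrow> z \<in> S \<and> (\<forall>b\<in>Basis. norm (f' b z - f' b z0) < d)"
    unfolding eventually_nhds_metric by blast
  show thesis
  proof (rule that[OF r(1)])
    show "ball z0 r \<subseteq> S" using r(2) by (auto simp: dist_commute)
    fix z v assume z: "z \<in> ball z0 r"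
    have zr: "z \<in> S" "\<And>b. b \<in> Basis \<Longrightarrow> norm (f' b z - f' b z0) < d"
      using r(2)[of z] z by (auto simp: dist_commute)
    have lz: "linear (\<lambda>v. f' v z - f' v z0)" using lin[OF zr(1)] lin[OF S(2)] by (rule linear_compose_sub)
    have "f' v z - f' v z0 = (\<lambda>v. f' v z - f' v z0) (\<Sum>b\<in>Basis. (v \<bullet> b) *\<^sub>R b)"
      by (simp add: euclidean_representation)
    also have "\<dots> = (\<Sum>b\<in>Basis. (v \<bullet> b) *\<^sub>R (f' b z - f' b z0))"
      unfolding linear_sum[OF lz] linear_scale[OF lz] ..
    also have "norm \<dots> \<le> (\<Sum>b\<in>(Basis::'e set). norm v * d)"
    proof (rule sum_norm_le)
      fix b :: 'e assume b: "b \<in> Basis"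
      show "norm ((v \<bullet> b) *\<^sub>R (f' b z - f' b z0)) \<le> norm v * d"
        using Basis_le_norm[OF b, of v] zr(2)[OF b] by (simp add: mult_mono)
    qed
    also have "\<dots> = real DIM('e) * d * norm v" by simp
    also have "\<dots> \<le> e * norm v"
      using e by (intro mult_right_mono) (auto simp: d_def field_simps)
    finally show "norm (f' v z - f' v z0) \<le> e * norm v" .
  qed
qed

section \<open>Tails of homoclinic families\<close>

lemma eventually_nhds_Pair_fst:
  assumes "eventually P (nhds a)"
  shows "\<forall>\<^sub>F p in nhds (a, b). P (fst p)"
proof -
  obtain S where S: "open S" "a \<in> S" "\<And>x. x \<in> S \<Longrightarrow> P x" using assms by (auto simp: eventually_nhds)
  have "\<forall>\<^sub>F p in nhds (a, b). p \<in> S \<times> UNIV"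
    by (rule eventually_nhds_in_open) (use S in \<open>auto intro: open_Times\<close>)
  then show ?thesis by eventually_elim (use S in auto)
qed

lemma continuous_on_tendsto_nhds:
  fixes f :: "'a::t2_space \<Rightarrow> 'b::topological_space"
  assumes "continuous_on S f" "open S" "a \<in> S"
  shows "(f \<longlongrightarrow> f a) (nhds a)"
proof -
  have "isCont f a" using assms by (simp add: continuous_on_eq_continuous_at)
  then show ?thesis unfolding isCont_def tendsto_at_iff_tendsto_nhds .
qed

text \<open>
  The theorem on uniform tails for a field of class \<open>C\<^sup>1\<close> with the parameter \<open>I\<close>, where \<open>\<alpha>\<close> only labels the
  orbits; the exponential dichotomy comes from hyperbolicity of the equilibrium.
\<close>

theorem homoclinic_tail:
  fixes G :: "real ^ 'n \<Rightarrow> real \<Rightarrow> real ^ 'n" and F :: "'j \<Rightarrow> real ^ 'n \<Rightarrow> real \<Rightarrow> real"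
    and Y :: "'j \<Rightarrow> real ^ 'n \<Rightarrow> real ^ 'n" and q :: "real \<Rightarrow> real \<Rightarrow> 'a::metric_space \<Rightarrow> real ^ 'n"
  assumes V: "open V" "I0 \<in> V" and W: "open W" "a0 \<in> W"
    and G: "Ck_on (Suc 0) (\<lambda>(x, I). G x I) (UNIV \<times> V)"
    and J: "finite J" and F: "\<And>j. j \<in> J \<Longrightarrow> Ck_on (Suc 0) (\<lambda>(x, I). F j x I) (UNIV \<times> V)"
    and F_int: "\<And>j I. j \<in> J \<Longrightarrow> I \<in> V \<Longrightarrow> first_integral_on (\<lambda>x. G x I) (\<lambda>x. F j x I) UNIV"
    and xe: "continuous_on V xe" and q: "continuous_on (UNIV \<times> V \<times> W) (\<lambda>(t, I, a). q I t a)"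
    and hyp: "\<And>I. I \<in> V \<Longrightarrow> hyperbolic_equilibrium (\<lambda>x. G x I) (xe I)"
    and orbit: "\<And>I a. I \<in> V \<Longrightarrow> a \<in> W \<Longrightarrow> homoclinic_orbit (\<lambda>x. G x I) (xe I) (\<lambda>t. q I t a)"
    and Y: "\<And>j x. j \<in> J \<Longrightarrow> (Y j has_derivative DY j x) (at x)"
    and commute: "\<And>j x. j \<in> J \<Longrightarrow> DY j x (G x I0) = frechet_derivative (\<lambda>x. G x I0) (at x) (Y j x)"
    and span: "\<And>x v. G x I0 \<noteq> 0 \<Longrightarrow> (\<And>j. j \<in> J \<Longrightarrow> frechet_derivative (\<lambda>x. F j x I0) (at x) v = 0) \<Longrightarrow>
        \<exists>a. v = (\<Sum>j\<in>J. a j *\<^sub>R Y j x)"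
    and \<rho>: "\<rho> > 0"
  shows "\<exists>T. \<forall>\<^sub>F p in nhds (I0, a0). \<forall>t\<ge>T. norm (q (fst p) t (snd p) - xe I0) < \<rho>"
proof -
  define S where "S = (UNIV :: (real ^ 'n) set) \<times> V"
  have S: "open S" unfolding S_def using V by (intro open_Times) auto
  obtain G' where G': "\<And>z. z \<in> S \<Longrightarrow> ((\<lambda>(x, I). G x I) has_derivative (\<lambda>v. G' v z)) (at z within S)"
    "\<And>v. continuous_on S (G' v)"
    using Ck_on_SucE[OF G] unfolding S_def by metis
  define DX where "DX I x v = G' (v, 0) (x, I)" for I x v
  have DX: "((\<lambda>x. G x I) has_derivative DX I x) (at x)" if "I \<in> V" for I x
    unfolding DX_def
    by (rule has_derivative_slice_fst[OF G'(1)[unfolded S_def] that]) (use that in auto)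
  have linG: "linear (\<lambda>v. G' v z)" if "z \<in> S" for z using has_derivative_linear[OF G'(1)[OF that]] .
  have linDX: "linear (\<lambda>v. G' (v, 0) z)" if "z \<in> S" for z
    using DX[of "snd z" "fst z"] that has_derivative_linear unfolding DX_def S_def by force
  define c0 where "c0 = xe I0"
  define z0 where "z0 = (c0, I0)"
  have z0: "z0 \<in> S" using V by (simp add: z0_def S_def)
  define A where "A = jacobian (\<lambda>x. G x I0) (at c0)"
  have Adx: "A *v v = DX I0 c0 v" for v
  proof -
    have "frechet_derivative (\<lambda>x. G x I0) (at c0) = DX I0 c0" using frechet_derivative_at[OF DX[OF V(2)]] by simp
    then show ?thesis unfolding A_def jacobian_def using has_derivative_linear[OF DX[OF V(2)]]
      by (simp add: matrix_works linear_matrix_vector_mul_eq)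
  qed
  have eigen: "Re \<mu> \<noteq> 0" if "v \<noteq> 0" "map_matrix complex_of_real A *v v = \<mu> *s v" for \<mu> v
    using hyp[OF V(2)] that unfolding hyperbolic_equilibrium_def A_def c0_def by blast
  obtain C where "exponential_dichotomy (\<lambda>v. A *v v) (unstable_space A) C"
      proof -
    have "\<exists>C. exponential_dichotomy (\<lambda>v. A *v v) (unstable_space A) C"
      by (rule halfline_dichotomy) (rule eigen)
    then show ?thesis using that by blast
  qed
  then interpret exponential_dichotomy "\<lambda>v. A *v v" "unstable_space A" C .
  have eVW: "\<forall>\<^sub>F p in nhds (I0, a0). p \<in> V \<times> W"
    by (rule eventually_nhds_in_open) (use V W in \<open>auto intro: open_Times\<close>)
  have near: "\<forall>\<^sub>F p in nhds (I0, a0). norm (xe (fst p) - c0) < d \<and> \<bar>fst p - I0\<bar> < d" if d: "d > 0" for d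
  proof (rule eventually_nhds_Pair_fst)
    have 1: "\<forall>\<^sub>F I in nhds I0. norm (xe I - c0) < d"
      using tendstoD[OF continuous_on_tendsto_nhds[OF xe V] d] by (simp add: c0_def dist_norm)
    have 2: "\<forall>\<^sub>F I in nhds I0. \<bar>I - I0\<bar> < d"
      using eventually_nhds_ball[OF d, of I0] by eventually_elim (simp add: dist_real_def abs_minus_commute)
    show "\<forall>\<^sub>F I in nhds I0. norm (xe I - c0) < d \<and> \<bar>I - I0\<bar> < d"
      by (rule eventually_conj[OF 1 2])
  qed
  have DXA: "\<exists>r>0. ball z0 r \<subseteq> S \<and> (\<forall>z\<in>ball z0 r. \<forall>v. norm (G' (v, 0) z - A *v v) \<le> e * norm v)" if e: "e > 0" for e
  proof -
    obtain r where "r > 0" "ball z0 r \<subseteq> S" "\<And>z v. z \<in> ball z0 r \<Longrightarrow> norm (G' (v, 0) z - G' (v, 0) z0) \<le> e * norm v"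
      using derivative_uniformly_close[OF S z0 linDX G'(2) e] by metis
    then show ?thesis unfolding Adx DX_def by (intro exI[of _ r]) (auto simp: z0_def)
  qed
  have in_ball: "(x, I) \<in> ball z0 r" if "norm (x - c0) + \<bar>I - I0\<bar> < r" for x I r
  proof -
    have "dist (x, I) z0 = norm (x - c0, I - I0)" by (simp add: z0_def dist_norm)
    also have "\<dots> \<le> norm (x - c0) + \<bar>I - I0\<bar>" using norm_Pair_le[of "x - c0" "I - I0"] by simp
    finally show ?thesis using that by (simp add: mem_ball dist_commute)
  qed
  show ?thesis
    unfolding c0_def[symmetric]
  proof (rule uniform_tail[where X = "\<lambda>p x. G x (fst p)" and c = "\<lambda>p. xe (fst p)" and q = "\<lambda>p t. q (fst p) t (snd p)"
        and F = "\<lambda>j p x. F j x (fst p)" and DF = "\<lambda>j p x. frechet_derivative (\<lambda>x. F j x (fst p)) (at x)"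
        and ?p0.0 = "(I0, a0)" and J = J and \<rho> = \<rho>, unfolded fst_conv snd_conv, folded c0_def])
    show "\<forall>\<^sub>F p in nhds (I0, a0). G (xe (fst p)) (fst p) = 0"
      using eVW by eventually_elim (use hyp in \<open>auto simp: hyperbolic_equilibrium_def\<close>)
    show "\<forall>\<^sub>F p in nhds (I0, a0). (\<forall>t. ((\<lambda>t. q (fst p) t (snd p)) has_vector_derivative G (q (fst p) t (snd p)) (fst p)) (at t)) \<and>
           ((\<lambda>t. q (fst p) t (snd p)) \<longlongrightarrow> xe (fst p)) at_top"
      using eVW by eventually_elim (use orbit in \<open>auto simp: homoclinic_orbit_def\<close>)
    show "((\<lambda>p. xe (fst p)) \<longlongrightarrow> c0) (nhds (I0, a0))"
    proof (rule tendstoI)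
      fix e :: real assume "e > 0"
      from near[OF this] show "\<forall>\<^sub>F p in nhds (I0, a0). dist (xe (fst p)) c0 < e"
        by eventually_elim (simp add: dist_norm)
    qed
    show "((\<lambda>p. q (fst p) t (snd p)) \<longlongrightarrow> q I0 t a0) (nhds (I0, a0))" for t
    proof -
      have "continuous_on (V \<times> W) (\<lambda>p. (\<lambda>(t, I, a). q I t a) (t, p))"
        by (rule continuous_on_compose2[OF q]) (auto intro!: continuous_intros)
      then have "continuous_on (V \<times> W) (\<lambda>p. q (fst p) t (snd p))" by (simp add: case_prod_beta)
      from continuous_on_tendsto_nhds[OF this, of "(I0, a0)"] show ?thesis
        using V W by (auto intro: open_Times)
    qed
    show "finite J" by (rule J)
    show "\<rho> > 0" by (rule \<rho>)
    show "\<forall>\<^sub>F p in nhds (I0, a0). \<forall>j\<in>J. \<forall>x. ((\<lambda>x. F j x (fst p)) has_derivative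
             frechet_derivative (\<lambda>x. F j x (fst p)) (at x)) (at x) \<and>
             frechet_derivative (\<lambda>x. F j x (fst p)) (at x) (G x (fst p)) = 0"
      using eVW
    proof eventually_elim
      case (elim p)
      then show ?case using F_int[of _ "fst p"] unfolding first_integral_on_def
        by (auto simp: frechet_derivative_works[symmetric])
    qed
    show "\<exists>r>0. \<forall>\<^sub>F p in nhds (I0, a0). \<forall>x\<in>cball 0 r. \<forall>y\<in>cball 0 r.
        norm (G (xe (fst p) + x) (fst p) - G (xe (fst p) + y) (fst p) - A *v (x - y)) \<le> e * norm (x - y)"
      if e: "e > 0" for e
    proof -
      obtain r where r: "r > 0" "ball z0 r \<subseteq> S" "\<And>z v. z \<in> ball z0 r \<Longrightarrow> norm (G' (v, 0) z - A *v v) \<le> e * norm v"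
        using DXA[OF e] by auto
      show ?thesis
      proof (intro exI[of _ "r / 4"] conjI)
        show "r / 4 > 0" using r by simp
        have "r / 4 > 0" using r by simp
        from near[OF this] eVW
        show "\<forall>\<^sub>F p in nhds (I0, a0). \<forall>x\<in>cball 0 (r/4). \<forall>y\<in>cball 0 (r/4).
          norm (G (xe (fst p) + x) (fst p) - G (xe (fst p) + y) (fst p) - A *v (x - y)) \<le> e * norm (x - y)"
        proof eventually_elim
          case (elim p)
          obtain I a where p: "p = (I, a)" by (cases p)
          have I: "I \<in> V" "norm (xe I - c0) < r / 4" "\<bar>I - I0\<bar> < r / 4" using elim p by auto
          show ?case unfolding p fst_conv
          proof (intro ballI)
            fix x y :: "real ^ 'n" assume xy: "x \<in> cball 0 (r/4)" "y \<in> cball 0 (r/4)"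
            have b: "xe I + w \<in> ball c0 (r / 2)" if "w \<in> cball 0 (r/4)" for w
              using norm_triangle_ineq[of "xe I - c0" w] I(2) that by (simp add: dist_norm norm_minus_commute algebra_simps)
            have "norm ((G (xe I + x) I - A *v (xe I + x)) - (G (xe I + y) I - A *v (xe I + y)))
                \<le> e * norm ((xe I + x) - (xe I + y))"
            proof (rule differentiable_bound[OF convex_ball[of c0 "r/2"] _ _ b[OF xy(1)] b[OF xy(2)]])
              fix w assume w: "w \<in> ball c0 (r/2)"
              show "((\<lambda>x. G x I - A *v x) has_derivative (\<lambda>v. DX I w v - A *v v)) (at w within ball c0 (r/2))"
                by (rule has_derivative_diff[OF has_derivative_at_withinI[OF DX[OF I(1)]] bounded_linear_imp_has_derivative])
                   (rule matrix_vector_mul_bounded_linear)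
              have "(w, I) \<in> ball z0 r"
                by (rule in_ball) (use w I(3) r(1) in \<open>simp add: dist_norm norm_minus_commute\<close>)
              then show "onorm (\<lambda>v. DX I w v - A *v v) \<le> e"
                using r(3) e unfolding DX_def by (intro onorm_bound) auto
            qed
            then show "norm (G (xe I + x) I - G (xe I + y) I - A *v (x - y)) \<le> e * norm (x - y)"
              by (simp add: matrix_vector_right_distrib matrix_vector_mult_diff_distrib algebra_simps)
          qed
        qed
      qed
    qed
    show "\<exists>r>0. \<forall>e>0. \<forall>\<^sub>F p in nhds (I0, a0). \<forall>x\<in>cball 0 r. norm (G (xe (fst p) + x) (fst p) - G (c0 + x) I0) \<le> e"
    proof -
      obtain r where r: "r > 0" "ball z0 r \<subseteq> S" "\<And>z v. z \<in> ball z0 r \<Longrightarrow> norm (G' v z - G' v z0) \<le> 1 * norm v"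
        using derivative_uniformly_close[OF S z0 linG G'(2) zero_less_one] by metis
      obtain K where K: "K \<ge> 0" "\<And>v. norm (G' v z0) \<le> norm v * K"
        using bounded_linear.nonneg_bounded[OF has_derivative_bounded_linear[OF G'(1)[OF z0]]] by auto
      have lip: "norm ((\<lambda>(x, I). G x I) z - (\<lambda>(x, I). G x I) z') \<le> (K + 1) * norm (z - z')"
        if z: "z \<in> ball z0 r" "z' \<in> ball z0 r" for z z'
      proof (rule differentiable_bound[OF convex_ball[of z0 r] _ _ z])
        fix w assume w: "w \<in> ball z0 r"
        show "((\<lambda>(x, I). G x I) has_derivative (\<lambda>v. G' v w)) (at w within ball z0 r)"
          by (rule has_derivative_subset[OF G'(1) r(2)]) (use w r in auto)
        show "onorm (\<lambda>v. G' v w) \<le> K + 1"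
        proof (rule onorm_bound)
          fix v
          have "norm (G' v w) \<le> norm (G' v z0) + norm (G' v w - G' v z0)" by (rule norm_triangle_sub)
          also have "\<dots> \<le> norm v * K + 1 * norm v" by (intro add_mono K(2) r(3) w)
          finally show "norm (G' v w) \<le> (K + 1) * norm v" by (simp add: algebra_simps)
        qed (use K in auto)
      qed
      show ?thesis
      proof (intro exI[of _ "r / 2"] conjI allI impI)
        show "r / 2 > 0" using r by simp
        fix e :: real assume e: "e > 0"
        define d where "d = min (r / 4) (e / (2 * (K + 1)))"
        have d: "d > 0" "d \<le> r / 4" "d * 2 * (K + 1) \<le> e"
        proof -
          show "d > 0" using r(1) e K(1) by (simp add: d_def)
          show "d \<le> r / 4" unfolding d_def by (rule min.cobounded1)
          have "d \<le> e / (2 * (K + 1))" by (simp add: d_def)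
          then show "d * 2 * (K + 1) \<le> e" using K(1) by (simp add: pos_le_divide_eq algebra_simps)
        qed
        from near[OF d(1)]
        show "\<forall>\<^sub>F p in nhds (I0, a0). \<forall>x\<in>cball 0 (r/2). norm (G (xe (fst p) + x) (fst p) - G (c0 + x) I0) \<le> e"
        proof eventually_elim
          case (elim p)
          show ?case
          proof
            fix x :: "real ^ 'n" assume x: "x \<in> cball 0 (r / 2)"
            have 1: "(xe (fst p) + x, fst p) \<in> ball z0 r"
              using elim x d(2) norm_triangle_ineq[of "xe (fst p) - c0" x] r(1)
              by (intro in_ball) (simp add: algebra_simps)
            have 2: "(c0 + x, I0) \<in> ball z0 r" using x r(1) by (intro in_ball) simp
            have "norm (G (xe (fst p) + x) (fst p) - G (c0 + x) I0) \<le> (K + 1) * norm ((xe (fst p) + x, fst p) - (c0 + x, I0))"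
              using lip[OF 1 2] by simp
            also have "\<dots> \<le> (K + 1) * (d + d)"
              using norm_Pair_le[of "xe (fst p) - c0" "fst p - I0"] elim K(1)
              by (intro mult_left_mono) auto
            also have "\<dots> \<le> e" using d(3) by (simp add: algebra_simps)
            finally show "norm (G (xe (fst p) + x) (fst p) - G (c0 + x) I0) \<le> e" .
          qed
        qed
      qed
    qed
    show "\<exists>r>0. \<forall>\<^sub>F p in nhds (I0, a0). \<forall>x\<in>ball x0 r. \<forall>v.
        \<bar>frechet_derivative (\<lambda>x. F j x (fst p)) (at x) v - frechet_derivative (\<lambda>x. F j x I0) (at x0) v\<bar> \<le> e * norm v"
      if j: "j \<in> J" and e: "e > 0" for j x0 e
    proof -
      obtain F' where F': "\<And>z. z \<in> S \<Longrightarrow> ((\<lambda>(x, I). F j x I) has_derivative (\<lambda>v. F' v z)) (at z within S)"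
        "\<And>v. continuous_on S (F' v)"
        using Ck_on_SucE[OF F[OF j]] unfolding S_def by metis
      have sl: "((\<lambda>x. F j x I) has_derivative (\<lambda>v. F' (v, 0) (x, I))) (at x)" if "I \<in> V" for I x
        by (rule has_derivative_slice_fst[OF F'(1)[unfolded S_def] that]) (use that in auto)
      have fd: "frechet_derivative (\<lambda>x. F j x I) (at x) = (\<lambda>v. F' (v, 0) (x, I))" if "I \<in> V" for I x
        using frechet_derivative_at[OF sl[OF that]] by simp
      have lin: "linear (\<lambda>v. F' (v, 0) z)" if "z \<in> S" for z
        using sl[of "snd z" "fst z"] that has_derivative_linear unfolding S_def by force
      have x0: "(x0, I0) \<in> S" using V by (simp add: S_def)
      obtain r where r: "r > 0" "ball (x0, I0) r \<subseteq> S"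
        "\<And>z v. z \<in> ball (x0, I0) r \<Longrightarrow> norm (F' (v, 0) z - F' (v, 0) (x0, I0)) \<le> e * norm v"
        using derivative_uniformly_close[OF S x0 lin F'(2) e] by metis
      show ?thesis
      proof (intro exI[of _ "r / 2"] conjI)
        show "r / 2 > 0" using r by simp
        have "r / 2 > 0" using r by simp
        from near[OF this] eVW
        show "\<forall>\<^sub>F p in nhds (I0, a0). \<forall>x\<in>ball x0 (r/2). \<forall>v.
          \<bar>frechet_derivative (\<lambda>x. F j x (fst p)) (at x) v - frechet_derivative (\<lambda>x. F j x I0) (at x0) v\<bar> \<le> e * norm v"
        proof eventually_elim
          case (elim p)
          show ?case
          proof (intro ballI allI)
            fix x v assume x: "x \<in> ball x0 (r/2)"
            have "dist (x0, I0) (x, fst p) = norm (x0 - x, I0 - fst p)" by (simp add: dist_norm)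
            also have "\<dots> \<le> norm (x0 - x) + \<bar>I0 - fst p\<bar>" using norm_Pair_le[of "x0 - x" "I0 - fst p"] by simp
            also have "\<dots> < r" using elim x by (simp add: dist_norm abs_minus_commute)
            finally have "(x, fst p) \<in> ball (x0, I0) r" by simp
            from r(3)[OF this, of v]
            show "\<bar>frechet_derivative (\<lambda>x. F j x (fst p)) (at x) v - frechet_derivative (\<lambda>x. F j x I0) (at x0) v\<bar> \<le> e * norm v"
              using fd V(2) elim by (auto simp: mem_Times_iff)
          qed
        qed
      qed
    qed
    show "\<exists>\<^sub>F T in at_top. \<forall>v\<in>unstable_space A. (\<forall>j\<in>J. frechet_derivative (\<lambda>x. F j x I0) (at (q I0 T a0)) v = 0) \<longrightarrow> v = 0"
    proof (rule kernel_transversal[where X = "\<lambda>x. G x I0" and c = c0 and DX = "DX I0" and Y = Y and DY = DY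
          and DF = "\<lambda>j x. frechet_derivative (\<lambda>x. F j x I0) (at x)" and q = "\<lambda>t. q I0 t a0"])
      show "\<And>t. ((\<lambda>t. q I0 t a0) has_vector_derivative G (q I0 t a0) I0) (at t)"
        "((\<lambda>t. q I0 t a0) \<longlongrightarrow> c0) at_top" "\<And>t. q I0 t a0 \<noteq> c0"
        using orbit[OF V(2) W(2)] by (auto simp: homoclinic_orbit_def c0_def)
      show "\<And>x. ((\<lambda>x. G x I0) has_derivative DX I0 x) (at x)" by (rule DX[OF V(2)])
      show "continuous_on UNIV (\<lambda>x. DX I0 x v)" for v
        unfolding DX_def by (rule continuous_on_compose2[OF G'(2)]) (use V in \<open>auto intro!: continuous_intros simp: S_def\<close>)
      show "\<exists>r>0. \<forall>x\<in>ball c0 r. \<forall>v. norm (DX I0 x v - A *v v) \<le> e * norm v" if e: "e > 0" for e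
      proof -
        obtain r where r: "r > 0" "\<And>z v. z \<in> ball z0 r \<Longrightarrow> norm (G' (v, 0) z - A *v v) \<le> e * norm v"
          using DXA[OF e] by auto
        show ?thesis unfolding DX_def
          by (intro exI[of _ r] conjI r ballI allI in_ball) (simp add: dist_norm norm_minus_commute)
      qed
      show "\<And>j x. j \<in> J \<Longrightarrow> DY j x (G x I0) = DX I0 x (Y j x)"
        using commute frechet_derivative_at[OF DX[OF V(2)]] by simp
    qed (use J Y span in auto)
  qed
qed

section \<open>First variation of a conserved quantity\<close>

text \<open>
  For \<open>e > 0\<close> the difference \<open>G e (c b) - G e (c a)\<close> is \<open>- e\<close> times the integral of \<open>DG\<^sub>e(c) X\<^sub>1(c)\<close>, because
  \<open>DG\<^sub>e\<close> annihilates \<open>X\<^sub>0 + e X\<^sub>1\<close>. The same identity at \<open>e = 0\<close> gives \<open>G 0 (c b) = G 0 (c a)\<close>, so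
  division by \<open>e\<close> produces difference quotients of \<open>e \<mapsto> G e z\<close> at the two end points.
\<close>

lemma variation_along_orbit:
  fixes G :: "real \<Rightarrow> 'z::euclidean_space \<Rightarrow> real" and X0 X1 :: "'z \<Rightarrow> 'z"
  assumes S: "open S" and e1: "e1 > 0"
    and G: "Ck_on (Suc 0) (\<lambda>(e, z). G e z) ({0..<e1} \<times> S)"
    and inv: "\<And>e z. e \<in> {0..<e1} \<Longrightarrow> z \<in> S \<Longrightarrow> frechet_derivative (G e) (at z) (X0 z + e *\<^sub>R X1 z) = 0"
  shows "\<exists>g1. continuous_on S g1 \<and>
      (\<forall>z\<in>S. ((\<lambda>e. G e z) has_real_derivative g1 z) (at 0 within {0..<e1})) \<and>
      (\<forall>c a b. (\<forall>t. (c has_vector_derivative X0 (c t)) (at t)) \<longrightarrow> (\<forall>t. c t \<in> S) \<longrightarrow>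
        continuous_on UNIV (\<lambda>t. X1 (c t)) \<longrightarrow> a \<le> b \<longrightarrow>
        continuous_on {a..b} (\<lambda>t. frechet_derivative (G 0) (at (c t)) (X1 (c t))) \<and>
        integral {a..b} (\<lambda>t. frechet_derivative (G 0) (at (c t)) (X1 (c t))) = g1 (c a) - g1 (c b))"
proof -
  define D where "D = {0..<e1} \<times> S"
  obtain G' where G': "\<And>w. w \<in> D \<Longrightarrow> ((\<lambda>(e, z). G e z) has_derivative (\<lambda>v. G' v w)) (at w within D)"
    "\<And>v. continuous_on D (G' v)"
    using Ck_on_SucE[OF G] unfolding D_def by metis
  have lin: "linear (\<lambda>v. G' v w)" if "w \<in> D" for w using has_derivative_linear[OF G'(1)[OF that]] .
  have slice: "(G e has_derivative (\<lambda>v. G' (0, v) (e, z))) (at z)" if "e \<in> {0..<e1}" "z \<in> S" for e z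
  proof -
    have "((\<lambda>z. (e, z)) has_derivative (\<lambda>v. (0, v))) (at z within S)"
      by (auto intro!: derivative_eq_intros)
    moreover have "((\<lambda>(e, z). G e z) has_derivative (\<lambda>v. G' v (e, z))) (at (e, z) within (\<lambda>z. (e, z)) ` S)"
      by (rule has_derivative_subset[OF G'(1)]) (use that in \<open>auto simp: D_def\<close>)
    ultimately have "(G e has_derivative (\<lambda>v. G' (0, v) (e, z))) (at z within S)"
      using has_derivative_in_compose[of "\<lambda>z. (e, z)" "\<lambda>v. (0, v)" z S "\<lambda>(e, z). G e z" "\<lambda>v. G' v (e, z)"] by simp
    then show ?thesis unfolding at_within_open[OF that(2) S] .
  qed
  have fd: "frechet_derivative (G e) (at z) = (\<lambda>v. G' (0, v) (e, z))" if "e \<in> {0..<e1}" "z \<in> S" for e z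
    using frechet_derivative_at[OF slice[OF that]] by simp
  define g1 where "g1 z = G' (1, 0) (0, z)" for z
  have g1_cont: "continuous_on S g1"
    unfolding g1_def
    by (rule continuous_on_compose2[OF G'(2)]) (use e1 in \<open>auto intro!: continuous_intros simp: D_def\<close>)
  have g1_der: "((\<lambda>e. G e z) has_real_derivative g1 z) (at 0 within {0..<e1})" if z: "z \<in> S" for z
  proof -
    have w: "(0, z) \<in> D" using z e1 by (simp add: D_def)
    have "((\<lambda>e. (e, z)) has_derivative (\<lambda>v. (v, 0))) (at 0 within {0..<e1})"
      by (auto intro!: derivative_eq_intros)
    moreover have "((\<lambda>(e, z). G e z) has_derivative (\<lambda>v. G' v (0, z))) (at (0, z) within (\<lambda>e. (e, z)) ` {0..<e1})"
      by (rule has_derivative_subset[OF G'(1)[OF w]]) (use z in \<open>auto simp: D_def\<close>)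
    ultimately have "((\<lambda>e. G e z) has_derivative (\<lambda>v. G' (v, 0) (0, z))) (at 0 within {0..<e1})"
      using has_derivative_in_compose[of "\<lambda>e. (e, z)" "\<lambda>v. (v, 0)" 0 "{0..<e1}" "\<lambda>(e, z). G e z" "\<lambda>v. G' v (0, z)"] by simp
    moreover have "(\<lambda>v. G' (v, 0) (0, z)) = (*) (g1 z)"
    proof
      fix v :: real
      have "G' (v *\<^sub>R (1, 0)) (0, z) = v *\<^sub>R G' (1, 0) (0, z)" by (rule linear_scale[OF lin[OF w]])
      then show "G' (v, 0) (0, z) = g1 z * v" by (simp add: g1_def)
    qed
    ultimately show ?thesis by (simp add: has_field_derivative_def)
  qed
  have key: "continuous_on {a..b} (\<lambda>t. frechet_derivative (G 0) (at (c t)) (X1 (c t))) \<and>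
        integral {a..b} (\<lambda>t. frechet_derivative (G 0) (at (c t)) (X1 (c t))) = g1 (c a) - g1 (c b)"
    if c: "\<And>t. (c has_vector_derivative X0 (c t)) (at t)" "\<And>t. c t \<in> S"
      and X1: "continuous_on UNIV (\<lambda>t. X1 (c t))" and ab: "a \<le> b" for c a b
  proof -
    have cc: "continuous_on UNIV c" by (rule continuous_on_vector_derivative[of _ _ "\<lambda>t. X0 (c t)"]) (use c(1) in auto)
    define k where "k e t = G' (0, X1 (c t)) (e, c t)" for e t
    \<comment> \<open>the expansion in a basis turns separate continuity in each direction into joint continuity\<close>
    have k_eq: "k e t = (\<Sum>v\<in>Basis. (X1 (c t) \<bullet> v) * G' (0, v) (e, c t))" if e: "e \<in> {0..<e1}" for e t
    proof -
      have w: "(e, c t) \<in> D" using e c(2) by (simp add: D_def)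
      have l: "linear (\<lambda>v. G' (0, v) (e, c t))" using has_derivative_linear[OF slice[OF e c(2)]] .
      have "k e t = (\<lambda>v. G' (0, v) (e, c t)) (\<Sum>v\<in>Basis. (X1 (c t) \<bullet> v) *\<^sub>R v)"
        by (simp add: k_def euclidean_representation)
      also have "\<dots> = (\<Sum>v\<in>Basis. (X1 (c t) \<bullet> v) *\<^sub>R G' (0, v) (e, c t))"
        unfolding linear_sum[OF l] linear_scale[OF l] ..
      finally show ?thesis by simp
    qed
    have k_cont: "continuous_on ({0..<e1} \<times> cbox a b) (\<lambda>(e, t). k e t)"
    proof -
      have "continuous_on ({0..<e1} \<times> cbox a b) (\<lambda>p. \<Sum>v\<in>Basis. (X1 (c (snd p)) \<bullet> v) * G' (0, v) (fst p, c (snd p)))"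
      proof (intro continuous_intros)
        show "continuous_on ({0..<e1} \<times> cbox a b) (\<lambda>p. X1 (c (snd p)))"
          by (rule continuous_on_compose2[OF X1]) (auto intro!: continuous_intros)
        fix v :: 'z
        show "continuous_on ({0..<e1} \<times> cbox a b) (\<lambda>p. G' (0, v) (fst p, c (snd p)))"
          by (rule continuous_on_compose2[OF G'(2)])
             (use c(2) in \<open>auto intro!: continuous_intros continuous_on_compose2[OF cc] simp: D_def\<close>)
      qed
      then show ?thesis
        by (rule continuous_on_eq) (auto simp: k_eq)
    qed
    define \<Phi> where "\<Phi> e = integral (cbox a b) (k e)" for e
    have \<Phi>_cont: "continuous_on {0..<e1} \<Phi>"
      unfolding \<Phi>_def by (rule integral_continuous_on_param[OF k_cont])
    have diff: "G e (c b) - G e (c a) = - e * \<Phi> e" if e: "e \<in> {0..<e1}" for e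
    proof -
      have der: "((\<lambda>t. G e (c t)) has_vector_derivative - e * k e t) (at t within {a..b})" for t
      proof -
        have "(G e \<circ> c has_vector_derivative G' (0, X0 (c t)) (e, c t)) (at t within {a..b})"
          by (rule vector_derivative_diff_chain_within[OF has_vector_derivative_at_within[OF c(1)] has_derivative_at_withinI[OF slice[OF e c(2)]]])
        moreover have "G' (0, X0 (c t)) (e, c t) = - e * k e t"
        proof -
          have l: "linear (\<lambda>v. G' (0, v) (e, c t))" using has_derivative_linear[OF slice[OF e c(2)]] .
          have "G' (0, X0 (c t) + e *\<^sub>R X1 (c t)) (e, c t) = 0"
            using inv[OF e c(2)] unfolding fd[OF e c(2)] .
          then show ?thesis using linear_add[OF l] linear_scale[OF l] by (simp add: k_def)
        qed
        ultimately show ?thesis by (simp add: o_def)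
      qed
      have "((\<lambda>t. - e * k e t) has_integral (G e (c b) - G e (c a))) {a..b}"
        by (rule fundamental_theorem_of_calculus[OF ab der])
      then have "integral {a..b} (\<lambda>t. - e * k e t) = G e (c b) - G e (c a)" by (rule integral_unique)
      then show ?thesis by (simp add: \<Phi>_def)
    qed
    have quot: "((\<lambda>e. (G e z - G 0 z) / e) \<longlongrightarrow> g1 z) (at 0 within {0..<e1})" if "z \<in> S" for z
      using g1_der[OF that] by (simp add: has_field_derivative_iff)
    have "((\<lambda>e. (G e (c b) - G 0 (c b)) / e - (G e (c a) - G 0 (c a)) / e) \<longlongrightarrow> g1 (c b) - g1 (c a)) (at 0 within {0..<e1})"
      by (intro tendsto_diff quot c(2))
    moreover have "\<forall>\<^sub>F e in at 0 within {0..<e1}. (G e (c b) - G 0 (c b)) / e - (G e (c a) - G 0 (c a)) / e = - \<Phi> e"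
      unfolding eventually_at_filter
    proof (rule always_eventually, intro allI impI)
      fix e :: real assume e: "e \<noteq> 0" "e \<in> {0..<e1}"
      have "G 0 (c b) = G 0 (c a)" using diff[of 0] e1 by simp
      then have "(G e (c b) - G 0 (c b)) / e - (G e (c a) - G 0 (c a)) / e = (G e (c b) - G e (c a)) / e"
        by (simp add: diff_divide_distrib)
      then show "(G e (c b) - G 0 (c b)) / e - (G e (c a) - G 0 (c a)) / e = - \<Phi> e"
        using diff[OF e(2)] e(1) by simp
    qed
    ultimately have l1: "((\<lambda>e. - \<Phi> e) \<longlongrightarrow> g1 (c b) - g1 (c a)) (at 0 within {0..<e1})"
      by (rule Lim_transform_eventually)
    have l2: "((\<lambda>e. - \<Phi> e) \<longlongrightarrow> - \<Phi> 0) (at 0 within {0..<e1})"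
      using \<Phi>_cont e1 by (intro tendsto_minus) (simp add: continuous_on)
    have "at 0 within {0..<e1} \<noteq> (bot :: real filter)"
    proof -
      have "at 0 within {0..<e1} = at_right (0::real)"
        by (rule at_within_nhd[of _ "{..<e1}"]) (use e1 in auto)
      then show ?thesis by simp
    qed
    from tendsto_unique[OF this l1 l2] have "\<Phi> 0 = g1 (c a) - g1 (c b)" by simp
    moreover have k0: "k 0 = (\<lambda>t. frechet_derivative (G 0) (at (c t)) (X1 (c t)))"
      using fd[of 0] e1 c(2) by (auto simp: k_def fun_eq_iff)
    moreover have "continuous_on {a..b} (k 0)"
    proof -
      have "continuous_on {a..b} (\<lambda>t. (\<lambda>(e, t). k e t) (0, t))"
        by (rule continuous_on_compose2[OF k_cont]) (use e1 in \<open>auto intro!: continuous_intros\<close>)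
      then show ?thesis by simp
    qed
    ultimately show ?thesis by (simp add: \<Phi>_def)
  qed
  show ?thesis
  proof (intro exI[of _ g1] conjI[OF g1_cont] conjI ballI allI impI)
    show "((\<lambda>e. G e z) has_real_derivative g1 z) (at 0 within {0..<e1})" if "z \<in> S" for z
      using g1_der[OF that] .
    fix c a b
    assume as: "\<forall>t. (c has_vector_derivative X0 (c t)) (at t)" "\<forall>t. c t \<in> S"
      "continuous_on UNIV (\<lambda>t. X1 (c t))" "a \<le> (b :: real)"
    show "continuous_on {a..b} (\<lambda>t. frechet_derivative (G 0) (at (c t)) (X1 (c t)))"
      "integral {a..b} (\<lambda>t. frechet_derivative (G 0) (at (c t)) (X1 (c t))) = g1 (c a) - g1 (c b)"
      using key[OF as(1,2)[rule_format] as(3,4)] by simp_all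
  qed
qed

section \<open>Commuting Hamiltonian fields and parameter integrals\<close>

lemma tube:
  fixes C :: "'b::topological_space set" and O' :: "('a::topological_space \<times> 'b) set"
  assumes "compact C" "open O'" "{x} \<times> C \<subseteq> O'"
  shows "\<exists>U. open U \<and> x \<in> U \<and> U \<times> C \<subseteq> O'"
proof -
  have "\<exists>U V. openin (euclidean :: 'a topology) U \<and> openin (euclidean :: 'b topology) V \<and> x \<in> U \<and> C \<subseteq> V \<and> U \<times> V \<subseteq> O'"
  proof (rule tube_lemma_right)
    show "openin (prod_topology (euclidean :: 'a topology) (euclidean :: 'b topology)) O'"
      unfolding prod_topology_euclidean open_openin[symmetric] by (rule assms(2))
    show "compactin (euclidean :: 'b topology) C" unfolding compactin_euclidean_iff by (rule assms(1))
    show "{x} \<times> C \<subseteq> O'" by (rule assms(3))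
  qed simp
  then obtain U V where "openin (euclidean :: 'a topology) U" "x \<in> U" "C \<subseteq> V" "U \<times> V \<subseteq> O'"
    by (elim exE conjE)
  note UV = this
  have "open U" using UV(1) unfolding open_openin[symmetric] .
  moreover have "U \<times> C \<subseteq> O'" using UV(3,4) by auto
  ultimately show ?thesis using UV(2) by (intro exI[of _ U] conjI)
qed

text \<open>
  The bracket of the two Hamiltonian fields vanishes: differentiate the involution identity in an
  arbitrary direction and use the symmetry of both Hessians.
\<close>

lemma commuting_hamiltonian_fields:
  fixes g h :: "real ^ ('m::finite + 'm) \<Rightarrow> real ^ ('m + 'm)"
  assumes f1: "\<And>y. (f1 has_derivative (\<lambda>v. g y \<bullet> v)) (at y)" and f2: "\<And>y. (f2 has_derivative (\<lambda>v. h y \<bullet> v)) (at y)"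
    and g: "(g has_derivative Dg) (at x)" and h: "(h has_derivative Dh) (at x)"
    and inv: "\<And>y. g y \<bullet> (J2m *v h y) = 0"
  shows "Dg (J2m *v h x) = Dh (J2m *v g x)"
proof -
  have "Dg (J2m *v h x) \<bullet> v = Dh (J2m *v g x) \<bullet> v" for v
  proof -
    have "((\<lambda>y. J2m *v h y) has_derivative (\<lambda>v. J2m *v Dh v)) (at x)"
      by (rule bounded_linear.has_derivative[OF matrix_vector_mul_bounded_linear h])
    from has_derivative_inner[OF g this]
    have "((\<lambda>y. g y \<bullet> (J2m *v h y)) has_derivative (\<lambda>v. g x \<bullet> (J2m *v Dh v) + Dg v \<bullet> (J2m *v h x))) (at x)" .
    moreover have "((\<lambda>y. g y \<bullet> (J2m *v h y)) has_derivative (\<lambda>v. 0)) (at x)"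
      unfolding inv by (rule has_derivative_const)
    ultimately have "(\<lambda>v. g x \<bullet> (J2m *v Dh v) + Dg v \<bullet> (J2m *v h x)) = (\<lambda>v. 0)"
      by (rule has_derivative_unique)
    then have "g x \<bullet> (J2m *v Dh v) + Dg v \<bullet> (J2m *v h x) = 0" by (rule fun_cong)
    moreover have "g x \<bullet> (J2m *v Dh v) = - (Dh v \<bullet> (J2m *v g x))" 
      by (simp only: J2m_skew[of "g x" "Dh v"] inner_commute[of "Dh v"])
    moreover have "Dg v \<bullet> (J2m *v h x) = Dg (J2m *v h x) \<bullet> v" by (rule symmetric_hessian[OF f1 g])
    moreover have "Dh v \<bullet> (J2m *v g x) = Dh (J2m *v g x) \<bullet> v" by (rule symmetric_hessian[OF f2 h])
    ultimately show ?thesis by linarith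
  qed
  then have "\<forall>v. Dg (J2m *v h x) \<bullet> v = Dh (J2m *v g x) \<bullet> v" ..
  then show ?thesis by (simp only: vector_eq_rdot)
qed

lemma Ck_on_directional:
  fixes f :: "'z::real_normed_vector \<Rightarrow> real"
  assumes "Ck_on (Suc 0) f S" "open S"
  obtains f' where "\<And>v. continuous_on S (f' v)" "\<And>z. z \<in> S \<Longrightarrow> (f has_derivative (\<lambda>v. f' v z)) (at z)"
    and "\<And>c w s. (c has_vector_derivative w) (at s) \<Longrightarrow> c s \<in> S \<Longrightarrow> deriv (\<lambda>s. f (c s)) s = f' w (c s)"
proof -
  obtain f' where f': "\<And>z. z \<in> S \<Longrightarrow> (f has_derivative (\<lambda>v. f' v z)) (at z within S)"
    "\<And>v. continuous_on S (f' v)" using Ck_on_SucE[OF assms(1)] by metis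
  have at: "(f has_derivative (\<lambda>v. f' v z)) (at z)" if "z \<in> S" for z
    using f'(1)[OF that] unfolding at_within_open[OF that assms(2)] .
  show thesis
  proof (rule that[OF f'(2) at])
    fix c w s assume c: "(c has_vector_derivative w) (at s)" "c s \<in> S"
    have "(f \<circ> c has_vector_derivative f' w (c s)) (at s)"
      by (rule vector_derivative_diff_chain_within[OF c(1) has_derivative_at_withinI[OF at[OF c(2)]]])
    then have "((\<lambda>s. f (c s)) has_real_derivative f' w (c s)) (at s)"
      by (simp add: has_real_derivative_iff_has_vector_derivative o_def)
    then show "deriv (\<lambda>s. f (c s)) s = f' w (c s)" by (rule DERIV_imp_deriv)
  qed
qed

lemma interval_integral_has_derivative:
  fixes h :: "real \<Rightarrow> real"
  assumes h: "continuous_on UNIV h"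
  shows "((\<lambda>t. LBINT s=0..t. h s) has_real_derivative h t) (at t)"
proof -
  define b where "b = \<bar>t\<bar> + 1"
  have "((\<lambda>u. LBINT y=(0::real)..u. h y) has_vector_derivative h t) (at t within {- b..b})"
    by (rule interval_integral_FTC2) (auto simp: b_def intro: continuous_on_subset[OF h])
  moreover have "at t within {- b..b} = at t"
    by (rule at_within_interior) (auto simp: b_def)
  ultimately show ?thesis by (simp add: has_real_derivative_iff_has_vector_derivative zero_ereal_def)
qed

text \<open>
  The integral is rescaled to the fixed interval \<open>[0, 1]\<close>.
\<close>

lemma interval_integral_continuous_param:
  fixes h :: "'p::topological_space \<Rightarrow> real \<Rightarrow> real"
  assumes h: "continuous_on (U \<times> UNIV) (\<lambda>(p, s). h p s)"
  shows "continuous_on (U \<times> UNIV) (\<lambda>(p, t). LBINT s=0..ereal t. h p s)"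
proof -
  have hp: "continuous_on UNIV (h p)" if "p \<in> U" for p
  proof -
    have "continuous_on UNIV (\<lambda>s. (\<lambda>(p, s). h p s) (p, s))"
      by (rule continuous_on_compose2[OF h]) (use that in \<open>auto intro!: continuous_intros\<close>)
    then show ?thesis by simp
  qed
  have eq: "(LBINT s=0..ereal t. h p s) = integral (cbox 0 1) (\<lambda>s. t * h p (t * s))" if p: "p \<in> U" for p t
  proof -
    define \<Theta> where "\<Theta> t = (LBINT s=0..ereal t. h p s)" for t
    have \<Theta>: "(\<Theta> has_real_derivative h p t) (at t)" for t
      unfolding \<Theta>_def by (rule interval_integral_has_derivative[OF hp[OF p]])
    have "((\<lambda>s. t * h p (t * s)) has_integral (\<Theta> (t * 1) - \<Theta> (t * 0))) {0..1}"
    proof (rule fundamental_theorem_of_calculus)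
      fix s :: real
      have "((\<lambda>s. \<Theta> (t * s)) has_real_derivative h p (t * s) * t) (at s within {0..1})"
        by (rule DERIV_chain2[OF \<Theta>]) (auto intro!: derivative_eq_intros)
      then show "((\<lambda>s. \<Theta> (t * s)) has_vector_derivative t * h p (t * s)) (at s within {0..1})"
        by (simp add: has_real_derivative_iff_has_vector_derivative mult.commute)
    qed simp
    from integral_unique[OF this] have "integral (cbox 0 1) (\<lambda>s. t * h p (t * s)) = \<Theta> t - \<Theta> 0"
      by (simp only: cbox_interval mult_1_right mult_zero_right)
    moreover have "\<Theta> 0 = 0" by (simp add: \<Theta>_def zero_ereal_def[symmetric])
    ultimately show ?thesis by (simp add: \<Theta>_def)
  qed
  have "continuous_on (U \<times> UNIV) (\<lambda>q. integral (cbox 0 1) (\<lambda>s. snd q * h (fst q) (snd q * s)))"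
  proof (rule integral_continuous_on_param)
    have "continuous_on ((U \<times> UNIV) \<times> cbox (0::real) 1) (\<lambda>w. snd (fst w) * (\<lambda>(p, s). h p s) (fst (fst w), snd (fst w) * snd w))"
      by (intro continuous_intros continuous_on_compose2[OF h]) auto
    then show "continuous_on ((U \<times> UNIV) \<times> cbox (0::real) 1) (\<lambda>(q, s). snd q * h (fst q) (snd q * s))"
      by (simp add: case_prod_beta)
  qed
  then show ?thesis by (rule continuous_on_eq) (auto simp: eq)
qed

section \<open>Homoclinic families of an integrable Hamiltonian system\<close>

text \<open>
  The unperturbed system, separated from the perturbation and from the times \<open>T\<^sub>j\<close>.
\<close>

locale integrable_homoclinics =
  fixes V :: "real set" and W :: "'a::real_inner set"
    and H0 :: "real ^ ('m::finite + 'm) \<Rightarrow> real \<Rightarrow> real"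
    and F :: "nat \<Rightarrow> real ^ ('m + 'm) \<Rightarrow> real \<Rightarrow> real"
    and xe :: "real \<Rightarrow> real ^ ('m + 'm)"
    and q :: "real \<Rightarrow> real \<Rightarrow> 'a \<Rightarrow> real ^ ('m + 'm)"
  assumes V: "open V" and W: "open W"
    and H0_smooth: "Ck_on 3 (\<lambda>(x, I). H0 x I) (UNIV \<times> V)"
    and F_smooth: "\<And>j. j \<in> {1..CARD('m)} \<Longrightarrow> Ck_on 3 (\<lambda>(x, I). F j x I) (UNIV \<times> V)"
    and F_integral: "\<And>j I. j \<in> {1..CARD('m)} \<Longrightarrow> I \<in> V \<Longrightarrow>
          first_integral_on (xfield H0 I) (\<lambda>x. F j x I) UNIV"
    and F_1: "\<And>x I. I \<in> V \<Longrightarrow> F 1 x I = H0 x I"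
    and F_independent: "\<And>x I. I \<in> V \<Longrightarrow> xfield H0 I x \<noteq> 0 \<Longrightarrow>
          inj_on (\<lambda>j. grad (\<lambda>y. F j y I) x) {1..CARD('m)} \<and>
          independent ((\<lambda>j. grad (\<lambda>y. F j y I) x) ` {1..CARD('m)})"
    and F_involution: "\<And>i j x I. i \<in> {1..CARD('m)} \<Longrightarrow> j \<in> {1..CARD('m)} \<Longrightarrow> I \<in> V \<Longrightarrow>
          grad (\<lambda>y. F i y I) x \<bullet> (J2m *v grad (\<lambda>y. F j y I) x) = 0"
    and equilibrium: "\<And>I. I \<in> V \<Longrightarrow> hyperbolic_equilibrium (xfield H0 I) (xe I)"
    and homoclinic: "\<And>I \<alpha>. I \<in> V \<Longrightarrow> \<alpha> \<in> W \<Longrightarrow>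
          homoclinic_orbit (xfield H0 I) (xe I) (\<lambda>t. q I t \<alpha>)"
    and xe_cont: "continuous_on V xe"
    and q_cont: "continuous_on (UNIV \<times> V \<times> W) (\<lambda>(t, I, \<alpha>). q I t \<alpha>)"
begin

lemma F_grad:
  assumes "j \<in> {1..CARD('m)}" "I \<in> V"
  shows "((\<lambda>y. F j y I) has_derivative (\<lambda>v. grad (\<lambda>y. F j y I) x \<bullet> v)) (at x)"
  using Ck_on_grad(1)[of 2 "F j" V I x] F_smooth[OF assms(1)] assms(2) by (simp add: numeral_3_eq_3 numeral_2_eq_2 del: Ck_on.simps)

lemma F_grad_derivative:
  assumes "j \<in> {1..CARD('m)}" "I \<in> V"
  shows "((\<lambda>y. grad (\<lambda>y. F j y I) y) has_derivative frechet_derivative (\<lambda>y. grad (\<lambda>y. F j y I) y) (at x)) (at x)"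
proof -
  have "Ck_on (Suc 1) (\<lambda>(x, I). grad (\<lambda>y. F j y I) x) (UNIV \<times> V)"
    using Ck_on_grad(2)[of 2 "F j" V] F_smooth[OF assms(1)] by (simp add: numeral_3_eq_3 numeral_2_eq_2 del: Ck_on.simps)
  then obtain g' where g': "\<And>z. z \<in> UNIV \<times> V \<Longrightarrow>
      ((\<lambda>(x, I). grad (\<lambda>y. F j y I) x) has_derivative (\<lambda>v. g' v z)) (at z within UNIV \<times> V)"
    using Ck_on_SucE by metis
  have "((\<lambda>x. grad (\<lambda>y. F j y I) x) has_derivative (\<lambda>v. g' (v, 0) (x, I))) (at x)"
    by (rule has_derivative_slice_fst[OF g' assms(2)]) (use assms in auto)
  then have "(\<lambda>x. grad (\<lambda>y. F j y I) x) differentiable (at x)" unfolding differentiable_def by blast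
  then show ?thesis by (simp only: frechet_derivative_works)
qed

lemma xfield_F1: "I \<in> V \<Longrightarrow> xfield H0 I x = J2m *v grad (\<lambda>y. F 1 y I) x"
  by (simp only: xfield_def F_1)

lemma card_m: "1 \<in> {1..CARD('m)}"
  using zero_less_card_finite[where 'a = 'm] by (simp add: Suc_le_eq)

lemma xfield_derivative:
  assumes "I \<in> V"
  shows "(xfield H0 I has_derivative (\<lambda>v. J2m *v frechet_derivative (\<lambda>y. grad (\<lambda>y. F 1 y I) y) (at x) v)) (at x)"
proof -
  have "xfield H0 I = (\<lambda>x. J2m *v grad (\<lambda>y. F 1 y I) x)" by (rule ext) (rule xfield_F1[OF assms])
  then show ?thesis
    using bounded_linear.has_derivative[OF matrix_vector_mul_bounded_linear F_grad_derivative[OF card_m assms]] by simp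
qed

text \<open>
  The case \<open>\<sigma> = - 1\<close> is the time-reversed system, whose field \<open>- X\<close> has the same first integrals and the same
  commuting fields and is again hyperbolic at the equilibrium.
\<close>

lemma tail:
  fixes \<sigma> :: real
  assumes I0: "I0 \<in> V" and a0: "a0 \<in> W" and \<rho>: "\<rho> > 0" and \<sigma>: "\<sigma> = 1 \<or> \<sigma> = - 1"
  shows "\<exists>T. \<forall>\<^sub>F p in nhds (I0, a0). \<forall>t\<ge>T. norm (q (fst p) (\<sigma> * t) (snd p) - xe I0) < \<rho>"
proof (rule homoclinic_tail[where G = "\<lambda>x I. \<sigma> *\<^sub>R xfield H0 I x" and F = F and J = "{1..CARD('m)}"
      and Y = "\<lambda>j x. J2m *v grad (\<lambda>y. F j y I0) x" and V = V and W = W and q = "\<lambda>I t a. q I (\<sigma> * t) a"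
      and DY = "\<lambda>j x v. J2m *v frechet_derivative (\<lambda>y. grad (\<lambda>y. F j y I0) y) (at x) v"])
  note der = xfield_derivative
  have \<sigma>0: "\<sigma> \<noteq> 0" using \<sigma> by auto
  show "Ck_on (Suc 0) (\<lambda>(x, I). \<sigma> *\<^sub>R xfield H0 I x) (UNIV \<times> V)"
  proof -
    have "Ck_on (Suc 2) (\<lambda>(x, I). H0 x I) (UNIV \<times> V)" using H0_smooth by (simp only: numeral_3_eq_3 numeral_2_eq_2)
    from Ck_on_grad(2)[OF this] have "Ck_on (Suc (Suc 0)) (\<lambda>(x, I). grad (\<lambda>y. H0 y I) x) (UNIV \<times> V)"
      by (simp only: numeral_2_eq_2)
    from Ck_on_SucD[OF this]
    have "Ck_on (Suc 0) (\<lambda>z. \<sigma> *\<^sub>R (J2m *v (\<lambda>(x, I). grad (\<lambda>y. H0 y I) x) z)) (UNIV \<times> V)"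
      by (rule Ck_on_bounded_linear[rotated])
         (rule bounded_linear_compose[OF bounded_linear_scaleR_right matrix_vector_mul_bounded_linear])
    moreover have "(\<lambda>z. \<sigma> *\<^sub>R (J2m *v (\<lambda>(x, I). grad (\<lambda>y. H0 y I) x) z)) = (\<lambda>(x, I). \<sigma> *\<^sub>R xfield H0 I x)"
      by (auto simp: fun_eq_iff xfield_def)
    ultimately show ?thesis by (simp only:)
  qed
  show "Ck_on (Suc 0) (\<lambda>(x, I). F j x I) (UNIV \<times> V)" if "j \<in> {1..CARD('m)}" for j
    by (rule Ck_on_SucD, rule Ck_on_SucD) (use F_smooth[OF that] in \<open>simp only: numeral_3_eq_3\<close>)
  show "first_integral_on (\<lambda>x. \<sigma> *\<^sub>R xfield H0 I x) (\<lambda>x. F j x I) UNIV" if "j \<in> {1..CARD('m)}" "I \<in> V" for j I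
    using F_integral[OF that] unfolding first_integral_on_def
    by (simp add: linear_scale[OF linear_frechet_derivative])
  show "continuous_on V xe" by (rule xe_cont)
  show "continuous_on (UNIV \<times> V \<times> W) (\<lambda>(t, I, a). q I (\<sigma> * t) a)"
  proof -
    have "continuous_on (UNIV \<times> V \<times> W) (\<lambda>w. (\<lambda>(t, I, a). q I t a) (\<sigma> * fst w, fst (snd w), snd (snd w)))"
      by (rule continuous_on_compose2[OF q_cont]) (auto intro!: continuous_intros)
    then show ?thesis by (simp add: case_prod_beta)
  qed
  show "hyperbolic_equilibrium (\<lambda>x. \<sigma> *\<^sub>R xfield H0 I x) (xe I)" if I: "I \<in> V" for I
  proof -
    define D where "D = (\<lambda>v. J2m *v frechet_derivative (\<lambda>y. grad (\<lambda>y. F 1 y I) y) (at (xe I)) v)"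
    have d: "(xfield H0 I has_derivative D) (at (xe I))" unfolding D_def by (rule der[OF I])
    have sd: "((\<lambda>x. \<sigma> *\<^sub>R xfield H0 I x) has_derivative (\<lambda>v. \<sigma> *\<^sub>R D v)) (at (xe I))"
      by (rule has_derivative_scaleR_right[OF d])
    have J: "jacobian (xfield H0 I) (at (xe I)) = matrix D"
      unfolding jacobian_def using frechet_derivative_at[OF d] by simp
    have sJ: "jacobian (\<lambda>x. \<sigma> *\<^sub>R xfield H0 I x) (at (xe I)) = \<sigma> *\<^sub>R matrix D"
      unfolding jacobian_def frechet_derivative_at[OF sd, symmetric] by (simp add: matrix_def vec_eq_iff)
    have mm: "map_matrix complex_of_real (\<sigma> *\<^sub>R matrix D) *v v = complex_of_real \<sigma> *s (map_matrix complex_of_real (matrix D) *v v)" for v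
      by (simp add: vec_eq_iff matrix_vector_mult_def map_matrix_def sum_distrib_left mult.assoc)
    note h = equilibrium[OF I, unfolded hyperbolic_equilibrium_def J]
    have "Re \<mu> \<noteq> 0" if v: "v \<noteq> 0" "complex_of_real \<sigma> *s (map_matrix complex_of_real (matrix D) *v v) = \<mu> *s v" for \<mu> v
    proof -
      have "complex_of_real \<sigma> *s (complex_of_real \<sigma> *s (map_matrix complex_of_real (matrix D) *v v)) = complex_of_real \<sigma> *s (\<mu> *s v)"
        using v(2) by (simp only:)
      then have "map_matrix complex_of_real (matrix D) *v v = (complex_of_real \<sigma> * \<mu>) *s v"
        using \<sigma> by (auto simp: vector_smult_assoc)
      then have "Re (complex_of_real \<sigma> * \<mu>) \<noteq> 0" using h v(1) by blast
      then show ?thesis by simp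
    qed
    then show ?thesis
      unfolding hyperbolic_equilibrium_def sJ mm
      using h sd by (auto simp: differentiable_def)
  qed
  show "homoclinic_orbit (\<lambda>x. \<sigma> *\<^sub>R xfield H0 I x) (xe I) (\<lambda>t. q I (\<sigma> * t) a)" if "I \<in> V" "a \<in> W" for I a
  proof -
    note h = homoclinic[OF that, unfolded homoclinic_orbit_def]
    have "((\<lambda>t. q I (\<sigma> * t) a) has_vector_derivative \<sigma> *\<^sub>R xfield H0 I (q I (\<sigma> * t) a)) (at t)" for t
    proof -
      have "((\<lambda>t. \<sigma> * t) has_vector_derivative \<sigma>) (at t)"
        by (auto intro!: derivative_eq_intros simp: has_real_derivative_iff_has_vector_derivative[symmetric])
      from vector_diff_chain_at[OF this, of "\<lambda>t. q I t a"] show ?thesis using h by (simp add: o_def)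
    qed
    moreover have "((\<lambda>t. q I (\<sigma> * t) a) \<longlongrightarrow> xe I) at_top \<and> ((\<lambda>t. q I (\<sigma> * t) a) \<longlongrightarrow> xe I) at_bot"
      using \<sigma>
    proof
      assume "\<sigma> = 1"
      then show ?thesis using h by simp
    next
      assume s: "\<sigma> = - 1"
      have "((\<lambda>t. q I (- t) a) \<longlongrightarrow> xe I) at_top"
        by (rule filterlim_compose[OF _ filterlim_uminus_at_bot_at_top]) (use h in auto)
      moreover have "((\<lambda>t. q I (- t) a) \<longlongrightarrow> xe I) at_bot"
        by (rule filterlim_compose[OF _ filterlim_uminus_at_top_at_bot]) (use h in auto)
      ultimately show ?thesis by (simp add: s)
    qed
    ultimately show ?thesis unfolding homoclinic_orbit_def using h by auto
  qed
  show "((\<lambda>x. J2m *v grad (\<lambda>y. F j y I0) x) has_derivative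
      (\<lambda>v. J2m *v frechet_derivative (\<lambda>y. grad (\<lambda>y. F j y I0) y) (at x) v)) (at x)" if "j \<in> {1..CARD('m)}" for j x
    by (rule bounded_linear.has_derivative[OF matrix_vector_mul_bounded_linear F_grad_derivative[OF that I0]])
  show "J2m *v frechet_derivative (\<lambda>y. grad (\<lambda>y. F j y I0) y) (at x) (\<sigma> *\<^sub>R xfield H0 I0 x) =
      frechet_derivative (\<lambda>x. \<sigma> *\<^sub>R xfield H0 I0 x) (at x) (J2m *v grad (\<lambda>y. F j y I0) x)"
    if j: "j \<in> {1..CARD('m)}" for j x
  proof -
    define Dg where "Dg i = frechet_derivative (\<lambda>y. grad (\<lambda>y. F i y I0) y) (at x)" for i
    have Dg: "((\<lambda>y. grad (\<lambda>y. F i y I0) y) has_derivative Dg i) (at x)" if "i \<in> {1..CARD('m)}" for i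
      unfolding Dg_def by (rule F_grad_derivative[OF that I0])
    have "Dg j (J2m *v grad (\<lambda>y. F 1 y I0) x) = Dg 1 (J2m *v grad (\<lambda>y. F j y I0) x)"
      by (rule commuting_hamiltonian_fields[OF F_grad[OF j I0] F_grad[OF card_m I0] Dg[OF j] Dg[OF card_m]])
         (rule F_involution[OF j card_m I0])
    moreover have "frechet_derivative (\<lambda>x. \<sigma> *\<^sub>R xfield H0 I0 x) (at x) = (\<lambda>v. \<sigma> *\<^sub>R (J2m *v Dg 1 v))"
      unfolding frechet_derivative_at[OF has_derivative_scaleR_right[OF der[OF I0]], symmetric] Dg_def ..
    moreover have "linear (Dg j)" using has_derivative_linear[OF Dg[OF j]] .
    ultimately show ?thesis
      unfolding xfield_F1[OF I0] Dg_def[symmetric] by (simp add: linear_scale matrix_vector_mult_scaleR)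
  qed
  show "\<exists>a. v = (\<Sum>j\<in>{1..CARD('m)}. a j *\<^sub>R (J2m *v grad (\<lambda>y. F j y I0) x))"
    if x: "\<sigma> *\<^sub>R xfield H0 I0 x \<noteq> 0"
      and v: "\<And>j. j \<in> {1..CARD('m)} \<Longrightarrow> frechet_derivative (\<lambda>x. F j x I0) (at x) v = 0" for x v
  proof (rule isotropic_span)
    have "xfield H0 I0 x \<noteq> 0" using x by auto
    from F_independent[OF I0 this]
    show "inj_on (\<lambda>j. grad (\<lambda>y. F j y I0) x) {1..CARD('m)}"
      "independent ((\<lambda>j. grad (\<lambda>y. F j y I0) x) ` {1..CARD('m)})" by auto
    show "grad (\<lambda>y. F j y I0) x \<bullet> v = 0" if "j \<in> {1..CARD('m)}" for j
      using v[OF that] unfolding frechet_derivative_at[OF F_grad[OF that I0], symmetric] .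
    show "grad (\<lambda>y. F i y I0) x \<bullet> (J2m *v grad (\<lambda>y. F j y I0) x) = 0"
      if "i \<in> {1..CARD('m)}" "j \<in> {1..CARD('m)}" for i j
      by (rule F_involution[OF that I0])
  qed auto
qed (use V W I0 a0 \<rho> in auto)

end

section \<open>Orbits near a homoclinic orbit and its limit circle\<close>

lemma open_angle_lift:
  assumes "openin (top_of_set (UNIV \<times> V \<times> sphere 0 1)) U" "open V"
  shows "open (angle_lift (U :: ('x::real_normed_vector \<times> real \<times> complex) set))"
    and "(x, I, \<theta>) \<in> angle_lift U \<Longrightarrow> I \<in> V"
proof -
  obtain U' where U': "open U'" "U = (UNIV \<times> V \<times> sphere 0 1) \<inter> U'" using assms(1) by (auto simp: openin_open)
  have "open ((UNIV \<times> V \<times> (UNIV :: real set)) \<inter> (\<lambda>(x :: 'x, I, \<theta>). (x, I, cis \<theta>)) -` U')"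
  proof (rule open_Int)
    show "open ((UNIV :: 'x set) \<times> V \<times> (UNIV :: real set))" using assms(2) by (intro open_Times) auto
    show "open ((\<lambda>(x :: 'x, I, \<theta>). (x, I, cis \<theta>)) -` U')"
      by (rule open_vimage[OF U'(1)]) (auto simp: case_prod_beta intro!: continuous_intros)
  qed
  moreover have "angle_lift U = (UNIV \<times> V \<times> UNIV) \<inter> (\<lambda>(x :: 'x, I, \<theta>). (x, I, cis \<theta>)) -` U'"
    by (auto simp: angle_lift_def U'(2))
  ultimately show "open (angle_lift U)" by simp
  show "(x, I, \<theta>) \<in> angle_lift U \<Longrightarrow> I \<in> V" using U'(2) by (auto simp: angle_lift_def)
qed

context integrable_homoclinics
begin

lemma dH0_continuous: "continuous_on (UNIV \<times> V) (\<lambda>(x, I). deriv (\<lambda>K. H0 x K) I)"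
proof -
  have C: "Ck_on (Suc 0) (\<lambda>(x, I). H0 x I) (UNIV \<times> V)"
    by (rule Ck_on_SucD, rule Ck_on_SucD) (use H0_smooth in \<open>simp only: numeral_3_eq_3\<close>)
  have S: "open ((UNIV :: (real ^ ('m + 'm)) set) \<times> V)" using V by (intro open_Times) auto
  obtain f' where f': "\<And>v. continuous_on (UNIV \<times> V) (f' v)"
    "\<And>c w s. (c has_vector_derivative w) (at s) \<Longrightarrow> c s \<in> UNIV \<times> V \<Longrightarrow>
       deriv (\<lambda>s. (\<lambda>(x, I). H0 x I) (c s)) s = f' w (c s)"
    using Ck_on_directional[OF C S] by metis
  show ?thesis
  proof (rule continuous_on_eq[OF f'(1)[of "(0, 1)"]])
    fix z :: "(real ^ ('m + 'm)) \<times> real" assume z: "z \<in> UNIV \<times> V"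
    obtain x I where xI: "z = (x, I)" by (cases z)
    have "((\<lambda>K. (x, K)) has_vector_derivative (0, 1)) (at I)"
      unfolding has_vector_derivative_def by (auto intro!: derivative_eq_intros)
    from f'(2)[OF this] z show "f' (0, 1) z = (\<lambda>(x, I). deriv (\<lambda>K. H0 x K) I) z" by (simp add: xI)
  qed
qed

lemma speed_continuous:
  "continuous_on ((V \<times> W) \<times> UNIV) (\<lambda>(p, s). deriv (\<lambda>K. H0 (q (fst p) s (snd p)) K) (fst p))"
proof -
  have qc: "continuous_on ((V \<times> W) \<times> UNIV) (\<lambda>w. (\<lambda>(t, I, \<alpha>). q I t \<alpha>) (snd w, fst (fst w), snd (fst w)))"
    by (rule continuous_on_compose2[OF q_cont]) (auto intro!: continuous_intros)
  have "continuous_on ((V \<times> W) \<times> UNIV)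
      (\<lambda>w. (\<lambda>(x, I). deriv (\<lambda>K. H0 x K) I) ((\<lambda>(t, I, \<alpha>). q I t \<alpha>) (snd w, fst (fst w), snd (fst w)), fst (fst w)))"
  proof (rule continuous_on_compose2[OF dH0_continuous])
    show "continuous_on ((V \<times> W) \<times> UNIV)
      (\<lambda>w. ((\<lambda>(t, I, \<alpha>). q I t \<alpha>) (snd w, fst (fst w), snd (fst w)), fst (fst w)))"
      by (rule continuous_on_Pair[OF qc]) (intro continuous_intros)
  qed auto
  then show ?thesis by (simp add: case_prod_beta)
qed

lemma theta_of_derivative:
  assumes "I \<in> V" "\<alpha> \<in> W"
  shows "((\<lambda>t. theta_of H0 q I t \<alpha>) has_real_derivative deriv (\<lambda>K. H0 (q I t \<alpha>) K) I) (at t)"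
  unfolding theta_of_def zero_ereal_def[symmetric]
proof (rule interval_integral_has_derivative)
  have "continuous_on UNIV (\<lambda>s. (\<lambda>(p, s). deriv (\<lambda>K. H0 (q (fst p) s (snd p)) K) (fst p)) ((I, \<alpha>), s))"
    by (rule continuous_on_compose2[OF speed_continuous]) (use assms in \<open>auto intro!: continuous_intros\<close>)
  then show "continuous_on UNIV (\<lambda>s. deriv (\<lambda>K. H0 (q I s \<alpha>) K) I)" by simp
qed

lemma theta_of_continuous:
  "continuous_on ((V \<times> W) \<times> UNIV) (\<lambda>(p, t). theta_of H0 q (fst p) t (snd p))"
  using interval_integral_continuous_param[OF speed_continuous] by (simp add: theta_of_def)

text \<open>
  The limit circle is compact, so \<open>U\<close> contains a uniform tube around it, which takes up the tails
  \<open>\<bar>t\<bar> \<ge> T\<close>. The remaining compact piece of the orbit is handled by continuity in all parameters, with the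
  angle \<open>\<theta>\<close> entering through \<open>cis \<theta>\<close>.
\<close>

lemma orbits_stay:
  assumes I0: "I0 \<in> V" and a0: "a0 \<in> W"
    and U: "openin (top_of_set (UNIV \<times> V \<times> sphere 0 1)) U"
    and \<Gamma>: "\<And>t. (q I0 t a0, I0, cis (theta_of H0 q I0 t a0 + \<theta>0)) \<in> U"
    and \<gamma>: "\<And>\<theta>. (xe I0, I0, cis \<theta>) \<in> U"
  shows "\<exists>d>0. \<forall>I \<alpha> \<theta>. dist I I0 < d \<longrightarrow> dist \<alpha> a0 < d \<longrightarrow> dist (cis \<theta>) (cis \<theta>0) < d \<longrightarrow>
     I \<in> V \<and> \<alpha> \<in> W \<and> (\<forall>t. (q I t \<alpha>, I, cis (theta_of H0 q I t \<alpha> + \<theta>)) \<in> U) \<and> (xe I, I, cis \<theta>) \<in> U"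
proof -
  obtain U' where U': "open U'" "U = (UNIV \<times> V \<times> sphere 0 1) \<inter> U'" using U by (auto simp: openin_open)
  have sph: "\<exists>\<theta>. z = cis \<theta>" if "z \<in> sphere 0 1" for z :: complex
    using that by (metis mem_sphere_0 rcis_cmod_Arg rcis_def of_real_1 mult_1)
  \<comment> \<open>regroups the coordinates so that the circle becomes the second factor of a product\<close>
  define O1 where "O1 = (\<lambda>w :: ((real ^ ('m + 'm)) \<times> real) \<times> complex. (fst (fst w), snd (fst w), snd w)) -` U'"
  have "open O1" unfolding O1_def by (rule open_vimage[OF U'(1)]) (auto intro!: continuous_intros)
  moreover have "{(xe I0, I0)} \<times> sphere (0::complex) 1 \<subseteq> O1"
    using \<gamma> sph U'(2) unfolding O1_def by fastforce
  ultimately obtain N where N: "open N" "(xe I0, I0) \<in> N" "N \<times> sphere (0::complex) 1 \<subseteq> O1"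
    using tube[OF compact_sphere] by metis
  obtain \<rho> where \<rho>: "\<rho> > 0" "ball (xe I0, I0) \<rho> \<subseteq> N" using N(1,2) openE by blast
  have inU: "(x, I, cis \<theta>) \<in> U" if "I \<in> V" "norm (x - xe I0) < \<rho> / 2" "\<bar>I - I0\<bar> < \<rho> / 2" for x I \<theta>
  proof -
    have "dist (x, I) (xe I0, I0) \<le> norm (x - xe I0) + \<bar>I - I0\<bar>"
      using norm_Pair_le[of "x - xe I0" "I - I0"] by (simp add: dist_norm)
    then have "dist (xe I0, I0) (x, I) < \<rho>" using that by (simp add: dist_commute)
    then have "((x, I), cis \<theta>) \<in> O1" using \<rho>(2) N(3) by (auto simp: subset_iff)
    then show ?thesis using U'(2) that(1) by (simp add: O1_def)
  qed
  obtain T1 where T1: "\<forall>\<^sub>F p in nhds (I0, a0). \<forall>t\<ge>T1. norm (q (fst p) (1 * t) (snd p) - xe I0) < \<rho> / 2"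
    using tail[OF I0 a0, of "\<rho> / 2" 1] \<rho>(1) by auto
  obtain T2 where T2: "\<forall>\<^sub>F p in nhds (I0, a0). \<forall>t\<ge>T2. norm (q (fst p) (- 1 * t) (snd p) - xe I0) < \<rho> / 2"
    using tail[OF I0 a0, of "\<rho> / 2" "- 1"] \<rho>(1) by auto
  define T where "T = max T1 T2"
  have VW: "\<forall>\<^sub>F p in nhds (I0, a0). p \<in> V \<times> W"
    by (rule eventually_nhds_in_open) (use V W I0 a0 in \<open>auto intro: open_Times\<close>)
  have nI: "\<forall>\<^sub>F p in nhds (I0, a0). \<bar>fst p - I0\<bar> < \<rho> / 2 \<and> norm (xe (fst p) - xe I0) < \<rho> / 2"
  proof (rule eventually_nhds_Pair_fst, rule eventually_conj)
    have r2: "\<rho> / 2 > 0" using \<rho>(1) by simp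
    show "\<forall>\<^sub>F I in nhds I0. \<bar>I - I0\<bar> < \<rho> / 2"
      using eventually_nhds_ball[OF r2, of I0] by eventually_elim (simp add: dist_real_def abs_minus_commute)
    show "\<forall>\<^sub>F I in nhds I0. norm (xe I - xe I0) < \<rho> / 2"
      using tendstoD[OF continuous_on_tendsto_nhds[OF xe_cont V I0] r2] by (simp add: dist_norm)
  qed
  define \<Omega> where "\<Omega> = ((V \<times> W) \<times> (UNIV :: complex set)) \<times> (UNIV :: real set)"
  define \<Psi> where "\<Psi> w = (q (fst (fst (fst w))) (snd w) (snd (fst (fst w))), fst (fst (fst w)),
      cis (theta_of H0 q (fst (fst (fst w))) (snd w) (snd (fst (fst w)))) * snd (fst w))"
    for w :: "((real \<times> 'a) \<times> complex) \<times> real"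
  have "continuous_on \<Omega> \<Psi>"
    unfolding \<Psi>_def
  proof (intro continuous_on_Pair continuous_on_mult)
    have "continuous_on \<Omega> (\<lambda>w. (\<lambda>(t, I, \<alpha>). q I t \<alpha>) (snd w, fst (fst (fst w)), snd (fst (fst w))))"
      by (rule continuous_on_compose2[OF q_cont]) (auto simp: \<Omega>_def intro!: continuous_intros)
    then show "continuous_on \<Omega> (\<lambda>w. q (fst (fst (fst w))) (snd w) (snd (fst (fst w))))" by (simp add: case_prod_beta)
    have "continuous_on \<Omega> (\<lambda>w. (\<lambda>(p, t). theta_of H0 q (fst p) t (snd p)) (fst (fst w), snd w))"
      by (rule continuous_on_compose2[OF theta_of_continuous]) (auto simp: \<Omega>_def intro!: continuous_intros)
    then show "continuous_on \<Omega> (\<lambda>w. cis (theta_of H0 q (fst (fst (fst w))) (snd w) (snd (fst (fst w)))))"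
      by (auto intro!: continuous_intros)
  qed (auto intro!: continuous_intros)
  moreover have "open \<Omega>" unfolding \<Omega>_def using V W by (intro open_Times) auto
  ultimately have "open (\<Omega> \<inter> \<Psi> -` U')" using U'(1) by (rule continuous_open_preimage)
  moreover have "{((I0, a0), cis \<theta>0)} \<times> {- T..T} \<subseteq> \<Omega> \<inter> \<Psi> -` U'"
    using \<Gamma> U'(2) I0 a0 by (auto simp: \<Omega>_def \<Psi>_def cis_mult)
  ultimately obtain M where M: "open M" "((I0, a0), cis \<theta>0) \<in> M" "M \<times> {- T..T} \<subseteq> \<Omega> \<inter> \<Psi> -` U'"
    using tube[OF compact_Icc] by metis
  obtain M1 M2 where M12': "open M1" "open M2" "((I0, a0), cis \<theta>0) \<in> M1 \<times> M2" "M1 \<times> M2 \<subseteq> M"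
    by (rule open_prod_elim[OF M(1,2)])
  have M12: "open M1" "open M2" "(I0, a0) \<in> M1" "cis \<theta>0 \<in> M2" "M1 \<times> M2 \<subseteq> M" using M12' by auto
  obtain d2 where d2': "d2 > 0" "ball (cis \<theta>0) d2 \<subseteq> M2" by (rule openE[OF M12(2,4)])
  have d2: "d2 > 0" "\<And>z. dist z (cis \<theta>0) < d2 \<Longrightarrow> z \<in> M2" using d2' by (auto simp: dist_commute)
  have "\<forall>\<^sub>F p in nhds (I0, a0). p \<in> M1" using M12(1,3) by (rule eventually_nhds_in_open)
  note M1e = this
  define good where "good p \<longleftrightarrow> p \<in> V \<times> W \<and> p \<in> M1 \<and>
      (\<bar>fst p - I0\<bar> < \<rho> / 2 \<and> norm (xe (fst p) - xe I0) < \<rho> / 2) \<and>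
      (\<forall>t\<ge>T1. norm (q (fst p) (1 * t) (snd p) - xe I0) < \<rho> / 2) \<and>
      (\<forall>t\<ge>T2. norm (q (fst p) (- 1 * t) (snd p) - xe I0) < \<rho> / 2)" for p
  have "eventually good (nhds (I0, a0))"
    unfolding good_def by (intro eventually_conj VW M1e nI T1 T2)
  then obtain d1 where d1: "d1 > 0" "\<And>p. dist p (I0, a0) < d1 \<Longrightarrow> good p"
    unfolding eventually_nhds_metric by auto
  show ?thesis
  proof (intro exI[of _ "min (d1 / 2) d2"] conjI allI impI)
    show "min (d1 / 2) d2 > 0" using d1(1) d2(1) by simp
    fix I \<alpha> \<theta>
    assume as: "dist I I0 < min (d1 / 2) d2" "dist \<alpha> a0 < min (d1 / 2) d2" "dist (cis \<theta>) (cis \<theta>0) < min (d1 / 2) d2"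
    have "dist (I, \<alpha>) (I0, a0) \<le> dist I I0 + dist \<alpha> a0"
      using norm_Pair_le[of "I - I0" "\<alpha> - a0"] by (simp add: dist_norm)
    then have "dist (I, \<alpha>) (I0, a0) < d1" using as by simp
    note p = d1(2)[OF this, unfolded good_def fst_conv snd_conv]
    show "I \<in> V" "\<alpha> \<in> W" using p by auto
    show "(xe I, I, cis \<theta>) \<in> U" by (rule inU) (use p in auto)
    fix t
    consider "t \<ge> T1" | "- t \<ge> T2" | "t \<in> {- T..T}" unfolding T_def by fastforce
    then show "(q I t \<alpha>, I, cis (theta_of H0 q I t \<alpha> + \<theta>)) \<in> U"
    proof cases
      case 1
      then have "norm (q I (1 * t) \<alpha> - xe I0) < \<rho> / 2" using p by simp
      then show ?thesis by (intro inU) (use p in auto)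
    next
      case 2
      then have "norm (q I (- 1 * - t) \<alpha> - xe I0) < \<rho> / 2"
        using p[THEN conjunct2, THEN conjunct2, THEN conjunct2, THEN conjunct2, rule_format, OF 2] by simp
      then show ?thesis by (intro inU) (use p in auto)
    next
      case 3
      have "((I, \<alpha>), cis \<theta>) \<in> M" using p as d2(2) M12(5) by auto
      then have "(((I, \<alpha>), cis \<theta>), t) \<in> \<Psi> -` U'" using 3 M(3) by blast
      then show ?thesis using p U'(2) by (simp add: \<Psi>_def cis_mult)
    qed
  qed
qed

end

section \<open>Limits of Melnikov integrals\<close>

context integrable_homoclinics
begin

lemma perturbation_continuous:
  fixes H1 :: "real ^ ('m + 'm) \<Rightarrow> real \<Rightarrow> real \<Rightarrow> real"
  assumes H1: "Ck_on 3 (\<lambda>(x, I, \<theta>). H1 x I \<theta>) (UNIV \<times> V \<times> UNIV)"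
  shows "continuous_on (UNIV \<times> V \<times> UNIV) (\<lambda>(x, I, \<theta>).
     (J2m *v grad (\<lambda>y. H1 y I \<theta>) x, - deriv (\<lambda>s. H1 x I s) \<theta>, deriv (\<lambda>K. H1 x K \<theta>) I))"
proof -
  let ?S = "(UNIV :: (real ^ ('m + 'm)) set) \<times> V \<times> (UNIV :: real set)"
  have C: "Ck_on (Suc 0) (\<lambda>(x, I, \<theta>). H1 x I \<theta>) ?S"
    by (rule Ck_on_SucD, rule Ck_on_SucD) (use H1 in \<open>simp only: numeral_3_eq_3\<close>)
  have S: "open ?S" using V by (intro open_Times) auto
  obtain f' where f': "\<And>v. continuous_on ?S (f' v)"
    "\<And>c w s. (c has_vector_derivative w) (at s) \<Longrightarrow> c s \<in> ?S \<Longrightarrow>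
       deriv (\<lambda>s. (\<lambda>(x, I, \<theta>). H1 x I \<theta>) (c s)) s = f' w (c s)"
    using Ck_on_directional[OF C S] by metis
  have 1: "continuous_on ?S (\<lambda>z. deriv (\<lambda>s. H1 (fst z) (fst (snd z)) s) (snd (snd z)))"
  proof (rule continuous_on_eq[OF f'(1)[of "(0, 0, 1)"]])
    fix z assume z: "z \<in> ?S"
    have "((\<lambda>s. (fst z, fst (snd z), s)) has_vector_derivative (0, 0, 1)) (at (snd (snd z)))"
      unfolding has_vector_derivative_def by (auto intro!: derivative_eq_intros)
    from f'(2)[OF this] z show "f' (0, 0, 1) z = deriv (\<lambda>s. H1 (fst z) (fst (snd z)) s) (snd (snd z))" by simp
  qed
  have 2: "continuous_on ?S (\<lambda>z. deriv (\<lambda>K. H1 (fst z) K (snd (snd z))) (fst (snd z)))"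
  proof (rule continuous_on_eq[OF f'(1)[of "(0, 1, 0)"]])
    fix z assume z: "z \<in> ?S"
    have "((\<lambda>K. (fst z, K, snd (snd z))) has_vector_derivative (0, 1, 0)) (at (fst (snd z)))"
      unfolding has_vector_derivative_def by (auto intro!: derivative_eq_intros)
    from f'(2)[OF this] z show "f' (0, 1, 0) z = deriv (\<lambda>K. H1 (fst z) K (snd (snd z))) (fst (snd z))"
      by (auto simp: mem_Times_iff)
  qed
  have 3: "continuous_on ?S (\<lambda>z. J2m *v grad (\<lambda>y. H1 y (fst (snd z)) (snd (snd z))) (fst z))"
  proof -
    have "Ck_on (Suc 0) (\<lambda>(x, y). (\<lambda>x y. H1 x (fst y) (snd y)) x y) (UNIV \<times> (V \<times> UNIV))"
    proof -
      have "(\<lambda>(x, y). (\<lambda>x y. H1 x (fst y) (snd y)) x y) = (\<lambda>(x, I, \<theta>). H1 x I \<theta>)" by (auto simp: fun_eq_iff)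
      then show ?thesis using C by (simp only:)
    qed
    from Ck_on_continuous_on[OF Ck_on_grad(2)[OF this]]
    have "continuous_on ?S (\<lambda>z. grad (\<lambda>y. H1 y (fst (snd z)) (snd (snd z))) (fst z))"
      by (simp add: case_prod_beta)
    then show ?thesis by (rule bounded_linear.continuous_on[OF matrix_vector_mul_bounded_linear])
  qed
  show ?thesis
    unfolding case_prod_beta by (intro continuous_on_Pair continuous_on_minus 1 2 3)
qed

text \<open>
  Continuity in \<open>e\<close> at 0 identifies \<open>G 0\<close> with \<open>Fh\<close>, so the first variation is the Melnikov
  integrand. The function \<open>g1\<close> inherits the period \<open>2\<pi>\<close> from \<open>G\<close>, whence its values at the two end points
  have the common limit \<open>g1 (xe I, I, \<theta>)\<close>.
\<close>

lemma melnikov_integral_tendsto_0: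
  fixes H1 :: "real ^ ('m + 'm) \<Rightarrow> real \<Rightarrow> real \<Rightarrow> real" and \<tau> :: "int \<Rightarrow> real"
  assumes H1: "Ck_on 3 (\<lambda>(x, I, \<theta>). H1 x I \<theta>) (UNIV \<times> V \<times> UNIV)"
    and Fh: "Ck_on (Suc 0) (\<lambda>(x, I). Fh x I) (UNIV \<times> V)"
    and U: "openin (top_of_set (UNIV \<times> V \<times> sphere 0 1)) U" and e1: "e1 > 0"
    and periodic: "\<And>e x I \<theta>. e \<in> {0..<e1} \<Longrightarrow> (x, I, \<theta>) \<in> angle_lift U \<Longrightarrow> G e (x, I, \<theta> + 2 * pi) = G e (x, I, \<theta>)"
    and fi: "\<And>e. e \<in> {0..<e1} \<Longrightarrow> first_integral_on (full_field H0 H1 e) (G e) (angle_lift U)"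
    and G: "Ck_on (Suc 0) (\<lambda>(e, z). G e z) ({0..<e1} \<times> angle_lift U)"
    and bigo: "\<And>x I \<theta>. (x, I, \<theta>) \<in> angle_lift U \<Longrightarrow> (\<lambda>e. G e (x, I, \<theta>) - Fh x I) \<in> O[at_right 0](\<lambda>e. e)"
    and I: "I \<in> V" and \<alpha>: "\<alpha> \<in> W"
    and orbit: "\<And>t. (q I t \<alpha>, I, cis (theta_of H0 q I t \<alpha> + \<theta>)) \<in> U"
    and limit: "(xe I, I, cis \<theta>) \<in> U"
    and \<tau>_zero: "\<And>j. \<exists>n::int. theta_of H0 q I (\<tau> j) \<alpha> = 2 * pi * n"
    and \<tau>_lim: "filterlim \<tau> at_top at_top" "filterlim \<tau> at_bot at_bot"
  shows "(\<lambda>j::nat. LBINT t=\<tau> (- int j)..\<tau> (int j).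
        grad (\<lambda>y. Fh y I) (q I t \<alpha>) \<bullet> (J2m *v grad (\<lambda>y. H1 y I (theta_of H0 q I t \<alpha> + \<theta>)) (q I t \<alpha>))
        - deriv (\<lambda>K. Fh (q I t \<alpha>) K) I * deriv (\<lambda>s. H1 (q I t \<alpha>) I s) (theta_of H0 q I t \<alpha> + \<theta>)) \<longlonglongrightarrow> 0"
proof -
  define S where "S = angle_lift U"
  have S: "open S" unfolding S_def by (rule open_angle_lift(1)[OF U V])
  have SV: "I' \<in> V" if "(x, I', \<theta>') \<in> S" for x I' \<theta>' using open_angle_lift(2)[OF U V] that unfolding S_def .
  have S_shift: "(x, I', \<theta>' + 2 * pi * of_int n) \<in> S \<longleftrightarrow> (x, I', \<theta>') \<in> S" for x I' \<theta>' and n :: int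
  proof -
    have "cis (\<theta>' + 2 * pi * of_int n) = cis \<theta>'"
      by (simp add: cis_mult[symmetric] cis_multiple_2pi)
    then show ?thesis by (simp add: S_def angle_lift_def)
  qed
  define X0 where "X0 = (\<lambda>(x, I, \<theta>::real). (J2m *v grad (\<lambda>y. H0 y I) x, 0::real, deriv (\<lambda>K. H0 x K) I))"
  define X1 where "X1 = (\<lambda>(x, I, \<theta>). (J2m *v grad (\<lambda>y. H1 y I \<theta>) x, - deriv (\<lambda>s. H1 x I s) \<theta>, deriv (\<lambda>K. H1 x K \<theta>) I))"
  have field: "full_field H0 H1 e z = X0 z + e *\<^sub>R X1 z" for e z
    by (cases z) (simp add: full_field_def X0_def X1_def)
  have inv: "frechet_derivative (G e) (at z) (X0 z + e *\<^sub>R X1 z) = 0" if "e \<in> {0..<e1}" "z \<in> S" for e z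
    using fi[OF that(1)] that(2) unfolding first_integral_on_def S_def[symmetric] field by blast
  from variation_along_orbit[OF S e1 G[folded S_def] inv]
  obtain g1 where "continuous_on S g1 \<and>
      (\<forall>z\<in>S. ((\<lambda>e. G e z) has_real_derivative g1 z) (at 0 within {0..<e1})) \<and>
      (\<forall>c a b. (\<forall>t. (c has_vector_derivative X0 (c t)) (at t)) \<longrightarrow> (\<forall>t. c t \<in> S) \<longrightarrow>
        continuous_on UNIV (\<lambda>t. X1 (c t)) \<longrightarrow> a \<le> b \<longrightarrow>
        continuous_on {a..b} (\<lambda>t. frechet_derivative (G 0) (at (c t)) (X1 (c t))) \<and>
        integral {a..b} (\<lambda>t. frechet_derivative (G 0) (at (c t)) (X1 (c t))) = g1 (c a) - g1 (c b))" ..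
  note var = this
  have g1: "continuous_on S g1"
    "\<And>z. z \<in> S \<Longrightarrow> ((\<lambda>e. G e z) has_real_derivative g1 z) (at 0 within {0..<e1})"
    and g1_var: "\<forall>c a b. (\<forall>t. (c has_vector_derivative X0 (c t)) (at t)) \<longrightarrow> (\<forall>t. c t \<in> S) \<longrightarrow>
        continuous_on UNIV (\<lambda>t. X1 (c t)) \<longrightarrow> a \<le> b \<longrightarrow>
        continuous_on {a..b} (\<lambda>t. frechet_derivative (G 0) (at (c t)) (X1 (c t))) \<and>
        integral {a..b} (\<lambda>t. frechet_derivative (G 0) (at (c t)) (X1 (c t))) = g1 (c a) - g1 (c b)"
    by (rule var[THEN conjunct1], erule bspec[OF var[THEN conjunct2, THEN conjunct1]],
        rule var[THEN conjunct2, THEN conjunct2])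
  have at0: "at 0 within {0..<e1} = at_right 0"
    by (rule at_within_nhd[of _ "{..<e1}"]) (use e1 in auto)
  have G0: "G 0 (x, I', \<theta>') = Fh x I'" if z: "(x, I', \<theta>') \<in> S" for x I' \<theta>'
  proof -
    have "((\<lambda>e. G e (x, I', \<theta>')) \<longlongrightarrow> G 0 (x, I', \<theta>')) (at_right 0)"
      using DERIV_continuous[OF g1(2)[OF z]] unfolding continuous_within at0 .
    moreover have "((\<lambda>e. G e (x, I', \<theta>')) \<longlongrightarrow> Fh x I') (at_right 0)"
    proof -
      have "((\<lambda>e. G e (x, I', \<theta>') - Fh x I') \<longlongrightarrow> 0) (at_right 0)"
      proof -
        obtain C where "\<forall>\<^sub>F e in at_right 0. norm (G e (x, I', \<theta>') - Fh x I') \<le> C * norm e"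
          by (rule landau_o.bigE[OF bigo[OF z[unfolded S_def]]])
        moreover have "((\<lambda>e. C * norm e) \<longlongrightarrow> 0) (at_right (0::real))" by (auto intro!: tendsto_eq_intros)
        ultimately show ?thesis by (rule Lim_null_comparison)
      qed
      from tendsto_add[OF this tendsto_const[of "Fh x I'"]] show ?thesis by simp
    qed
    ultimately show ?thesis by (rule tendsto_unique[OF trivial_limit_at_right_real])
  qed
  have G0_der: "frechet_derivative (G 0) (at (x, I', \<theta>')) (u, v, w) = grad (\<lambda>y. Fh y I') x \<bullet> u + deriv (\<lambda>K. Fh x K) I' * v"
    if z: "(x, I', \<theta>') \<in> S" for x I' \<theta>' u v w
  proof -
    have SV': "open ((UNIV :: (real ^ ('m + 'm)) set) \<times> V)" using V by (intro open_Times) auto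
    obtain f' where f': "\<And>z. z \<in> UNIV \<times> V \<Longrightarrow> ((\<lambda>(x, I). Fh x I) has_derivative (\<lambda>v. f' v z)) (at z)"
      "\<And>c w s. (c has_vector_derivative w) (at s) \<Longrightarrow> c s \<in> UNIV \<times> V \<Longrightarrow>
       deriv (\<lambda>s. (\<lambda>(x, I). Fh x I) (c s)) s = f' w (c s)"
      using Ck_on_directional[OF Fh SV'] by metis
    have xV: "(x, I') \<in> UNIV \<times> V" using SV[OF z] by simp
    have proj: "((\<lambda>z. (fst z, fst (snd z))) has_derivative (\<lambda>h. (fst h, fst (snd h)))) (at (x, I', \<theta>'))"
      by (auto intro!: derivative_eq_intros)
    have "((\<lambda>z. (\<lambda>(x, I). Fh x I) (fst z, fst (snd z))) has_derivative (\<lambda>h. f' (fst h, fst (snd h)) (x, I'))) (at (x, I', \<theta>'))"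
      using has_derivative_compose[OF proj, of "\<lambda>(x, I). Fh x I" "\<lambda>v. f' v (x, I')"] f'(1)[OF xV] by simp
    then have "(G 0 has_derivative (\<lambda>h. f' (fst h, fst (snd h)) (x, I'))) (at (x, I', \<theta>'))"
      by (rule has_derivative_transform_within_open[OF _ S z]) (auto simp: G0)
    then have "frechet_derivative (G 0) (at (x, I', \<theta>')) (u, v, w) = f' (u, v) (x, I')"
      by (simp add: frechet_derivative_at[symmetric])
    also have "\<dots> = f' (u, 0) (x, I') + v * f' (0, 1) (x, I')"
    proof -
      have l: "linear (\<lambda>v. f' v (x, I'))" using has_derivative_linear[OF f'(1)[OF xV]] .
      have "f' ((u, 0) + v *\<^sub>R (0, 1)) (x, I') = f' (u, 0) (x, I') + v *\<^sub>R f' (0, 1) (x, I')"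
        unfolding linear_add[OF l] linear_scale[OF l] ..
      then show ?thesis by simp
    qed
    also have "f' (u, 0) (x, I') = grad (\<lambda>y. Fh y I') x \<bullet> u"
    proof -
      have "((\<lambda>y. Fh y I') has_derivative (\<lambda>v. f' (v, 0) (x, I'))) (at x)"
        by (rule has_derivative_slice_fst[where V = V, OF has_derivative_at_withinI[OF f'(1)[OF xV]] SV[OF z]])
      from has_derivative_unique[OF this Ck_on_grad(1)[OF Fh SV[OF z]]] show ?thesis by metis
    qed
    also have "f' (0, 1) (x, I') = deriv (\<lambda>K. Fh x K) I'"
    proof -
      have "((\<lambda>K. (x, K)) has_vector_derivative (0, 1)) (at I')"
        unfolding has_vector_derivative_def by (auto intro!: derivative_eq_intros)
      from f'(2)[OF this] xV show ?thesis by simp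
    qed
    finally show ?thesis by (simp add: mult.commute)
  qed
  have g1_per: "g1 (x, I', \<theta>' + 2 * pi) = g1 (x, I', \<theta>')" if z: "(x, I', \<theta>') \<in> S" for x I' \<theta>'
  proof -
    have z': "(x, I', \<theta>' + 2 * pi) \<in> S" using S_shift[of x I' \<theta>' 1] z by simp
    have "((\<lambda>e. G e (x, I', \<theta>' + 2 * pi)) has_real_derivative g1 (x, I', \<theta>')) (at 0 within {0..<e1})"
      by (rule has_field_derivative_transform_within[OF g1(2)[OF z] e1])
         (use e1 periodic z in \<open>auto simp: S_def\<close>)
    from g1(2)[OF z'] this show ?thesis
      unfolding has_field_derivative_iff at0 by (rule tendsto_unique[OF trivial_limit_at_right_real])
  qed
  have g1_nat: "g1 (x, I', \<theta>' + 2 * pi * real n) = g1 (x, I', \<theta>')" if z: "(x, I', \<theta>') \<in> S" for x I' \<theta>' n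
  proof (induction n)
    case (Suc n)
    have "(x, I', \<theta>' + 2 * pi * of_int (int n)) \<in> S" using S_shift z by blast
    then have "g1 (x, I', \<theta>' + 2 * pi * real n + 2 * pi) = g1 (x, I', \<theta>' + 2 * pi * real n)" by (intro g1_per) simp
    then show ?case using Suc by (simp add: algebra_simps)
  qed simp
  have g1_int: "g1 (x, I', 2 * pi * of_int n + \<theta>') = g1 (x, I', \<theta>')" if z: "(x, I', \<theta>') \<in> S" for x I' \<theta>' and n :: int
  proof (cases "n \<ge> 0")
    case True
    then show ?thesis using g1_nat[OF z, of "nat n"] by (simp add: add.commute)
  next
    case False
    have "(x, I', \<theta>' + 2 * pi * of_int n) \<in> S" using S_shift z by blast
    from g1_nat[OF this, of "nat (- n)"] False show ?thesis by (simp add: add.commute)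
  qed
  define c where "c t = (q I t \<alpha>, I, theta_of H0 q I t \<alpha> + \<theta>)" for t
  have c': "(c has_vector_derivative X0 (c t)) (at t)" for t
  proof -
    have "((\<lambda>t. q I t \<alpha>) has_vector_derivative J2m *v grad (\<lambda>y. H0 y I) (q I t \<alpha>)) (at t)"
      using homoclinic[OF I \<alpha>] unfolding homoclinic_orbit_def xfield_def by blast
    moreover have "((\<lambda>t. theta_of H0 q I t \<alpha> + \<theta>) has_vector_derivative deriv (\<lambda>K. H0 (q I t \<alpha>) K) I) (at t)"
      using theta_of_derivative[OF I \<alpha>, of t]
      unfolding has_real_derivative_iff_has_vector_derivative[symmetric] by (auto intro!: derivative_eq_intros)
    ultimately show ?thesis
      unfolding c_def X0_def by (auto intro!: has_vector_derivative_Pair has_vector_derivative_const)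
  qed
  have cS: "c t \<in> S" for t using orbit by (simp add: c_def S_def angle_lift_def)
  have cc: "continuous_on UNIV c" by (rule continuous_on_vector_derivative[of _ _ "\<lambda>t. X0 (c t)"]) (use c' in auto)
  have X1c: "continuous_on UNIV (\<lambda>t. X1 (c t))"
    unfolding X1_def by (rule continuous_on_compose2[OF perturbation_continuous[OF H1] cc]) (use I in \<open>auto simp: c_def\<close>)
  define N where "N t = grad (\<lambda>y. Fh y I) (q I t \<alpha>) \<bullet> (J2m *v grad (\<lambda>y. H1 y I (theta_of H0 q I t \<alpha> + \<theta>)) (q I t \<alpha>))
        - deriv (\<lambda>K. Fh (q I t \<alpha>) K) I * deriv (\<lambda>s. H1 (q I t \<alpha>) I s) (theta_of H0 q I t \<alpha> + \<theta>)" for t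
  have N: "frechet_derivative (G 0) (at (c t)) (X1 (c t)) = N t" for t
    using G0_der[OF cS[of t, unfolded c_def]] by (simp add: c_def X1_def N_def)
  have int: "(LBINT t=a..b. N t) = g1 (c a) - g1 (c b)" if ab: "a \<le> b" for a b :: real
  proof -
    have k: "continuous_on {a..b} N \<and> integral {a..b} N = g1 (c a) - g1 (c b)"
      using g1_var[rule_format, OF c' cS X1c ab] unfolding N by simp
    have "set_integrable lborel {a..b} N" by (rule borel_integrable_atLeastAtMost'[OF conjunct1[OF k]])
    from interval_integral_eq_integral[OF ab this] show ?thesis unfolding conjunct2[OF k] .
  qed
  have limS: "(xe I, I, \<theta>) \<in> S" using limit by (simp add: S_def angle_lift_def)
  have g1_lim: "(\<lambda>j. g1 (c (s j))) \<longlonglongrightarrow> g1 (xe I, I, \<theta>)"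
    if s: "(\<lambda>j. q I (s j) \<alpha>) \<longlonglongrightarrow> xe I" and sz: "\<And>j. \<exists>n::int. theta_of H0 q I (s j) \<alpha> = 2 * pi * n" for s :: "nat \<Rightarrow> real"
  proof -
    have eq: "g1 (c (s j)) = g1 (q I (s j) \<alpha>, I, \<theta>)" for j
    proof -
      obtain n :: int where n: "theta_of H0 q I (s j) \<alpha> = 2 * pi * n" using sz by blast
      have "(q I (s j) \<alpha>, I, \<theta> + 2 * pi * of_int n) \<in> S" using cS[of "s j"] n by (simp add: c_def add.commute)
      then have "(q I (s j) \<alpha>, I, \<theta>) \<in> S" by (simp only: S_shift)
      from g1_int[OF this, of n] show ?thesis by (simp add: c_def n)
    qed
    have "(\<lambda>j. (q I (s j) \<alpha>, I, \<theta>)) \<longlonglongrightarrow> (xe I, I, \<theta>)" by (intro tendsto_intros s)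
    moreover have "isCont g1 (xe I, I, \<theta>)" using g1(1) S limS by (simp add: continuous_on_eq_continuous_at)
    ultimately show ?thesis unfolding eq by (intro isCont_tendsto_compose[of _ g1])
  qed
  have top: "filterlim (\<lambda>j::nat. \<tau> (int j)) at_top sequentially"
    by (rule filterlim_compose[OF \<tau>_lim(1) filterlim_int_sequentially])
  have bot: "filterlim (\<lambda>j::nat. \<tau> (- int j)) at_bot sequentially"
  proof (rule filterlim_compose[OF \<tau>_lim(2)])
    show "filterlim (\<lambda>j::nat. - int j) at_bot sequentially"
      unfolding filterlim_at_bot
    proof
      fix Z :: int
      show "\<forall>\<^sub>F j in sequentially. - int j \<le> Z"
        using eventually_ge_at_top[of "nat (- Z)"] by eventually_elim linarith
    qed
  qed
  have lims: "((\<lambda>t. q I t \<alpha>) \<longlongrightarrow> xe I) at_top" "((\<lambda>t. q I t \<alpha>) \<longlongrightarrow> xe I) at_bot"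
    using homoclinic[OF I \<alpha>] unfolding homoclinic_orbit_def by auto
  have "(\<lambda>j. g1 (c (\<tau> (- int j))) - g1 (c (\<tau> (int j)))) \<longlonglongrightarrow> g1 (xe I, I, \<theta>) - g1 (xe I, I, \<theta>)"
    by (intro tendsto_diff g1_lim filterlim_compose[OF lims(1) top] filterlim_compose[OF lims(2) bot] \<tau>_zero)
  moreover have "\<forall>\<^sub>F j in sequentially. g1 (c (\<tau> (- int j))) - g1 (c (\<tau> (int j))) = (LBINT t=\<tau> (- int j)..\<tau> (int j). N t)"
    using top[unfolded filterlim_at_top, rule_format, of 0] bot[unfolded filterlim_at_bot, rule_format, of 0]
    by eventually_elim (simp add: int)
  ultimately have "(\<lambda>j. LBINT t=\<tau> (- int j)..\<tau> (int j). N t) \<longlonglongrightarrow> 0"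
    using Lim_transform_eventually by fastforce
  then show ?thesis unfolding N_def .
qed

end

section \<open>Vanishing of the Melnikov functions\<close>

theorem theorem4p9:
  fixes V :: "real set"
    and W :: "'a::real_inner set"
    and H0 :: "real ^ ('m::finite + 'm) \<Rightarrow> real \<Rightarrow> real"
    and H1 :: "real ^ ('m + 'm) \<Rightarrow> real \<Rightarrow> real \<Rightarrow> real"
    and F :: "nat \<Rightarrow> real ^ ('m + 'm) \<Rightarrow> real \<Rightarrow> real"
    and xe :: "real \<Rightarrow> real ^ ('m + 'm)"
    and q :: "real \<Rightarrow> real \<Rightarrow> 'a \<Rightarrow> real ^ ('m + 'm)"
    and T :: "real \<Rightarrow> 'a \<Rightarrow> int \<Rightarrow> real"
    and I\<^sub>0 \<theta>\<^sub>0 :: real and \<alpha>\<^sub>0 :: 'a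
  assumes dim_param: "has_dimension TYPE('a) (CARD('m) - 1)"
    and V: "open V" "is_interval V"
    and H0_smooth: "Ck_on 3 (\<lambda>(x, I). H0 x I) (UNIV \<times> V)"
    and H1_smooth: "Ck_on 3 (\<lambda>(x, I, \<theta>). H1 x I \<theta>) (UNIV \<times> V \<times> UNIV)"
    and H1_periodic: "\<And>x I \<theta>. I \<in> V \<Longrightarrow> H1 x I (\<theta> + 2 * pi) = H1 x I \<theta>"
    \<comment> \<open>(W1)\<close>
    and F_smooth: "\<And>j. j \<in> {1..CARD('m)} \<Longrightarrow> Ck_on 3 (\<lambda>(x, I). F j x I) (UNIV \<times> V)"
    and F_integral: "\<And>j I. j \<in> {1..CARD('m)} \<Longrightarrow> I \<in> V \<Longrightarrow>
          first_integral_on (xfield H0 I) (\<lambda>x. F j x I) UNIV"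
    and F_1: "\<And>x I. I \<in> V \<Longrightarrow> F 1 x I = H0 x I"
    and F_independent: "\<And>x I. I \<in> V \<Longrightarrow> xfield H0 I x \<noteq> 0 \<Longrightarrow>
          inj_on (\<lambda>j. grad (\<lambda>y. F j y I) x) {1..CARD('m)} \<and>
          independent ((\<lambda>j. grad (\<lambda>y. F j y I) x) ` {1..CARD('m)})"
    and F_involution: "\<And>i j x I. i \<in> {1..CARD('m)} \<Longrightarrow> j \<in> {1..CARD('m)} \<Longrightarrow> I \<in> V \<Longrightarrow>
          grad (\<lambda>y. F i y I) x \<bullet> (J2m *v grad (\<lambda>y. F j y I) x) = 0"
    \<comment> \<open>(W2)\<close>
    and W: "open W" "connected W"
    and equilibrium: "\<And>I. I \<in> V \<Longrightarrow> hyperbolic_equilibrium (xfield H0 I) (xe I)"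
    and homoclinic: "\<And>I \<alpha>. I \<in> V \<Longrightarrow> \<alpha> \<in> W \<Longrightarrow>
          homoclinic_orbit (xfield H0 I) (xe I) (\<lambda>t. q I t \<alpha>)"
    and xe_smooth: "Ck_on 2 xe V"
    and q_smooth: "Ck_on 2 (\<lambda>(t, I, \<alpha>). q I t \<alpha>) (UNIV \<times> V \<times> W)"
    \<comment> \<open>(W3)\<close>
    and W3: "\<And>I \<alpha> t. I \<in> V \<Longrightarrow> \<alpha> \<in> W \<Longrightarrow> deriv (\<lambda>K. H0 (q I t \<alpha>) K) I > 0"
    \<comment> \<open>the sequences used to define the Melnikov functions\<close>
    and T_zero: "\<And>I \<alpha> j. I \<in> V \<Longrightarrow> \<alpha> \<in> W \<Longrightarrow> \<exists>n::int. theta_of H0 q I (T I \<alpha> j) \<alpha> = 2 * pi * n"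
    and T_lim: "\<And>I \<alpha>. I \<in> V \<Longrightarrow> \<alpha> \<in> W \<Longrightarrow> filterlim (T I \<alpha>) at_top at_top"
               "\<And>I \<alpha>. I \<in> V \<Longrightarrow> \<alpha> \<in> W \<Longrightarrow> filterlim (T I \<alpha>) at_bot at_bot"
    and base_point: "I\<^sub>0 \<in> V" "\<alpha>\<^sub>0 \<in> W"
  defines "\<Gamma> \<equiv> range (\<lambda>t. (q I\<^sub>0 t \<alpha>\<^sub>0, I\<^sub>0, cis (theta_of H0 q I\<^sub>0 t \<alpha>\<^sub>0 + \<theta>\<^sub>0)))"
    and "\<gamma> \<equiv> range (\<lambda>\<theta>. (xe I\<^sub>0, I\<^sub>0, cis \<theta>))"
  shows "(\<forall>k\<in>{2..CARD('m)}. has_first_integral_near V H0 H1 (F k) (\<Gamma> \<union> \<gamma>) \<longrightarrow>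
            (\<exists>P. openin (top_of_set (V \<times> sphere 0 1 \<times> W)) P \<and> connected P \<and>
               (I\<^sub>0, cis \<theta>\<^sub>0, \<alpha>\<^sub>0) \<in> P \<and>
               (\<forall>I \<theta> \<alpha>. (I, cis \<theta>, \<alpha>) \<in> P \<longrightarrow>
                  convergent (melnikov_seq H0 H1 (F k) q T I \<theta> \<alpha>) \<and>
                  melnikov H0 H1 (F k) q T I \<theta> \<alpha> = 0)))
       \<and> (has_first_integral_near V H0 H1 (\<lambda>x I. I) (\<Gamma> \<union> \<gamma>) \<longrightarrow>
            (\<exists>P. openin (top_of_set (V \<times> sphere 0 1 \<times> W)) P \<and> connected P \<and>
               (I\<^sub>0, cis \<theta>\<^sub>0, \<alpha>\<^sub>0) \<in> P \<and>
               (\<forall>I \<theta> \<alpha>. (I, cis \<theta>, \<alpha>) \<in> P \<longrightarrow>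
                  convergent (melnikov1_seq H0 H1 q T I \<theta> \<alpha>) \<and>
                  melnikov1 H0 H1 q T I \<theta> \<alpha> = 0)))"
proof -
  interpret integrable_homoclinics V W H0 F xe q
  proof (rule integrable_homoclinics.intro)
    show "continuous_on V xe" using xe_smooth by (rule Ck_on_continuous_on)
    show "continuous_on (UNIV \<times> V \<times> W) (\<lambda>(t, I, \<alpha>). q I t \<alpha>)" using q_smooth by (rule Ck_on_continuous_on)
  qed (fact V(1) W(1) H0_smooth F_smooth F_integral F_1 F_independent F_involution equilibrium homoclinic)+
  have key: "\<exists>P. openin (top_of_set (V \<times> sphere 0 1 \<times> W)) P \<and> connected P \<and> (I\<^sub>0, cis \<theta>\<^sub>0, \<alpha>\<^sub>0) \<in> P \<and>
      (\<forall>I \<theta> \<alpha>. (I, cis \<theta>, \<alpha>) \<in> P \<longrightarrow> melnikov_seq H0 H1 Fh q T I \<theta> \<alpha> \<longlonglongrightarrow> 0)"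
    if near: "has_first_integral_near V H0 H1 Fh (\<Gamma> \<union> \<gamma>)"
      and Fh: "Ck_on (Suc 0) (\<lambda>(x, I). Fh x I) (UNIV \<times> V)" for Fh
  proof -
    obtain e1 U G where e1: "e1 > 0" and U: "openin (top_of_set (UNIV \<times> V \<times> sphere 0 1)) U" "\<Gamma> \<union> \<gamma> \<subseteq> U"
      and G: "\<forall>e\<in>{0..<e1}. (\<forall>(x, I, \<theta>)\<in>angle_lift U. G e (x, I, \<theta> + 2 * pi) = G e (x, I, \<theta>)) \<and>
           Ck_on 3 (G e) (angle_lift U) \<and> first_integral_on (full_field H0 H1 e) (G e) (angle_lift U)"
        "Ck_on 2 (\<lambda>(e, z). G e z) ({0..<e1} \<times> angle_lift U)"
        "\<forall>(x, I, \<theta>)\<in>angle_lift U. (\<lambda>e. G e (x, I, \<theta>) - Fh x I) \<in> O[at_right 0](\<lambda>e. e)"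
      using near unfolding has_first_integral_near_def by (elim exE conjE bexE)
    have G1: "Ck_on (Suc 0) (\<lambda>(e, z). G e z) ({0..<e1} \<times> angle_lift U)"
      by (rule Ck_on_SucD) (use G(2) in \<open>simp only: numeral_2_eq_2\<close>)
    have "(q I\<^sub>0 t \<alpha>\<^sub>0, I\<^sub>0, cis (theta_of H0 q I\<^sub>0 t \<alpha>\<^sub>0 + \<theta>\<^sub>0)) \<in> U" for t using U(2) by (auto simp: \<Gamma>_def)
    moreover have "(xe I\<^sub>0, I\<^sub>0, cis \<theta>) \<in> U" for \<theta> using U(2) by (auto simp: \<gamma>_def)
    ultimately obtain d where d: "d > 0" and stay: "\<forall>I \<alpha> \<theta>. dist I I\<^sub>0 < d \<longrightarrow> dist \<alpha> \<alpha>\<^sub>0 < d \<longrightarrow> dist (cis \<theta>) (cis \<theta>\<^sub>0) < d \<longrightarrow>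
        I \<in> V \<and> \<alpha> \<in> W \<and> (\<forall>t. (q I t \<alpha>, I, cis (theta_of H0 q I t \<alpha> + \<theta>)) \<in> U) \<and> (xe I, I, cis \<theta>) \<in> U"
      using orbits_stay[OF base_point U(1), of \<theta>\<^sub>0] by auto
    have "openin (top_of_set (sphere 0 1)) (sphere 0 1 \<inter> ball (cis \<theta>\<^sub>0) d)" by (intro openin_open_Int) simp
    moreover have "cis \<theta>\<^sub>0 \<in> sphere 0 1 \<inter> ball (cis \<theta>\<^sub>0) d" using d by simp
    \<comment> \<open>local connectedness of the circle provides a connected arc around the base angle\<close>
    ultimately obtain A where A: "openin (top_of_set (sphere 0 1)) A" "connected A" "cis \<theta>\<^sub>0 \<in> A"
        "A \<subseteq> sphere 0 1 \<inter> ball (cis \<theta>\<^sub>0) d"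
      using locally_connected_sphere[of "0::complex" 1] unfolding locally_connected by meson
    have near_V: "ball I\<^sub>0 d \<subseteq> V" and near_W: "ball \<alpha>\<^sub>0 d \<subseteq> W"
      using stay[rule_format, of _ \<alpha>\<^sub>0 \<theta>\<^sub>0] stay[rule_format, of I\<^sub>0 _ \<theta>\<^sub>0] d by (auto simp: dist_commute)
    show ?thesis
    proof (intro exI[of _ "ball I\<^sub>0 d \<times> A \<times> ball \<alpha>\<^sub>0 d"] conjI allI impI)
      have "openin (top_of_set V) (ball I\<^sub>0 d)" "openin (top_of_set W) (ball \<alpha>\<^sub>0 d)"
        using near_V near_W by (auto simp: openin_open)
      then show "openin (top_of_set (V \<times> sphere 0 1 \<times> W)) (ball I\<^sub>0 d \<times> A \<times> ball \<alpha>\<^sub>0 d)"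
        using A(1) by (intro openin_Times)
      show "connected (ball I\<^sub>0 d \<times> A \<times> ball \<alpha>\<^sub>0 d)"
        by (intro connected_Times A(2) convex_connected convex_ball)
      show "(I\<^sub>0, cis \<theta>\<^sub>0, \<alpha>\<^sub>0) \<in> ball I\<^sub>0 d \<times> A \<times> ball \<alpha>\<^sub>0 d" using d A(3) by simp
      fix I \<theta> \<alpha> assume P: "(I, cis \<theta>, \<alpha>) \<in> ball I\<^sub>0 d \<times> A \<times> ball \<alpha>\<^sub>0 d"
      have "dist I I\<^sub>0 < d" "dist \<alpha> \<alpha>\<^sub>0 < d" "dist (cis \<theta>) (cis \<theta>\<^sub>0) < d" using P A(4) by (auto simp: dist_commute)
      then have in_U: "I \<in> V" "\<alpha> \<in> W" "\<And>t. (q I t \<alpha>, I, cis (theta_of H0 q I t \<alpha> + \<theta>)) \<in> U" "(xe I, I, cis \<theta>) \<in> U"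
        using stay by auto
      show "melnikov_seq H0 H1 Fh q T I \<theta> \<alpha> \<longlonglongrightarrow> 0"
        unfolding melnikov_seq_def
      proof (rule melnikov_integral_tendsto_0[OF H1_smooth Fh U(1) e1 _ _ G1 _ in_U T_zero[OF in_U(1,2)] T_lim(1)[OF in_U(1,2)] T_lim(2)[OF in_U(1,2)]])
        show "G e (x, I', \<theta>' + 2 * pi) = G e (x, I', \<theta>')" if "e \<in> {0..<e1}" "(x, I', \<theta>') \<in> angle_lift U" for e x I' \<theta>'
          using G(1) that by fast
        show "first_integral_on (full_field H0 H1 e) (G e) (angle_lift U)" if "e \<in> {0..<e1}" for e
          using G(1) that by blast
        show "(\<lambda>e. G e (x, I', \<theta>') - Fh x I') \<in> O[at_right 0](\<lambda>e. e)" if "(x, I', \<theta>') \<in> angle_lift U" for x I' \<theta>'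
          using G(3) that by fast
      qed
    qed
  qed
  have limD: "convergent s \<and> lim s = 0" if "s \<longlonglongrightarrow> 0" for s :: "nat \<Rightarrow> real"
    using that limI convergentI by blast
  \<comment> \<open>for \<open>Fh = I\<close> the gradient in \<open>x\<close> vanishes and the derivative in \<open>I\<close> is 1\<close>
  have action: "melnikov1_seq H0 H1 q T I \<theta> \<alpha> = (\<lambda>j. - melnikov_seq H0 H1 (\<lambda>x I. I) q T I \<theta> \<alpha> j)" for I \<theta> \<alpha>
  proof -
    have "grad (\<lambda>y :: real ^ ('m + 'm). I) x = 0" for x
      by (rule grad_unique) simp
    then show ?thesis
      by (simp add: fun_eq_iff melnikov1_seq_def melnikov_seq_def interval_lebesgue_integral_uminus)
  qed
  show ?thesis
  proof (intro conjI ballI impI)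
    fix k assume k: "k \<in> {2..CARD('m)}" and near: "has_first_integral_near V H0 H1 (F k) (\<Gamma> \<union> \<gamma>)"
    have "Ck_on (Suc 0) (\<lambda>(x, I). F k x I) (UNIV \<times> V)"
      by (rule Ck_on_SucD, rule Ck_on_SucD) (use F_smooth[of k] k in \<open>simp only: numeral_3_eq_3, simp\<close>)
    from key[OF near this] obtain P where P: "openin (top_of_set (V \<times> sphere 0 1 \<times> W)) P" "connected P"
      "(I\<^sub>0, cis \<theta>\<^sub>0, \<alpha>\<^sub>0) \<in> P"
      "\<forall>I \<theta> \<alpha>. (I, cis \<theta>, \<alpha>) \<in> P \<longrightarrow> melnikov_seq H0 H1 (F k) q T I \<theta> \<alpha> \<longlonglongrightarrow> 0"
      by (elim exE conjE)
    then show "\<exists>P. openin (top_of_set (V \<times> sphere 0 1 \<times> W)) P \<and> connected P \<and> (I\<^sub>0, cis \<theta>\<^sub>0, \<alpha>\<^sub>0) \<in> P \<and>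
        (\<forall>I \<theta> \<alpha>. (I, cis \<theta>, \<alpha>) \<in> P \<longrightarrow> convergent (melnikov_seq H0 H1 (F k) q T I \<theta> \<alpha>) \<and>
           melnikov H0 H1 (F k) q T I \<theta> \<alpha> = 0)"
      unfolding melnikov_def using limD by (intro exI[of _ P] conjI allI impI) auto
  next
    assume near: "has_first_integral_near V H0 H1 (\<lambda>x I. I) (\<Gamma> \<union> \<gamma>)"
    have "Ck_on (Suc 0) (\<lambda>(x :: real ^ ('m + 'm), I). I) (UNIV \<times> V)"
      unfolding Ck_on.simps case_prod_beta
      by (intro exI[of _ "\<lambda>v z. snd v"]) (auto intro!: derivative_eq_intros continuous_intros)
    from key[OF near this] obtain P where P: "openin (top_of_set (V \<times> sphere 0 1 \<times> W)) P" "connected P"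
      "(I\<^sub>0, cis \<theta>\<^sub>0, \<alpha>\<^sub>0) \<in> P"
      "\<forall>I \<theta> \<alpha>. (I, cis \<theta>, \<alpha>) \<in> P \<longrightarrow> melnikov_seq H0 H1 (\<lambda>x I. I) q T I \<theta> \<alpha> \<longlonglongrightarrow> 0"
      by (elim exE conjE)
    have "melnikov1_seq H0 H1 q T I \<theta> \<alpha> \<longlonglongrightarrow> 0" if "(I, cis \<theta>, \<alpha>) \<in> P" for I \<theta> \<alpha>
      unfolding action using tendsto_minus[OF P(4)[rule_format, OF that]] by simp
    then show "\<exists>P. openin (top_of_set (V \<times> sphere 0 1 \<times> W)) P \<and> connected P \<and> (I\<^sub>0, cis \<theta>\<^sub>0, \<alpha>\<^sub>0) \<in> P \<and>
        (\<forall>I \<theta> \<alpha>. (I, cis \<theta>, \<alpha>) \<in> P \<longrightarrow> convergent (melnikov1_seq H0 H1 q T I \<theta> \<alpha>) \<and>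
           melnikov1 H0 H1 q T I \<theta> \<alpha> = 0)"
      unfolding melnikov1_def using P(1,2,3) limD by (intro exI[of _ P] conjI allI impI) auto
  qed
qed

end
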